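(* Given an instance $(D,v^* )$ of TFP, the problem can be solved in time $2^{\mathcal{O}(s\log s)}\cdot n^{\mathcal{O}(1)}$, where $n=|V(D)|$ and $s$ is the sum of the sfas-in number and the sfas-out number of $(D,v^* )$.
   Context: A tournament is a digraph with exactly one arc between every pair of distinct vertices; $(u,v)$ means $u$ beats $v$. TFP: given a tournament $D$ with $|V(D)|$ a power of two and a player $v^*$, decide whether there is a seeding of a balanced knockout tournament (complete binary tree with $|V(D)|$ leaves, in each round sibling winners play and the winner according to $D$ advances) under which $v^*$ is the champion. The sfas-in (resp. sfas-out) number of $(D,v^* )$ is the minimum number of arcs of $D$ whose reversal yields a digraph in which no directed cycle contains a vertex of $N_{\mathrm{in}}(v^* )$ (resp. $N_{\mathrm{out}}(v^* )$), where $N_{\mathrm{in}}(v^* )$, $N_{\mathrm{out}}(v^* )$ are the in- and out-neighborhoods of $v^*$. *)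

theory Defs
  imports Complex_Main
begin

text \<open>D u v means u beats v; the vertex set is {0..<n}.\<close>
definition tournament :: "nat \<Rightarrow> (nat \<Rightarrow> nat \<Rightarrow> bool) \<Rightarrow> bool" where
  "tournament n D \<longleftrightarrow>
     (\<forall>u v. D u v \<longrightarrow> u < n \<and> v < n \<and> u \<noteq> v) \<and>
     (\<forall>u<n. \<forall>v<n. u \<noteq> v \<longrightarrow> (D u v \<longleftrightarrow> \<not> D v u))"

definition arcs :: "(nat \<Rightarrow> nat \<Rightarrow> bool) \<Rightarrow> (nat \<times> nat) set" where
  "arcs D = {(u, v). D u v}"

text \<open>Winner of the balanced knockout on the block of 2^k leaves starting at leaf i,
  where seeding s assigns a player to each leaf; sibling blocks are adjacent.\<close>
fun ko_winner :: "(nat \<Rightarrow> nat \<Rightarrow> bool) \<Rightarrow> (nat \<Rightarrow> nat) \<Rightarrow> nat \<Rightarrow> nat \<Rightarrow> nat" where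
  "ko_winner D s 0 i = s i"
| "ko_winner D s (Suc k) i =
     (let a = ko_winner D s k i; b = ko_winner D s k (i + 2 ^ k) in
      if D a b then a else b)"

definition TFP :: "nat \<Rightarrow> nat \<Rightarrow> (nat \<Rightarrow> nat \<Rightarrow> bool) \<Rightarrow> nat \<Rightarrow> bool" where
  "TFP k n D v \<longleftrightarrow>
     (\<exists>s. bij_betw s {0..<2 ^ k} {0..<n} \<and> ko_winner D s k 0 = v)"

definition reverse_arcs :: "(nat \<times> nat) set \<Rightarrow> (nat \<times> nat) set \<Rightarrow> (nat \<times> nat) set" where
  "reverse_arcs A F = (A - F) \<union> converse F"

definition sfas_num :: "(nat \<Rightarrow> nat \<Rightarrow> bool) \<Rightarrow> nat set \<Rightarrow> nat" where
  "sfas_num D S = (LEAST c. \<exists>F. F \<subseteq> arcs D \<and> card F = c \<and>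
                     (\<forall>u\<in>S. (u, u) \<notin> (reverse_arcs (arcs D) F)\<^sup>+))"

definition N_in :: "(nat \<Rightarrow> nat \<Rightarrow> bool) \<Rightarrow> nat \<Rightarrow> nat set" where
  "N_in D v = {u. D u v}"

definition N_out :: "(nat \<Rightarrow> nat \<Rightarrow> bool) \<Rightarrow> nat \<Rightarrow> nat set" where
  "N_out D v = {u. D v u}"

definition sfas_in :: "(nat \<Rightarrow> nat \<Rightarrow> bool) \<Rightarrow> nat \<Rightarrow> nat" where
  "sfas_in D v = sfas_num D (N_in D v)"

definition sfas_out :: "(nat \<Rightarrow> nat \<Rightarrow> bool) \<Rightarrow> nat \<Rightarrow> nat" where
  "sfas_out D v = sfas_num D (N_out D v)"

text \<open>Symbols are naturals < alph; 0 is blank, input uses 1,2,3.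
  delta q a = (q', b, m): new state, written symbol, head move m in {-1,0,1}.\<close>
record tm =
  states :: nat
  alph :: nat
  delta :: "nat \<Rightarrow> nat \<Rightarrow> nat \<times> nat \<times> int"
  start :: nat
  acc :: nat
  rej :: nat

definition wf_tm :: "tm \<Rightarrow> bool" where
  "wf_tm M \<longleftrightarrow> start M < states M \<and> acc M < states M \<and> rej M < states M \<and>
     acc M \<noteq> rej M \<and> 4 \<le> alph M \<and>
     (\<forall>q<states M. \<forall>a<alph M. (case delta M q a of (q', b, m) \<Rightarrow>
        q' < states M \<and> b < alph M \<and> m \<in> {-1, 0, 1}))"

type_synonym config = "nat \<times> (int \<Rightarrow> nat) \<times> int"

definition tm_step :: "tm \<Rightarrow> config \<Rightarrow> config" where
  "tm_step M c = (case c of (q, tp, h) \<Rightarrow>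
     if q = acc M \<or> q = rej M then c
     else (case delta M q (tp h) of (q', b, m) \<Rightarrow> (q', tp(h := b), h + m)))"

definition tm_init :: "tm \<Rightarrow> nat list \<Rightarrow> config" where
  "tm_init M w = (start M, (\<lambda>i. if 0 \<le> i \<and> nat i < length w then w ! nat i else 0), 0)"

definition tm_run :: "tm \<Rightarrow> nat \<Rightarrow> nat list \<Rightarrow> config" where
  "tm_run M t w = (tm_step M ^^ t) (tm_init M w)"

definition decides_within :: "tm \<Rightarrow> nat list \<Rightarrow> nat \<Rightarrow> bool \<Rightarrow> bool" where
  "decides_within M w t b \<longleftrightarrow>
     (\<exists>t'\<le>t. (fst (tm_run M t' w) = acc M \<or> fst (tm_run M t' w) = rej M) \<and>
              (fst (tm_run M t' w) = acc M \<longleftrightarrow> b))"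

definition encode :: "nat \<Rightarrow> (nat \<Rightarrow> nat \<Rightarrow> bool) \<Rightarrow> nat \<Rightarrow> nat list" where
  "encode n D v =
     concat (map (\<lambda>i. map (\<lambda>j. if D i j then 1 else 2) [0..<n]) [0..<n]) @ [3] @ replicate v 1"

end

theory Submission
  imports Defs
begin

text \<open>
  Let \<open>F\<^sub>1\<close> and \<open>F\<^sub>2\<close> realise the two sfas numbers. Every cycle of \<open>D\<close> contains an in- or an out-neighbour
  of \<open>v\<close>, so deleting \<open>F\<^sub>1 \<union> F\<^sub>2\<close> destroys all cycles, and some linear order of the players has at most \<open>s\<close>
  back arcs. Call \<open>v\<close> and the endpoints of the back arcs affected; an unaffected player beats exactly
  the players behind it in the order.

  Read from the final backwards, a knockout tournament won by \<open>v\<close> is a chain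
  \<open>{v} = S\<^sub>0 \<subset> S\<^sub>1 \<subset> \<dots> \<subset> S\<^sub>k = V\<close> in which every \<open>S\<^sub>j\<close> is matched along arcs onto \<open>S\<^sub>j\<^sub>+\<^sub>1 - S\<^sub>j\<close>.
  For every affected player guess the stage at which it enters, and which affected player beats it
  there or that an unaffected one does. Everything else is greedy: an affected player takes the
  latest available unaffected player in front of it as its parent, and every remaining parent takes
  the earliest free unaffected player behind it. By counting along the order, the greedy choice keeps
  at least as many early players in the tournament as any solution with the same guesses.

  A linear order with few back arcs is found by branching on the three arcs of cyclic triangles.
  There are at most \<open>4\<^sup>s\<close> branches and \<open>(2 s + 1)\<^sup>2\<^sup>s\<^sup>+\<^sup>1 (k + 1)\<^sup>2\<^sup>s\<^sup>+\<^sup>1\<close> guesses, where \<open>n = 2\<^sup>k\<close>, and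
  \<open>(k + 1)\<^sup>s \<le> s! 2\<^sup>k\<^sup>+\<^sup>1\<^sup>+\<^sup>s\<close> bounds this by a polynomial in \<open>n\<close> and \<open>(s + 2)\<^sup>s\<close>.

  The algorithm is a program over counters and bit arrays. A Turing machine keeps each array on a
  track of its tape and each counter as a mark on a track of its own, which costs a quadratic factor.
\<close>

section \<open>Counter programs on Turing machines\<close>

text \<open>The number \<open>s\<close> is never computed, so no search depth can be fixed in
  advance. The branching is therefore driven by a digit string: digit 0 leaves the tournament alone,
  digits 1 to 3 select an arc of the current triangle. Read as numbers in base 4 with position 0
  least significant, the strings supported on the first \<open>b\<close> positions precede all
  others. A search that stops at the first success thus adapts to every order with \<open>b\<close>
  back arcs, and the string it stops at has at most \<open>b\<close> nonzero digits.

  The chain of sets makes the rounds of the knockout independent: only the set of entered players is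
  handed on. Two such sets are compared by the number of their unaffected members before each rank.
  Early players are the valuable parents, so an affected player uses up the latest parent that will
  do, and every other parent brings in the earliest player it can.

  Apart from two loops, one over branchings and one over guesses, the program consists of loops of
  length \<open>n\<close> in fixed nesting. All superpolynomial cost is in the number of rounds of
  these two.\<close>

record store =
  cnt :: "nat \<Rightarrow> nat"
  arr :: "nat \<Rightarrow> nat \<Rightarrow> bool"

definition setc :: "nat \<Rightarrow> nat \<Rightarrow> store \<Rightarrow> store" where
  "setc x i s = s\<lparr>cnt := (cnt s)(x := i)\<rparr>"

definition seta :: "nat \<Rightarrow> nat \<Rightarrow> bool \<Rightarrow> store \<Rightarrow> store" where
  "seta a i b s = s\<lparr>arr := (arr s)(a := (arr s a)(i := b))\<rparr>"

lemma cnt_setc [simp]: "cnt (setc x i s) = (cnt s)(x := i)"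
  and arr_setc [simp]: "arr (setc x i s) = arr s"
  and cnt_seta [simp]: "cnt (seta a i b s) = cnt s"
  and arr_seta [simp]: "arr (seta a i b s) = (arr s)(a := (arr s a)(i := b))"
  by (simp_all add: setc_def seta_def)

datatype track = Arr nat | Cnt nat

fun tval :: "store \<Rightarrow> track \<Rightarrow> nat \<Rightarrow> bool" where
  "tval s (Arr a) p = arr s a p"
| "tval s (Cnt y) p = (cnt s y = p)"

text \<open>Every instruction concerns the cell marked by one counter, so one sweep from cell 0 to
  that mark and back carries it out. A \<open>Test\<close> on a track \<open>Cnt y\<close> asks
  whether two counters are equal, the only comparison of counters available at this level.\<close>

datatype instr = Zero nat | Inc nat | Write nat nat bool | Test nat track bool

fun eff :: "instr \<Rightarrow> store \<Rightarrow> store" where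
  "eff (Zero x) s = setc x 0 s"
| "eff (Inc x) s = setc x (Suc (cnt s x)) s"
| "eff (Write a x b) s = seta a (cnt s x) b s"
| "eff (Test x k b) s = s"

fun res :: "instr \<Rightarrow> store \<Rightarrow> bool" where
  "res (Test x k b) s = (tval s k (cnt s x) = b)"
| "res _ s = True"

datatype com = Done | Then com com (infixr ";;" 60) | Cond instr com com | Loop instr com

text \<open>The instruction attached to \<open>Done\<close> is the final test deciding acceptance.\<close>
fun act :: "com \<Rightarrow> instr" where
  "act Done = Test 0 (Arr 2) True"
| "act (Then c d) = act c"
| "act (Cond i c d) = i"
| "act (Loop i c) = i"

text \<open>Leaving the finished first half of a \<open>Then\<close> costs one step, spent on the
  test \<open>act Done\<close>, which changes nothing. This is the \<open>+ 1\<close> in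
  \<open>runs_Then\<close>.\<close>

fun nxt :: "com \<Rightarrow> bool \<Rightarrow> com" where
  "nxt Done b = Done"
| "nxt (Then c d) b = (if c = Done then d else Then (nxt c b) d)"
| "nxt (Cond i c d) b = (if b then c else d)"
| "nxt (Loop i c) b = (if b then Then c (Loop i c) else Done)"

definition step :: "com \<times> store \<Rightarrow> com \<times> store" where
  "step cs = (nxt (fst cs) (res (act (fst cs)) (snd cs)), eff (act (fst cs)) (snd cs))"

definition runs :: "com \<Rightarrow> store \<Rightarrow> nat \<Rightarrow> store \<Rightarrow> bool" where
  "runs c s t s' \<longleftrightarrow> (\<exists>k\<le>t. (step ^^ k) (c, s) = (Done, s'))"

lemma step_Done: "step (Done, s) = (Done, s)"
  by (simp add: step_def)

lemma steps_Done: "(step ^^ k) (Done, s) = (Done, s)"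
  by (induction k) (simp_all add: step_Done)

lemma steps_Then:
  "(step ^^ k) (c, s) = (Done, s1) \<Longrightarrow> \<exists>j\<le>Suc k. (step ^^ j) (Then c d, s) = (d, s1)"
proof (induction k arbitrary: c s)
  case 0
  then have "c = Done" "s1 = s" by auto
  then have "(step ^^ 1) (Then c d, s) = (d, s1)" by (simp add: step_def)
  then show ?case by (intro exI[of _ 1]) simp
next
  case (Suc k)
  show ?case
  proof (cases "c = Done")
    case True
    with Suc.prems have "s1 = s" by (simp only: steps_Done prod.inject)
    with True have "(step ^^ 1) (Then c d, s) = (d, s1)" by (simp add: step_def)
    then show ?thesis by (intro exI[of _ 1]) simp
  next
    case False
    obtain c' s' where cs: "step (c, s) = (c', s')" by force
    have "(step ^^ k) (c', s') = (Done, s1)"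
      using Suc.prems by (simp add: funpow_Suc_right cs del: funpow.simps)
    from Suc.IH[OF this] obtain j where j: "j \<le> Suc k" "(step ^^ j) (Then c' d, s') = (d, s1)"
      by blast
    have "step (Then c d, s) = (Then c' d, s')"
      using False cs by (auto simp: step_def)
    then have "(step ^^ Suc j) (Then c d, s) = (d, s1)"
      using j by (simp add: funpow_Suc_right del: funpow.simps)
    then show ?thesis using j(1) by (intro exI[of _ "Suc j"]) simp
  qed
qed

lemma runs_mono: "runs c s t s' \<Longrightarrow> t \<le> t' \<Longrightarrow> runs c s t' s'"
  unfolding runs_def by (meson le_trans)

lemma runs_Done: "runs Done s t s"
  unfolding runs_def by (rule exI[of _ 0]) simp

lemma runs_Then:
  assumes "runs c s t s1" "runs d s1 u s2"
  shows "runs (Then c d) s (t + u + 1) s2"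
proof -
  from assms obtain k l where k: "k \<le> t" "(step ^^ k) (c, s) = (Done, s1)"
    and l: "l \<le> u" "(step ^^ l) (d, s1) = (Done, s2)" unfolding runs_def by blast
  from steps_Then[OF k(2), of d] obtain j where "j \<le> Suc k" "(step ^^ j) (Then c d, s) = (d, s1)"
    by blast
  with l have "(step ^^ (l + j)) (Then c d, s) = (Done, s2)" by (simp add: funpow_add)
  then show ?thesis unfolding runs_def using k(1) l(1) \<open>j \<le> Suc k\<close>
    by (intro exI[of _ "l + j"]) simp
qed

lemma runs_step:
  assumes "step (c, s) = (c', s')" "runs c' s' t s''"
  shows "runs c s (t + 1) s''"
proof -
  from assms(2) obtain k where "k \<le> t" "(step ^^ k) (c', s') = (Done, s'')"
    unfolding runs_def by blast
  then show ?thesis unfolding runs_def using assms(1)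
    by (intro exI[of _ "Suc k"]) (simp add: funpow_Suc_right del: funpow.simps)
qed

lemma runs_Cond:
  assumes "runs (if res i s then c else d) (eff i s) t s'"
  shows "runs (Cond i c d) s (t + 1) s'"
  by (rule runs_step[OF _ assms]) (simp add: step_def)

abbreviation Do :: "instr \<Rightarrow> com" where "Do i \<equiv> Cond i Done Done"

lemma runs_Do: "runs (Do i) s 1 (eff i s)"
  using runs_Cond[of i s Done Done 0 "eff i s"] runs_Done[of "eff i s" 0] by simp

lemma runs_Loop_False:
  assumes "\<not> res i s" shows "runs (Loop i c) s 1 (eff i s)"
  using runs_step[of "Loop i c" s Done "eff i s" 0] assms runs_Done
  by (simp add: step_def)

lemma runs_Loop_True:
  assumes "res i s" "runs c (eff i s) t s1" "runs (Loop i c) s1 u s2"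
  shows "runs (Loop i c) s (t + u + 2) s2"
proof -
  have "step (Loop i c, s) = (Then c (Loop i c), eff i s)" using assms(1) by (simp add: step_def)
  from runs_step[OF this runs_Then[OF assms(2,3)]] show ?thesis by simp
qed

text \<open>The invariant is indexed by the round, so the exact number of rounds enters the bound.
  Besides its body a round costs two steps: the test of the loop and the step that leaves the
  finished body.\<close>

lemma runs_Loop:
  assumes body: "\<And>j s. j < k \<Longrightarrow> I j s \<Longrightarrow> res i s \<and> eff i s = s \<and> (\<exists>s'. runs c s t s' \<and> I (Suc j) s')"
    and exit: "\<And>s. I k s \<Longrightarrow> \<not> res i s \<and> eff i s = s"
    and "I 0 s"
  shows "\<exists>s'. runs (Loop i c) s (k * (t + 2) + 1) s' \<and> I k s'"
proof -
  have "j \<le> k \<Longrightarrow> I j s \<Longrightarrow> \<exists>s'. runs (Loop i c) s ((k - j) * (t + 2) + 1) s' \<and> I k s'" for j s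
  proof (induction "k - j" arbitrary: j s)
    case 0
    then have "j = k" by simp
    with 0 exit[of s] runs_Loop_False[of i s c] show ?case by auto
  next
    case (Suc d)
    then have jk: "j < k" by simp
    from body[OF jk Suc.prems(2)] obtain s1 where
      s1: "res i s" "eff i s = s" "runs c s t s1" "I (Suc j) s1" by blast
    have "d = k - Suc j" using Suc.hyps(2) by simp
    from Suc.hyps(1)[OF this _ s1(4)] jk obtain s2 where
      s2: "runs (Loop i c) s1 ((k - Suc j) * (t + 2) + 1) s2" "I k s2" by (meson Suc_leI)
    have "runs (Loop i c) s (t + ((k - Suc j) * (t + 2) + 1) + 2) s2"
      using runs_Loop_True[OF s1(1) _ s2(1), of t] s1(2,3) by simp
    moreover have "t + ((k - Suc j) * (t + 2) + 1) + 2 = (k - j) * (t + 2) + 1"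
      using jk by (simp add: Suc_diff_Suc[symmetric] del: diff_Suc_Suc)
    ultimately show ?case using s2(2) by auto
  qed
  from this[of 0 s] assms(3) show ?thesis by simp
qed

section \<open>Finitely many continuations as machine states\<close>

fun resid :: "com \<Rightarrow> com set" where
  "resid Done = {Done}"
| "resid (Then c d) = (\<lambda>c'. Then c' d) ` resid c \<union> resid d"
| "resid (Cond i c d) = {Cond i c d} \<union> resid c \<union> resid d"
| "resid (Loop i c) = {Loop i c, Done} \<union> (\<lambda>c'. Then c' (Loop i c)) ` resid c"

lemma finite_resid: "finite (resid c)"
  by (induction c) auto

lemma self_resid: "c \<in> resid c"
  by (induction c) auto

text \<open>Closure under \<open>nxt\<close> means that the set contains every command that can
  remain while \<open>c\<close> runs. With \<open>finite_resid\<close>, the remaining command can be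
  kept in the finite control of a machine.\<close>

lemma nxt_resid: "d \<in> resid c \<Longrightarrow> nxt d b \<in> resid c"
proof (induction c arbitrary: d)
  case (Then c1 c2)
  then show ?case using self_resid[of c2] by auto
next
  case (Cond i c1 c2)
  then show ?case using self_resid[of c1] self_resid[of c2] by auto
next
  case (Loop i c)
  have "Then c (Loop i c) \<in> resid (Loop i c)" using self_resid[of c] by simp
  moreover have "nxt (Then c' (Loop i c)) b \<in> resid (Loop i c)" if "c' \<in> resid c" for c'
    using Loop.IH[OF that] by simp
  ultimately show ?case using Loop.prems by fastforce
qed auto

fun tok :: "nat \<Rightarrow> track \<Rightarrow> bool" where
  "tok K (Arr a) = (a < K)"
| "tok K (Cnt x) = (x < K)"

fun iok :: "nat \<Rightarrow> instr \<Rightarrow> bool" where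
  "iok K (Zero x) = (x < K)"
| "iok K (Inc x) = (x < K)"
| "iok K (Write a x b) = (a < K \<and> x < K)"
| "iok K (Test x k b) = (x < K \<and> tok K k)"

text \<open>The action of \<open>Done\<close> reads array 2. Hence \<open>2 < K\<close> is demanded
  at the two constructors that contribute \<open>Done\<close> itself to
  \<open>resid\<close>.\<close>

fun cok :: "nat \<Rightarrow> com \<Rightarrow> bool" where
  "cok K Done = (2 < K)"
| "cok K (Then c d) = (cok K c \<and> cok K d)"
| "cok K (Cond i c d) = (iok K i \<and> cok K c \<and> cok K d)"
| "cok K (Loop i c) = (2 < K \<and> iok K i \<and> cok K c)"

lemma iok_mono: "iok K i \<Longrightarrow> K \<le> K' \<Longrightarrow> iok K' i"
proof (cases i)
  case (Test x k b)
  then show "iok K i \<Longrightarrow> K \<le> K' \<Longrightarrow> iok K' i" by (cases k) auto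
qed auto

lemma cok_mono: "cok K c \<Longrightarrow> K \<le> K' \<Longrightarrow> cok K' c"
  by (induction c) (auto intro: iok_mono)

lemma ex_iok: "\<exists>K. iok K i"
proof (cases i)
  case (Zero x)
  then show ?thesis by (intro exI[of _ "Suc x"]) auto
next
  case (Inc x)
  then show ?thesis by (intro exI[of _ "Suc x"]) auto
next
  case (Write a x b)
  then show ?thesis by (intro exI[of _ "Suc (a + x)"]) auto
next
  case (Test x k b)
  then show ?thesis
    by (cases k; intro exI[of _ "Suc (x + (case k of Arr a \<Rightarrow> a | Cnt a \<Rightarrow> a))"]) auto
qed

lemma ex_cok: "\<exists>K. cok K c"
proof (induction c)
  case Done
  then show ?case by (auto intro: exI[of _ 3])
next
  case (Then c d)
  then obtain K1 K2 where "cok K1 c" "cok K2 d" by blast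
  then have "cok (K1 + K2) (Then c d)" by (auto intro: cok_mono)
  then show ?case by blast
next
  case (Cond i c d)
  then obtain K1 K2 K3 where "cok K1 c" "cok K2 d" "iok K3 i" using ex_iok by blast
  then have "cok (K1 + K2 + K3) (Cond i c d)" by (auto intro: cok_mono iok_mono)
  then show ?case by blast
next
  case (Loop i c)
  then obtain K1 K3 where "cok K1 c" "iok K3 i" using ex_iok by blast
  then have "cok (K1 + K3 + 3) (Loop i c)" by (auto intro: cok_mono iok_mono)
  then show ?case by blast
qed

lemma cok_resid: "cok K c \<Longrightarrow> d \<in> resid c \<Longrightarrow> cok K d"
proof (induction c arbitrary: d)
  case Done
  then show ?case by simp
next
  case (Then c1 c2)
  from Then.prems(2) consider c' where "d = Then c' c2" "c' \<in> resid c1" | "d \<in> resid c2" by auto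
  then show ?case
  proof cases
    case 1
    then show ?thesis using Then.IH(1)[OF _ 1(2)] Then.prems(1) by simp
  next
    case 2
    then show ?thesis using Then.IH(2)[OF _ 2] Then.prems(1) by simp
  qed
next
  case (Cond i c1 c2)
  from Cond.prems(2) consider "d = Cond i c1 c2" | "d \<in> resid c1" | "d \<in> resid c2" by auto
  then show ?case
  proof cases
    case 1
    then show ?thesis using Cond.prems(1) by simp
  next
    case 2
    then show ?thesis using Cond.IH(1)[OF _ 2] Cond.prems(1) by simp
  next
    case 3
    then show ?thesis using Cond.IH(2)[OF _ 3] Cond.prems(1) by simp
  qed
next
  case (Loop i c1)
  from Loop.prems(2) consider "d = Loop i c1" | "d = Done" | c' where "d = Then c' (Loop i c1)" "c' \<in> resid c1" by auto
  then show ?case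
  proof cases
    case 3
    then show ?thesis using Loop.IH[OF _ 3(2)] Loop.prems(1) by simp
  qed (use Loop.prems(1) in simp_all)
qed

lemma iok_act: "cok K c \<Longrightarrow> iok K (act c)"
  by (induction c) auto

text \<open>Bit \<open>a\<close> of a tape symbol holds array \<open>a\<close>, bit \<open>K\<close> marks cell 0, and bit \<open>K + 1 + x\<close>
  marks the cell whose index is the value of counter \<open>x\<close>; thus the input symbols 1, 2, 3 are read
  as bits of the arrays 0 and 1.\<close>
fun tbit :: "nat \<Rightarrow> track \<Rightarrow> nat" where
  "tbit K (Arr a) = a"
| "tbit K (Cnt x) = K + 1 + x"

section \<open>Simulation by sweeps of the head\<close>

datatype control = Start | Scan com | Next com | Back com bool | Halt bool

fun ipos :: "instr \<Rightarrow> nat" where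
  "ipos (Zero x) = x"
| "ipos (Inc x) = x"
| "ipos (Write a x b) = x"
| "ipos (Test x k b) = x"

fun atmark :: "nat \<Rightarrow> com \<Rightarrow> nat \<Rightarrow> instr \<Rightarrow> control \<times> nat \<times> int" where
  "atmark K c a (Zero x) = (Back c True, unset_bit (K + 1 + x) a, 0)"
| "atmark K c a (Inc x) = (Next c, unset_bit (K + 1 + x) a, 1)"
| "atmark K c a (Write r x b) = (Back c True, (if b then set_bit r a else unset_bit r a), 0)"
| "atmark K c a (Test x k b) = (Back c (bit a (tbit K k) = b), a, 0)"

fun athome :: "nat \<Rightarrow> nat \<Rightarrow> instr \<Rightarrow> nat" where
  "athome K a (Zero x) = set_bit (K + 1 + x) a"
| "athome K a _ = a"

text \<open>\<open>Scan\<close> looks for the mark of the counter concerned, \<open>Next\<close> is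
  the additional move of \<open>Inc\<close>, and \<open>Back\<close> carries the outcome of the test
  home to cell 0. The mask at \<open>Start\<close> sets the bits \<open>K\<close> to
  \<open>2 * K\<close>: the mark of cell 0 and the marks of all counters, which start at 0.\<close>

fun trans :: "nat \<Rightarrow> com \<Rightarrow> control \<Rightarrow> nat \<Rightarrow> control \<times> nat \<times> int" where
  "trans K c0 Start a = (Scan c0, or a (push_bit K (mask (K + 1))), 0)"
| "trans K c0 (Scan c) a =
     (if bit a (K + 1 + ipos (act c)) then atmark K c a (act c) else (Scan c, a, 1))"
| "trans K c0 (Next c) a = (Back c True, set_bit (K + 1 + ipos (act c)) a, 0)"
| "trans K c0 (Back c b) a =
     (if bit a K then (if c = Done then Halt b else Scan (nxt c b), athome K a (act c), 0)
      else (Back c b, a, -1))"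
| "trans K c0 (Halt b) a = (Halt b, a, 0)"

definition astep :: "nat \<Rightarrow> com \<Rightarrow> control \<times> (int \<Rightarrow> nat) \<times> int \<Rightarrow> control \<times> (int \<Rightarrow> nat) \<times> int" where
  "astep K c0 = (\<lambda>(q, tp, h). case trans K c0 q (tp h) of (q', b, m) \<Rightarrow> (q', tp(h := b), h + m))"

text \<open>Only nonnegative cells are described, since the head turns at the mark of cell 0 and
  never gets to the left of it.\<close>

definition encodes :: "nat \<Rightarrow> store \<Rightarrow> (int \<Rightarrow> nat) \<Rightarrow> bool" where
  "encodes K s tp \<longleftrightarrow> (\<forall>p::nat. (\<forall>a<K. bit (tp (int p)) a = arr s a p) \<and>
     bit (tp (int p)) K = (p = 0) \<and> (\<forall>x<K. bit (tp (int p)) (K + 1 + x) = (cnt s x = p)))"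

lemma funpow_Suc_app: "(f ^^ Suc k) x = (f ^^ k) (f x)"
  by (simp add: funpow_Suc_right del: funpow.simps)

lemma scan_right:
  assumes "encodes K s tp" "ipos (act c) < K" "p \<le> cnt s (ipos (act c))"
  shows "(astep K c0 ^^ p) (Scan c, tp, 0) = (Scan c, tp, int p)"
  using assms(3)
proof (induction p)
  case (Suc p)
  have "\<not> bit (tp (int p)) (K + 1 + ipos (act c))"
    using assms(1,2) Suc.prems unfolding encodes_def by auto
  then show ?case using Suc by (simp add: astep_def)
qed simp

lemma scan_left:
  assumes "\<And>q. 0 < q \<Longrightarrow> q \<le> p \<Longrightarrow> \<not> bit (tp (int q)) K"
  shows "(astep K c0 ^^ p) (Back c b, tp, int p) = (Back c b, tp, 0)"
  using assms
proof (induction p)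
  case (Suc p)
  have "\<not> bit (tp (int (Suc p))) K" using Suc.prems by blast
  then have "astep K c0 (Back c b, tp, int (Suc p)) = (Back c b, tp, int p)"
    by (simp add: astep_def)
  then show ?case using Suc by (simp only: funpow_Suc_app) simp
qed simp

lemma back_home:
  assumes "\<And>q. bit (tp (int q)) K = (q = 0)"
  shows "(astep K c0 ^^ Suc p) (Back c b, tp, int p) =
    (if c = Done then Halt b else Scan (nxt c b), tp(0 := athome K (tp 0) (act c)), 0)"
proof -
  have "bit (tp 0) K" using assms[of 0] by simp
  then show ?thesis
    using scan_left[of p tp K c0 c b] assms
    by (simp add: astep_def)
qed

text \<open>With the counter at \<open>p\<close>, reaching its mark and acting there takes
  \<open>p + 1\<close> steps, and coming home takes another \<open>p + 1\<close>. \<open>Inc\<close>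
  is the worst case: one cell further to go, \<open>2 * p + 4\<close> steps in all.\<close>

lemma sim_instr:
  assumes enc: "encodes K s tp" and ok: "cok K c" and m: "\<And>x. x < K \<Longrightarrow> cnt s x \<le> m"
  shows "\<exists>t tp'. t \<le> 2 * m + 5 \<and> encodes K (eff (act c) s) tp' \<and>
    (astep K c0 ^^ t) (Scan c, tp, 0) =
      (if c = Done then Halt (res (act c) s) else Scan (nxt c (res (act c) s)), tp', 0)"
proof -
  define x where "x = ipos (act c)"
  define p where "p = cnt s x"
  have iok: "iok K (act c)" using ok by (rule iok_act)
  then have x: "x < K" unfolding x_def by (cases "act c") auto
  have pm: "p \<le> m" using m x p_def by simp
  have sc: "(astep K c0 ^^ p) (Scan c, tp, 0) = (Scan c, tp, int p)"
    by (rule scan_right[OF enc]) (use x in \<open>auto simp: x_def p_def\<close>)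
  have mark: "bit (tp (int p)) (K + 1 + x)" using enc x unfolding encodes_def p_def by auto
  have home: "bit (tp (int q)) K = (q = 0)" for q using enc unfolding encodes_def by auto
  have A: "bit (tp (int q)) a = arr s a q" if "a < K" for q a using enc that unfolding encodes_def by auto
  have C: "bit (tp (int q)) (K + 1 + y) = (cnt s y = q)" if "y < K" for q y
    using enc that unfolding encodes_def by auto
  have one: "(astep K c0 ^^ Suc p) (Scan c, tp, 0) =
    (case atmark K c (tp (int p)) (act c) of (q, b, d) \<Rightarrow> (q, tp(int p := b), int p + d))"
    using sc mark by (simp add: astep_def x_def)
  show ?thesis
  proof (cases "act c")
    case (Zero y)
    have y: "y = x" using Zero x_def by simp
    have ne: "c \<noteq> Done" using Zero by auto
    define tp1 where "tp1 = tp(int p := unset_bit (K + 1 + x) (tp (int p)))"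
    have s1: "(astep K c0 ^^ Suc p) (Scan c, tp, 0) = (Back c True, tp1, int p)"
      using one Zero y by (simp add: tp1_def)
    define tp2 where "tp2 = tp1(0 := athome K (tp1 0) (act c))"
    have h1: "bit (tp1 (int q)) K = (q = 0)" for q
      using home by (auto simp: tp1_def bit_unset_bit_iff)
    have "(astep K c0 ^^ (Suc p + Suc p)) (Scan c, tp, 0) =
       (if c = Done then Halt True else Scan (nxt c True), tp2, 0)"
      unfolding funpow_add comp_def s1 back_home[OF h1] tp2_def ..
    moreover have "bit (tp2 (int q)) j = (if j = K + 1 + x then q = 0 else bit (tp (int q)) j)" for q j
      using C[OF x, of q] unfolding tp2_def tp1_def Zero y
      by (cases "q = 0"; cases "q = p") (auto simp: bit_unset_bit_iff bit_set_bit_iff p_def)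
    then have "encodes K (eff (act c) s) tp2"
      using A C home x unfolding encodes_def Zero y by auto
    ultimately show ?thesis using pm Zero ne by (intro exI[of _ "Suc p + Suc p"] exI[of _ tp2]) simp
  next
    case (Inc y)
    have y: "y = x" using Inc x_def by simp
    have ne: "c \<noteq> Done" using Inc by auto
    define tp1 where "tp1 = tp(int p := unset_bit (K + 1 + x) (tp (int p)))"
    have s1: "(astep K c0 ^^ Suc p) (Scan c, tp, 0) = (Next c, tp1, int (Suc p))"
      using one Inc y by (simp add: tp1_def)
    define tp2 where "tp2 = tp1(int (Suc p) := set_bit (K + 1 + x) (tp1 (int (Suc p))))"
    have s2: "(astep K c0 ^^ (1 + Suc p)) (Scan c, tp, 0) = (Back c True, tp2, int (Suc p))"
      unfolding funpow_add comp_def s1 by (simp add: astep_def tp2_def Inc y)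
    have t2: "bit (tp2 (int q)) j = (if j = K + 1 + x then q = Suc p else bit (tp (int q)) j)" for q j
    proof -
      have "tp2 (int q) = (if q = Suc p then set_bit (K + 1 + x) (tp (int q))
         else if q = p then unset_bit (K + 1 + x) (tp (int q)) else tp (int q))"
        unfolding tp2_def tp1_def fun_upd_apply of_nat_eq_iff by simp
      then show ?thesis
        using C[OF x, of q] by (auto simp: bit_unset_bit_iff bit_set_bit_iff p_def)
    qed
    have h2: "bit (tp2 (int q)) K = (q = 0)" for q
      using home t2 by auto
    have "(astep K c0 ^^ (Suc (Suc p) + (1 + Suc p))) (Scan c, tp, 0) =
       (if c = Done then Halt True else Scan (nxt c True), tp2, 0)"
      unfolding funpow_add[of "Suc (Suc p)"] comp_def s2 back_home[OF h2] by (simp add: Inc)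
    moreover have "encodes K (eff (act c) s) tp2"
      using A C home x t2 unfolding encodes_def Inc y by (auto simp: p_def)
    ultimately show ?thesis using pm Inc ne
      by (intro exI[of _ "Suc (Suc p) + (1 + Suc p)"] exI[of _ tp2]) simp
  next
    case (Write r y b)
    have y: "y = x" using Write x_def by simp
    have ne: "c \<noteq> Done" using Write by auto
    have r: "r < K" using iok Write by simp
    define tp1 where "tp1 = tp(int p := if b then set_bit r (tp (int p)) else unset_bit r (tp (int p)))"
    have s1: "(astep K c0 ^^ Suc p) (Scan c, tp, 0) = (Back c True, tp1, int p)"
      using one Write y by (simp add: tp1_def)
    have h1: "bit (tp1 (int q)) K = (q = 0)" for q
      using home r by (auto simp: tp1_def bit_unset_bit_iff bit_set_bit_iff)
    have "(astep K c0 ^^ (Suc p + Suc p)) (Scan c, tp, 0) =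
       (if c = Done then Halt True else Scan (nxt c True), tp1, 0)"
      unfolding funpow_add comp_def s1 back_home[OF h1] by (simp add: Write)
    moreover have "bit (tp1 (int q)) j = (if j = r \<and> q = p then b else bit (tp (int q)) j)" for q j
      unfolding tp1_def by (auto simp: bit_unset_bit_iff bit_set_bit_iff)
    then have "encodes K (eff (act c) s) tp1"
      using A C home x r unfolding encodes_def Write y by (auto simp: p_def)
    ultimately show ?thesis using pm Write ne by (intro exI[of _ "Suc p + Suc p"] exI[of _ tp1]) simp
  next
    case (Test y k b)
    have y: "y = x" using Test x_def by simp
    have v: "bit (tp (int p)) (tbit K k) = tval s k (cnt s y)"
      using iok A C y unfolding Test p_def by (cases k) auto
    have s1: "(astep K c0 ^^ Suc p) (Scan c, tp, 0) = (Back c (res (act c) s), tp, int p)"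
      using one Test y v by simp
    have "(astep K c0 ^^ (Suc p + Suc p)) (Scan c, tp, 0) =
       (if c = Done then Halt (res (act c) s) else Scan (nxt c (res (act c) s)), tp, 0)"
      unfolding funpow_add comp_def s1 back_home[OF home] by (simp add: Test)
    then show ?thesis using pm Test enc by (intro exI[of _ "Suc p + Suc p"] exI[of _ tp]) simp
  qed
qed

text \<open>A step raises a counter by at most one, so all values stay at most \<open>m + k\<close>
  and every sweep is bounded in terms of \<open>B\<close>. The factor \<open>k + 1\<close> includes
  the final test made at \<open>Done\<close>.\<close>

lemma sim_run:
  assumes "encodes K s tp" "cok K c" "\<And>x. x < K \<Longrightarrow> cnt s x \<le> m" "m + k \<le> B"
    "(step ^^ k) (c, s) = (Done, s')"
  shows "\<exists>t tp'. t \<le> (k + 1) * (2 * B + 5) \<and>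
    (astep K c0 ^^ t) (Scan c, tp, 0) = (Halt (arr s' 2 (cnt s' 0)), tp', 0)"
  using assms
proof (induction k arbitrary: c s tp m)
  case 0
  then have "c = Done" "s' = s" by auto
  moreover obtain t tp' where "t \<le> 2 * m + 5" "(astep K c0 ^^ t) (Scan c, tp, 0) =
      (if c = Done then Halt (res (act c) s) else Scan (nxt c (res (act c) s)), tp', 0)"
    using sim_instr[OF 0(1,2), of m c0] 0(3) by blast
  ultimately show ?case using 0(4) by (intro exI[of _ t] exI[of _ tp']) simp
next
  case (Suc k)
  obtain t tp1 where t: "t \<le> 2 * m + 5" "encodes K (eff (act c) s) tp1"
    "(astep K c0 ^^ t) (Scan c, tp, 0) =
      (if c = Done then Halt (res (act c) s) else Scan (nxt c (res (act c) s)), tp1, 0)"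
    using sim_instr[OF Suc.prems(1,2), of m c0] Suc.prems(3) by blast
  show ?case
  proof (cases "c = Done")
    case True
    then have "s' = s" using Suc.prems(5) by (simp only: steps_Done prod.inject)
    with t True Suc.prems(4) show ?thesis by (intro exI[of _ t] exI[of _ tp1]) simp
  next
    case False
    have ok: "cok K (nxt c b)" for b
      using cok_resid[OF Suc.prems(2)] nxt_resid[OF self_resid] by blast
    have m: "cnt (eff (act c) s) x \<le> Suc m" if "x < K" for x
      using Suc.prems(3)[OF that] by (cases "act c") (auto simp: le_SucI)
    have "(step ^^ k) (nxt c (res (act c) s), eff (act c) s) = (Done, s')"
      using Suc.prems(5) by (simp only: funpow_Suc_app) (simp add: step_def)
    from Suc.IH[OF t(2) ok m _ this] Suc.prems(4) obtain t' tp' where t':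
      "t' \<le> (k + 1) * (2 * B + 5)" "(astep K c0 ^^ t') (Scan (nxt c (res (act c) s)), tp1, 0) =
         (Halt (arr s' 2 (cnt s' 0)), tp', 0)" by auto
    have "(astep K c0 ^^ (t' + t)) (Scan c, tp, 0) = (Halt (arr s' 2 (cnt s' 0)), tp', 0)"
      using t(3) t'(2) False by (simp add: funpow_add)
    moreover have "t' + t \<le> (Suc k + 1) * (2 * B + 5)"
      using t(1) t'(1) Suc.prems(4) by simp
    ultimately show ?thesis by blast
  qed
qed

definition init_store :: "nat list \<Rightarrow> store" where
  "init_store w = \<lparr>cnt = (\<lambda>_. 0), arr = (\<lambda>a p. p < length w \<and> bit (w ! p) a)\<rparr>"

definition control_states :: "com \<Rightarrow> control set" where
  "control_states c = {Start, Halt True, Halt False} \<union> Scan ` resid c \<union> Next ` resid c \<union>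
     (\<lambda>(d, b). Back d b) ` (resid c \<times> UNIV)"

lemma trans_control_states: "q \<in> control_states c \<Longrightarrow> fst (trans K c q a) \<in> control_states c"
proof (cases q)
  case (Scan d)
  assume "q \<in> control_states c"
  with Scan have "d \<in> resid c" unfolding control_states_def by auto
  then show ?thesis using Scan unfolding control_states_def by (cases "act d") auto
next
  case (Back d b)
  assume "q \<in> control_states c"
  with Back have "d \<in> resid c" unfolding control_states_def by auto
  then show ?thesis using Back nxt_resid[of d c b] unfolding control_states_def by (cases b) auto
qed (auto simp: control_states_def self_resid)

lemma less_exp_iff: "(a::nat) < 2 ^ m \<longleftrightarrow> (\<forall>i\<ge>m. \<not> bit a i)"
proof
  assume "a < 2 ^ m"
  then have "take_bit m a = a" by (simp add: take_bit_nat_eq_self_iff)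
  then show "\<forall>i\<ge>m. \<not> bit a i" by (metis bit_take_bit_iff not_le)
next
  assume "\<forall>i\<ge>m. \<not> bit a i"
  then have "bit (take_bit m a) i = bit a i" for i by (cases "i < m") (auto simp: bit_take_bit_iff)
  then have "take_bit m a = a" by (intro bit_eqI) blast
  then show "a < 2 ^ m" by (simp add: take_bit_nat_eq_self_iff)
qed

lemma trans_bounds:
  assumes "q \<in> control_states c" "cok K c" "a < 2 ^ (2 * K + 1)" "trans K c q a = (q', b, m)"
  shows "b < 2 ^ (2 * K + 1) \<and> m \<in> {-1, 0, 1}"
proof (cases q)
  case Start
  then show ?thesis using assms unfolding less_exp_iff
    by (auto simp: bit_or_iff bit_push_bit_iff bit_mask_iff)
next
  case (Scan d)
  then have "d \<in> resid c" using assms(1) unfolding control_states_def by auto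
  then have i: "iok K (act d)" using cok_resid[OF assms(2)] iok_act by blast
  then show ?thesis using assms(3,4) Scan unfolding less_exp_iff
    by (cases "act d") (auto simp: bit_unset_bit_iff bit_set_bit_iff split: if_splits)
next
  case (Next d)
  then have "d \<in> resid c" using assms(1) unfolding control_states_def by auto
  then have "iok K (act d)" using cok_resid[OF assms(2)] iok_act by blast
  then show ?thesis using assms(3,4) Next unfolding less_exp_iff
    by (cases "act d") (auto simp: bit_unset_bit_iff bit_set_bit_iff split: if_splits)
next
  case (Back d e)
  then have "d \<in> resid c" using assms(1) unfolding control_states_def by auto
  then have "iok K (act d)" using cok_resid[OF assms(2)] iok_act by blast
  then show ?thesis using assms(3,4) Back unfolding less_exp_iff
    by (cases "act d") (auto simp: bit_unset_bit_iff bit_set_bit_iff split: if_splits)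
next
  case (Halt e)
  then show ?thesis using assms(3,4) by auto
qed

text \<open>Counters start at 0 and are at most \<open>T\<close> after \<open>T\<close> steps. This
  gives at most \<open>T + 1\<close> sweeps of length linear in \<open>T\<close>, preceded by the
  one step that sets the marks.\<close>

theorem com_to_tm:
  "\<exists>M. wf_tm M \<and> (\<forall>w T s'. set w \<subseteq> {1, 2, 3} \<longrightarrow> runs c (init_store w) T s' \<longrightarrow>
     decides_within M w (1 + (T + 1) * (2 * T + 5)) (arr s' 2 (cnt s' 0)))"
proof -
  obtain K where ok: "cok K c" using ex_cok by blast
  have K: "2 < K" using ok by (induction c) auto
  have fin: "finite (control_states c)" unfolding control_states_def by (auto simp: finite_resid)
  from ex_bij_betw_finite_nat[OF fin] obtain e where e: "bij_betw e (control_states c) {0..<card (control_states c)}" by blast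
  define dec where "dec = inv_into (control_states c) e"
  have dec: "dec (e q) = q" if "q \<in> control_states c" for q
    using that e unfolding dec_def by (simp add: bij_betw_inv_into_left)
  have decQ: "dec i \<in> control_states c" if "i < card (control_states c)" for i
    using that e unfolding dec_def by (metis atLeastLessThan_iff bij_betw_imp_surj_on inv_into_into zero_le)
  have eb: "e q < card (control_states c)" if "q \<in> control_states c" for q
    using that e by (meson atLeastLessThan_iff bij_betwE)
  have einj: "e q = e q' \<longleftrightarrow> q = q'" if "q \<in> control_states c" "q' \<in> control_states c" for q q'
    using that e by (meson bij_betw_imp_inj_on inj_on_eq_iff)
  have Q: "Start \<in> control_states c" "Halt b \<in> control_states c" for b unfolding control_states_def by (cases b; auto)+
  define M where "M = \<lparr>states = card (control_states c), alph = 2 ^ (2 * K + 1),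
    delta = (\<lambda>q a. case trans K c (dec q) a of (q', b, m) \<Rightarrow> (e q', b, m)),
    start = e Start, acc = e (Halt True), rej = e (Halt False)\<rparr>"
  have wf: "wf_tm M"
  proof -
    have "4 \<le> (2::nat) ^ (2 * K + 1)" using power_increasing[of 2 "2 * K + 1" "2::nat"] K by simp
    moreover have "case delta M q a of (q', b, m) \<Rightarrow> q' < states M \<and> b < alph M \<and> m \<in> {-1, 0, 1}"
      if "q < states M" "a < alph M" for q a
    proof -
      obtain q' b m where t: "trans K c (dec q) a = (q', b, m)" by (cases "trans K c (dec q) a") auto
      have dq: "dec q \<in> control_states c" using that decQ by (simp add: M_def)
      have "q' \<in> control_states c" using trans_control_states[OF dq, of K a] t by simp
      then show ?thesis using trans_bounds[OF dq ok _ t] that eb t by (simp add: M_def)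
    qed
    ultimately show ?thesis using eb Q einj unfolding wf_tm_def by (simp add: M_def)
  qed
  have sim1: "tm_step M (e q, tp, h) = (case astep K c (q, tp, h) of (q', tp', h') \<Rightarrow> (e q', tp', h')) \<and>
      fst (astep K c (q, tp, h)) \<in> control_states c" if "q \<in> control_states c" for q tp h
  proof -
    obtain q' b m where t: "trans K c q (tp h) = (q', b, m)" by (cases "trans K c q (tp h)") auto
    have "q' \<in> control_states c" using trans_control_states[OF that, of K "tp h"] t by simp
    moreover have "tp(h := tp h) = tp" by simp
    ultimately show ?thesis
    \<comment> \<open>Both machines rest in halting controls, but \<open>tm_step\<close> does so by
      a test on the state and \<open>trans\<close> by rewriting the scanned symbol, so this case is
      separate.\<close>
    proof (cases "q = Halt True \<or> q = Halt False")
      case True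
      then show ?thesis using that \<open>q' \<in> control_states c\<close> t by (auto simp: tm_step_def astep_def M_def)
    next
      case False
      then show ?thesis using that \<open>q' \<in> control_states c\<close> t dec einj Q
        by (auto simp: tm_step_def astep_def M_def)
    qed
  qed
  have sim: "(tm_step M ^^ t) (e q, tp, h) = (case (astep K c ^^ t) (q, tp, h) of (q', tp', h') \<Rightarrow> (e q', tp', h'))
     \<and> fst ((astep K c ^^ t) (q, tp, h)) \<in> control_states c" if "q \<in> control_states c" for t q tp h
  proof (induction t)
    case (Suc t)
    obtain q' tp' h' where "(astep K c ^^ t) (q, tp, h) = (q', tp', h')"
      by (cases "(astep K c ^^ t) (q, tp, h)") auto
    with Suc sim1[of q' tp' h'] show ?case by auto
  qed (use that in auto)
  have "decides_within M w (1 + (T + 1) * (2 * T + 5)) (arr s' 2 (cnt s' 0))"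
    if w: "set w \<subseteq> {1, 2, 3}" and r: "runs c (init_store w) T s'" for w T s'
  proof -
    from r obtain k where k: "k \<le> T" "(step ^^ k) (c, init_store w) = (Done, s')"
      unfolding runs_def by blast
    define tp where "tp = (\<lambda>i::int. if 0 \<le> i \<and> nat i < length w then w ! nat i else 0)"
    define tp1 where "tp1 = tp(0 := or (tp 0) (push_bit K (mask (K + 1))))"
    have a1: "astep K c (Start, tp, 0) = (Scan c, tp1, 0)"
      by (simp add: astep_def tp1_def)
    have small: "\<not> bit (tp i) j" if "j \<ge> K" for i j
    proof -
      have "tp i \<le> 3"
      proof (cases "0 \<le> i \<and> nat i < length w")
        case True
        then have "w ! nat i \<in> {1, 2, 3}" using w nth_mem by blast
        then show ?thesis using True by (auto simp: tp_def)
      qed (auto simp: tp_def)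
      then have "tp i < 2 ^ 2" by simp
      then show ?thesis using that K unfolding less_exp_iff by auto
    qed
    have "encodes K (init_store w) tp1"
      unfolding encodes_def init_store_def tp1_def
      using small[of _ "int _"] by (auto simp: bit_or_iff bit_push_bit_iff bit_mask_iff tp_def)
    from sim_run[OF this ok _ _ k(2), of 0 k c] obtain t tp' where t:
      "t \<le> (k + 1) * (2 * k + 5)" "(astep K c ^^ t) (Scan c, tp1, 0) = (Halt (arr s' 2 (cnt s' 0)), tp', 0)"
      by (auto simp: init_store_def)
    have "(astep K c ^^ Suc t) (Start, tp, 0) = (Halt (arr s' 2 (cnt s' 0)), tp', 0)"
      using t(2) by (simp only: funpow_Suc_app a1)
    with sim[OF Q(1), of "Suc t" tp 0]
    have "tm_run M (Suc t) w = (e (Halt (arr s' 2 (cnt s' 0))), tp', 0)"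
      unfolding tm_run_def tm_init_def tp_def by (simp add: M_def del: funpow.simps)
    moreover have "Suc t \<le> 1 + (T + 1) * (2 * T + 5)"
    proof -
      have "(k + 1) * (2 * k + 5) \<le> (T + 1) * (2 * T + 5)" using k(1) by (intro mult_le_mono) auto
      then show ?thesis using t(1) by linarith
    qed
    ultimately show ?thesis unfolding decides_within_def using einj Q
      by (intro exI[of _ "Suc t"]) (auto simp: M_def)
  qed
  with wf show ?thesis by blast
qed

section \<open>Commands with quantified tests\<close>

text \<open>The base \<open>n + 2\<close> lets constants and sums fit under a pure power for every
  \<open>n\<close>, including 0 and 1, so that no leading coefficient has to be carried
  along.\<close>

definition poly_bounded :: "(nat \<Rightarrow> nat) \<Rightarrow> bool" where
  "poly_bounded f \<longleftrightarrow> (\<exists>e. \<forall>n. f n \<le> (n + 2) ^ e)"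

lemma poly_bounded_const [intro]: "poly_bounded (\<lambda>n. c)"
proof -
  have "c \<le> (n + 2) ^ c" for n
  proof -
    have "c \<le> 2 ^ c" by (simp add: less_imp_le)
    also have "\<dots> \<le> (n + 2) ^ c" by (rule power_mono) auto
    finally show ?thesis .
  qed
  then show ?thesis unfolding poly_bounded_def by blast
qed

lemma poly_bounded_id [intro]: "poly_bounded (\<lambda>n. n)"
  unfolding poly_bounded_def by (rule exI[of _ 1]) simp

lemma poly_bounded_mult [intro]:
  assumes "poly_bounded f" "poly_bounded g" shows "poly_bounded (\<lambda>n. f n * g n)"
proof -
  from assms obtain a b where "\<And>n. f n \<le> (n + 2) ^ a" "\<And>n. g n \<le> (n + 2) ^ b"
    unfolding poly_bounded_def by blast
  then have "f n * g n \<le> (n + 2) ^ (a + b)" for n by (simp add: power_add mult_le_mono)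
  then show ?thesis unfolding poly_bounded_def by blast
qed

lemma poly_bounded_add [intro]:
  assumes "poly_bounded f" "poly_bounded g" shows "poly_bounded (\<lambda>n. f n + g n)"
proof -
  \<comment> \<open>Sums reduce to products by
    \<open>f n + g n <= (f n + 1) * (g n + 1)\<close>.\<close>
  have "poly_bounded (\<lambda>n. (f n + 1) * (g n + 1))"
  proof (rule poly_bounded_mult)
    have suc: "poly_bounded (\<lambda>n. h n + 1)" if "poly_bounded h" for h :: "nat \<Rightarrow> nat"
    proof -
      from that obtain a where a: "\<And>n. h n \<le> (n + 2) ^ a" unfolding poly_bounded_def by blast
      have "h n + 1 \<le> (n + 2) ^ (a + 1)" for n
      proof -
        have "1 \<le> (n + 2) ^ a" by simp
        then have "h n + 1 \<le> 2 * (n + 2) ^ a" using a[of n] by linarith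
        also have "\<dots> \<le> (n + 2) ^ (a + 1)" by simp
        finally show ?thesis .
      qed
      then show ?thesis unfolding poly_bounded_def by blast
    qed
    show "poly_bounded (\<lambda>n. f n + 1)" "poly_bounded (\<lambda>n. g n + 1)" using assms suc by blast+
  qed
  then obtain e where e: "\<And>n. (f n + 1) * (g n + 1) \<le> (n + 2) ^ e" unfolding poly_bounded_def by blast
  have "f n + g n \<le> (n + 2) ^ e" for n using e[of n] by (simp add: algebra_simps)
  then show ?thesis unfolding poly_bounded_def by blast
qed

text \<open>The value \<open>n\<close> signals that nothing was found. A counter can hold it, so
  result and failure of a search share one counter.\<close>

definition first :: "nat \<Rightarrow> (nat \<Rightarrow> bool) \<Rightarrow> nat" where
  "first n P = (LEAST i. i < n \<longrightarrow> P i)"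

lemma first_le: "first n P \<le> n"
  unfolding first_def by (rule Least_le) simp

lemma first_holds: "first n P < n \<Longrightarrow> P (first n P)"
  unfolding first_def using LeastI[of "\<lambda>i. i < n \<longrightarrow> P i" n] by simp

lemma first_least: "j < first n P \<Longrightarrow> \<not> P j"
  unfolding first_def using not_less_Least by blast

lemma first_eqI: "i \<le> n \<Longrightarrow> (i < n \<Longrightarrow> P i) \<Longrightarrow> (\<And>j. j < i \<Longrightarrow> \<not> P j) \<Longrightarrow> first n P = i"
  unfolding first_def by (rule Least_equality) (auto, meson less_le_trans not_le)

lemma first_less_iff: "first n P < n \<longleftrightarrow> (\<exists>i<n. P i)"
  by (metis first_holds first_least first_le le_neq_implies_less)

text \<open>First-order formulas with quantifiers bounded by counter 0. A fixed formula becomes a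
  loop nest of fixed depth and is testable in polynomial time, so the algorithm can state its
  choices as formulas.\<close>

datatype fm = EqF nat nat | LtF nat nat | B1 nat nat | B2 nat nat nat
  | Neg fm | Con fm fm | Ex nat fm

fun sem :: "fm \<Rightarrow> store \<Rightarrow> bool" where
  "sem (EqF x y) s = (cnt s x = cnt s y)"
| "sem (LtF x y) s = (cnt s x < cnt s y)"
| "sem (B1 a x) s = arr s a (cnt s x)"
| "sem (B2 a x y) s = arr s a (cnt s x * cnt s 0 + cnt s y)"
| "sem (Neg p) s = (\<not> sem p s)"
| "sem (Con p q) s = (sem p s \<and> sem q s)"
| "sem (Ex x p) s = (\<exists>i<cnt s 0. sem p (setc x i s))"

fun wff :: "nat set \<Rightarrow> fm \<Rightarrow> bool" where
  "wff S (EqF x y) = (x \<in> S \<and> y \<in> S)"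
| "wff S (LtF x y) = (x \<in> S \<and> y \<in> S)"
| "wff S (B1 a x) = (a \<noteq> 2 \<and> x \<in> S)"
| "wff S (B2 a x y) = (a \<noteq> 2 \<and> x \<in> S \<and> y \<in> S)"
| "wff S (Neg p) = wff S p"
| "wff S (Con p q) = (wff S p \<and> wff S q)"
| "wff S (Ex x p) = (x \<notin> S \<and> 3 < x \<and> wff (insert x S) p)"

text \<open>Counter 0 always holds the size \<open>n\<close> of the universe, the counters 1, 2, 3 are scratch space for
  the compiled code, and a test leaves its result in array 2 at index \<open>n\<close>. The set \<open>S\<close> contains the counters
  whose values matter; quantifiers run over counters outside \<open>S\<close>.\<close>
definition agree :: "nat set \<Rightarrow> store \<Rightarrow> store \<Rightarrow> bool" where
  "agree S s t \<longleftrightarrow> (\<forall>x\<in>S. cnt t x = cnt s x \<and> cnt s x \<le> cnt s 0) \<and> (\<forall>a. a \<noteq> 2 \<longrightarrow> arr t a = arr s a)"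

definition admissible :: "nat set \<Rightarrow> bool" where
  "admissible S \<longleftrightarrow> 0 \<in> S \<and> 1 \<notin> S \<and> 2 \<notin> S \<and> 3 \<notin> S"

abbreviation flag :: "store \<Rightarrow> bool" where "flag t \<equiv> arr t 2 (cnt t 0)"

text \<open>In \<open>agree S s t\<close>, \<open>s\<close> is the abstract store on which meanings
  are defined, and \<open>t\<close> is the actual one, which may hold anything in the counters
  outside \<open>S\<close> and in array 2. One polynomial in \<open>n\<close> has to serve all such
  pairs.\<close>

definition evals :: "nat set \<Rightarrow> com \<Rightarrow> (store \<Rightarrow> bool) \<Rightarrow> bool" where
  "evals S c P \<longleftrightarrow> (\<exists>f. poly_bounded f \<and> (\<forall>s t. agree S s t \<longrightarrow>
     (\<exists>t'. runs c t (f (cnt s 0)) t' \<and> agree S s t' \<and> flag t' = P s)))"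

definition comps :: "nat set \<Rightarrow> com \<Rightarrow> (store \<Rightarrow> store) \<Rightarrow> bool" where
  "comps S c g \<longleftrightarrow> (\<exists>f. poly_bounded f \<and> (\<forall>s t. agree S s t \<longrightarrow>
     (\<exists>t'. runs c t (f (cnt s 0)) t' \<and> agree S (g s) t')))"

definition setF :: "bool \<Rightarrow> com" where "setF b = Do (Write 2 0 b)"

definition testF :: "instr \<Rightarrow> com" where "testF i = Cond i (setF True) (setF False)"

lemma runs_setF: "runs (setF b) t 1 (seta 2 (cnt t 0) b t)"
  using runs_Do[of "Write 2 0 b" t] by (simp add: setF_def)

lemma runs_testF: "runs (testF (Test x k b)) t 2 (seta 2 (cnt t 0) (tval t k (cnt t x) = b) t)"
proof -
  have "runs (if res (Test x k b) t then setF True else setF False) (eff (Test x k b) t) 1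
     (seta 2 (cnt t 0) (tval t k (cnt t x) = b) t)"
    using runs_setF[of True t] runs_setF[of False t] by (auto split: if_splits)
  from runs_Cond[OF this] show ?thesis by (simp add: testF_def numeral_2_eq_2)
qed

lemma agree_flag: "agree S s t \<Longrightarrow> agree S s (seta 2 i b t)"
  by (auto simp: agree_def)

lemma agree_scratch: "agree S s t \<Longrightarrow> arr t' = arr t \<Longrightarrow> (\<And>x. x \<in> S \<Longrightarrow> cnt t' x = cnt t x) \<Longrightarrow> agree S s t'"
  by (auto simp: agree_def)

lemma agree_cnt: "agree S s t \<Longrightarrow> x \<in> S \<Longrightarrow> cnt t x = cnt s x"
  and agree_bound: "agree S s t \<Longrightarrow> x \<in> S \<Longrightarrow> cnt s x \<le> cnt s 0"
  and agree_arr: "agree S s t \<Longrightarrow> a \<noteq> 2 \<Longrightarrow> arr t a = arr s a"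
  by (auto simp: agree_def)

definition addloop :: "nat \<Rightarrow> nat \<Rightarrow> nat \<Rightarrow> com" where
  "addloop z a b = Do (Zero z) ;; Loop (Test z (Cnt b) False) (Do (Inc a) ;; Do (Inc z))"

lemma runs_addloop:
  assumes "z \<noteq> a" "z \<noteq> b" "a \<noteq> b"
  shows "\<exists>t'. runs (addloop z a b) t (cnt t b * 5 + 3) t' \<and>
    cnt t' = (cnt t)(z := cnt t b, a := cnt t a + cnt t b) \<and> arr t' = arr t"
proof -
  define I where "I = (\<lambda>j (s::store). cnt s = (cnt t)(z := j, a := cnt t a + j) \<and> arr s = arr t)"
  have "\<exists>t'. runs (Loop (Test z (Cnt b) False) (Do (Inc a) ;; Do (Inc z))) (setc z 0 t)
     (cnt t b * (3 + 2) + 1) t' \<and> I (cnt t b) t'"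
  proof (rule runs_Loop)
    fix j s assume "j < cnt t b" and I: "I j s"
    have "runs (Do (Inc a) ;; Do (Inc z)) s (1 + 1 + 1) (eff (Inc z) (eff (Inc a) s))"
      by (rule runs_Then[OF runs_Do runs_Do])
    moreover have "I (Suc j) (eff (Inc z) (eff (Inc a) s))" using I assms by (auto simp: I_def fun_eq_iff)
    ultimately show "res (Test z (Cnt b) False) s \<and> eff (Test z (Cnt b) False) s = s \<and>
      (\<exists>s'. runs (Do (Inc a) ;; Do (Inc z)) s 3 s' \<and> I (Suc j) s')"
      using I \<open>j < cnt t b\<close> assms by (auto simp: I_def numeral_3_eq_3)
  qed (use assms in \<open>auto simp: I_def fun_eq_iff\<close>)
  then obtain t' where t': "runs (Loop (Test z (Cnt b) False) (Do (Inc a) ;; Do (Inc z))) (setc z 0 t)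
     (cnt t b * (3 + 2) + 1) t'" "I (cnt t b) t'" by blast
  have "runs (addloop z a b) t (1 + (cnt t b * (3 + 2) + 1) + 1) t'"
    unfolding addloop_def using runs_Then[OF runs_Do[of "Zero z" t]] t'(1) by simp
  then show ?thesis using t'(2) by (intro exI[of _ t']) (simp add: I_def numeral_eq_Suc)
qed

text \<open>Pairs are stored in row-major order. The index is left in counter 1, while counter 2
  counts the rows and counter 3 drives the additions.\<close>

definition idx :: "nat \<Rightarrow> nat \<Rightarrow> com" where
  "idx x y = Do (Zero 1) ;; Do (Zero 2) ;;
     Loop (Test 2 (Cnt x) False) (addloop 3 1 0 ;; Do (Inc 2)) ;; addloop 3 1 y"

lemma runs_idx:
  assumes "x \<notin> {1, 2, 3}" "y \<notin> {1, 2, 3}" "cnt t x \<le> cnt t 0" "cnt t y \<le> cnt t 0"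
  shows "\<exists>t'. runs (idx x y) t (cnt t 0 * (cnt t 0 * 5 + 7) + cnt t 0 * 5 + 9) t' \<and>
    cnt t' 1 = cnt t x * cnt t 0 + cnt t y \<and> (\<forall>z. z \<notin> {1, 2, 3} \<longrightarrow> cnt t' z = cnt t z) \<and> arr t' = arr t"
proof -
  define t0 where "t0 = setc 2 0 (setc 1 0 t)"
  define I where "I = (\<lambda>j (s::store). cnt s 1 = j * cnt t 0 \<and> cnt s 2 = j \<and>
    (\<forall>z. z \<notin> {1, 2, 3} \<longrightarrow> cnt s z = cnt t z) \<and> arr s = arr t)"
  have "\<exists>t'. runs (Loop (Test 2 (Cnt x) False) (addloop 3 1 0 ;; Do (Inc 2))) t0
     (cnt t x * ((cnt t 0 * 5 + 5) + 2) + 1) t' \<and> I (cnt t x) t'"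
  proof (rule runs_Loop)
    fix j s assume "j < cnt t x" and I: "I j s"
    obtain s1 where s1: "runs (addloop 3 1 0) s (cnt s 0 * 5 + 3) s1"
      "cnt s1 = (cnt s)(3 := cnt s 0, 1 := cnt s 1 + cnt s 0)" "arr s1 = arr s"
      using runs_addloop[of 3 1 0 s] by auto
    have "runs (addloop 3 1 0 ;; Do (Inc 2)) s ((cnt s 0 * 5 + 3) + 1 + 1) (eff (Inc 2) s1)"
      by (rule runs_Then[OF s1(1) runs_Do])
    moreover have "I (Suc j) (eff (Inc 2) s1)" using I s1 by (auto simp: I_def)
    moreover have "cnt s 0 = cnt t 0" using I by (auto simp: I_def)
    ultimately show "res (Test 2 (Cnt x) False) s \<and> eff (Test 2 (Cnt x) False) s = s \<and>
      (\<exists>s'. runs (addloop 3 1 0 ;; Do (Inc 2)) s (cnt t 0 * 5 + 5) s' \<and> I (Suc j) s')"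
      using I \<open>j < cnt t x\<close> assms(1) by (intro conjI exI[of _ "eff (Inc 2) s1"]) (auto simp: I_def numeral_eq_Suc)
  qed (use assms in \<open>auto simp: I_def t0_def\<close>)
  then obtain t1 where t1: "runs (Loop (Test 2 (Cnt x) False) (addloop 3 1 0 ;; Do (Inc 2))) t0
     (cnt t x * ((cnt t 0 * 5 + 5) + 2) + 1) t1" "I (cnt t x) t1" by blast
  obtain t2 where t2: "runs (addloop 3 1 y) t1 (cnt t1 y * 5 + 3) t2"
      "cnt t2 = (cnt t1)(3 := cnt t1 y, 1 := cnt t1 1 + cnt t1 y)" "arr t2 = arr t1"
    using runs_addloop[of 3 1 y t1] assms(2) by auto
  have y: "cnt t1 y = cnt t y" using t1(2) assms(2) by (auto simp: I_def)
  have "runs (idx x y) t (1 + (1 + ((cnt t x * ((cnt t 0 * 5 + 5) + 2) + 1) + (cnt t1 y * 5 + 3) + 1) + 1) + 1) t2"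
    unfolding idx_def
    by (rule runs_Then[OF runs_Do runs_Then[OF runs_Do runs_Then[OF _ t2(1)]]])
      (use t1(1) in \<open>simp add: t0_def\<close>)
  moreover have "1 + (1 + ((cnt t x * ((cnt t 0 * 5 + 5) + 2) + 1) + (cnt t1 y * 5 + 3) + 1) + 1) + 1
     \<le> cnt t 0 * (cnt t 0 * 5 + 7) + cnt t 0 * 5 + 9"
  proof -
    have "cnt t x * (cnt t 0 * 5 + 7) \<le> cnt t 0 * (cnt t 0 * 5 + 7)" using assms(3) by (rule mult_le_mono1)
    then show ?thesis using y assms(4) by (simp add: algebra_simps)
  qed
  ultimately have "runs (idx x y) t (cnt t 0 * (cnt t 0 * 5 + 7) + cnt t 0 * 5 + 9) t2" by (rule runs_mono)
  then show ?thesis using t1(2) t2(2,3) y by (intro exI[of _ t2]) (auto simp: I_def)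
qed

text \<open>The flag has two meanings. At the head of the loop it says that \<open>x\<close> has
  reached \<open>n\<close>; after \<open>e\<close> it says that the current value passes. Either one
  ends the search, and in the former case \<open>x\<close> keeps the value \<open>n\<close>, the
  default of \<open>first\<close>.\<close>

definition find :: "nat \<Rightarrow> com \<Rightarrow> com" where
  "find x e = Do (Zero x) ;; testF (Test x (Cnt 0) True) ;;
     Loop (Test 0 (Arr 2) False)
       (e ;; Cond (Test 0 (Arr 2) True) Done (Do (Inc x) ;; testF (Test x (Cnt 0) True)))"

lemma runs_find:
  assumes admissible: "admissible S" and x: "x \<noteq> 0"
    and ev: "evals (insert x S) e P"
  shows "\<exists>f. poly_bounded f \<and> (\<forall>s t. agree S s t \<longrightarrow> (\<exists>t'. runs (find x e) t (f (cnt s 0)) t' \<and>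
     agree (insert x S) (setc x (first (cnt s 0) (\<lambda>i. P (setc x i s))) s) t'))"
proof -
  let ?S = "insert x S"
  let ?body = "e ;; Cond (Test 0 (Arr 2) True) Done (Do (Inc x) ;; testF (Test x (Cnt 0) True))"
  from ev obtain f where f: "poly_bounded f" "\<And>s t. agree ?S s t \<Longrightarrow>
     \<exists>t'. runs e t (f (cnt s 0)) t' \<and> agree ?S s t' \<and> flag t' = P s" unfolding evals_def by blast
  define g where "g = (\<lambda>n. (n + 1) * (f n + 10) + 10)"
  have "\<exists>t'. runs (find x e) t (g (cnt s 0)) t' \<and>
     agree ?S (setc x (first (cnt s 0) (\<lambda>i. P (setc x i s))) s) t'" if ag: "agree S s t" for s t
  proof -
    define n where "n = cnt s 0"
    define k where "k = first n (\<lambda>i. P (setc x i s))"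
    have kn: "k \<le> n" unfolding k_def by (rule first_le)
    have nt: "cnt t' 0 = n" if "agree ?S (setc x i s) t'" for i t'
      using agree_cnt[OF that, of 0] admissible x by (auto simp: n_def admissible_def)
    have main: "\<exists>t'. runs (Loop (Test 0 (Arr 2) False) ?body) t ((n - i) * (f n + 10) + f n + 10) t' \<and> agree ?S (setc x k s) t'"
      if "i \<le> k" "agree ?S (setc x i s) t" "flag t = (i = n)" for i t
      using that
    proof (induction "n - i" arbitrary: i t rule: less_induct)
      case less
      show ?case
      proof (cases "i = n")
        case True
        then have "k = i" using less.prems(1) kn by simp
        moreover have "runs (Loop (Test 0 (Arr 2) False) ?body) t 1 t"
          using runs_Loop_False[of "Test 0 (Arr 2) False" t ?body] less.prems(3) True by simp
        ultimately show ?thesis using less.prems(2) by (meson runs_mono le_add2 trans_le_add2 one_le_numeral)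
      next
        case False
        then have i: "i < n" using less.prems(1) kn by simp
        obtain t1 where t1: "runs e t (f n) t1" "agree ?S (setc x i s) t1" "flag t1 = P (setc x i s)"
          using f(2)[OF less.prems(2)] x by (auto simp: n_def)
        have res0: "res (Test 0 (Arr 2) False) t" using less.prems(3) False by simp
        show ?thesis
        proof (cases "P (setc x i s)")
          case True
          then have "k = i" using less.prems(1) first_least unfolding k_def
            by (metis le_neq_implies_less)
          have "runs (Cond (Test 0 (Arr 2) True) Done (Do (Inc x) ;; testF (Test x (Cnt 0) True))) t1 1 t1"
            using runs_Cond[of "Test 0 (Arr 2) True" t1 Done _ 0 t1] runs_Done[of t1 0] t1(3) True by simp
          from runs_Then[OF t1(1) this] have b: "runs ?body t (f n + 2) t1" by simp
          have l: "runs (Loop (Test 0 (Arr 2) False) ?body) t1 1 t1"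
            using runs_Loop_False[of "Test 0 (Arr 2) False" t1 ?body] t1(3) True by simp
          have "runs (Loop (Test 0 (Arr 2) False) ?body) t (f n + 2 + 1 + 2) t1"
            using runs_Loop_True[OF res0 _ l] b by simp
          then have "runs (Loop (Test 0 (Arr 2) False) ?body) t ((n - i) * (f n + 10) + f n + 10) t1"
            by (rule runs_mono) simp
          then show ?thesis using t1(2) \<open>k = i\<close> by blast
        next
          case False
          have ik: "Suc i \<le> k"
          proof (rule ccontr)
            assume "\<not> Suc i \<le> k"
            then have "i = k" using less.prems(1) by simp
            then show False using False first_holds[of n "\<lambda>i. P (setc x i s)"] i unfolding k_def by simp
          qed
          define t2 where "t2 = setc x (Suc i) t1"
          define t3 where "t3 = seta 2 (cnt t2 0) (cnt t2 0 = cnt t2 x) t2"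
          have c1: "cnt t1 x = i" using agree_cnt[OF t1(2), of x] by simp
          have r2: "runs (Do (Inc x)) t1 1 t2" using runs_Do[of "Inc x" t1] c1 by (simp add: t2_def)
          have r3: "runs (testF (Test x (Cnt 0) True)) t2 2 t3" using runs_testF[of x "Cnt 0" True t2] by (simp add: t3_def)
          have "runs (Cond (Test 0 (Arr 2) True) Done (Do (Inc x) ;; testF (Test x (Cnt 0) True))) t1 5 t3"
            using runs_Cond[of "Test 0 (Arr 2) True" t1 Done _ 4 t3] runs_Then[OF r2 r3] t1(3) False by (simp add: numeral_eq_Suc)
          from runs_Then[OF t1(1) this] have b: "runs ?body t (f n + 6) t3" by (simp add: add.commute)
          have a3: "agree ?S (setc x (Suc i) s) t3"
            unfolding t3_def t2_def using t1(2) i x by (intro agree_flag) (auto simp: agree_def n_def)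
          have f3: "flag t3 = (Suc i = n)" using nt[OF t1(2)] x by (auto simp: t3_def t2_def)
          have "n - Suc i < n - i" using i by simp
          from less.hyps[OF this ik a3 f3] obtain t4 where t4:
            "runs (Loop (Test 0 (Arr 2) False) ?body) t3 ((n - Suc i) * (f n + 10) + f n + 10) t4"
            "agree ?S (setc x k s) t4" by blast
          have "runs (Loop (Test 0 (Arr 2) False) ?body) t (f n + 6 + ((n - Suc i) * (f n + 10) + f n + 10) + 2) t4"
            by (rule runs_Loop_True[OF res0 _ t4(1)]) (use b in simp)
          moreover have "(n - i) * (f n + 10) = (n - Suc i) * (f n + 10) + (f n + 10)"
            using i by (simp add: Suc_diff_Suc[symmetric] del: diff_Suc_Suc)
          ultimately have "runs (Loop (Test 0 (Arr 2) False) ?body) t ((n - i) * (f n + 10) + f n + 10) t4"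
            by (elim runs_mono) simp
          then show ?thesis using t4(2) by blast
        qed
      qed
    qed
    define t1 where "t1 = setc x 0 t"
    define t2 where "t2 = seta 2 (cnt t1 0) (cnt t1 0 = cnt t1 x) t1"
    have r1: "runs (Do (Zero x)) t 1 t1" using runs_Do[of "Zero x" t] by (simp add: t1_def)
    have r2: "runs (testF (Test x (Cnt 0) True)) t1 2 t2" using runs_testF[of x "Cnt 0" True t1] by (simp add: t2_def)
    have a2: "agree ?S (setc x 0 s) t2"
      unfolding t2_def t1_def using ag x by (intro agree_flag) (auto simp: agree_def)
    have f2: "flag t2 = (0 = n)" using nt[OF a2] x by (auto simp: t2_def t1_def)
    from main[OF _ a2 f2] obtain t3 where t3:
      "runs (Loop (Test 0 (Arr 2) False) ?body) t2 (n * (f n + 10) + f n + 10) t3" "agree ?S (setc x k s) t3" by auto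
    have "runs (find x e) t (1 + (2 + (n * (f n + 10) + f n + 10) + 1) + 1) t3"
      unfolding find_def by (rule runs_Then[OF r1 runs_Then[OF r2 t3(1)]])
    then have "runs (find x e) t (g n) t3" by (rule runs_mono) (simp add: g_def algebra_simps)
    then show ?thesis using t3(2) unfolding k_def n_def by blast
  qed
  moreover have "poly_bounded g" unfolding g_def using f(1) by (intro poly_bounded_add poly_bounded_mult poly_bounded_id poly_bounded_const)
  ultimately show ?thesis by blast
qed

fun ev :: "fm \<Rightarrow> com" where
  "ev (EqF x y) = testF (Test x (Cnt y) True)"
| "ev (LtF x y) = setF False ;; Do (Zero 1) ;;
     Loop (Test 1 (Cnt y) False) (Cond (Test 1 (Cnt x) True) (setF True) Done ;; Do (Inc 1))"
| "ev (B1 a x) = testF (Test x (Arr a) True)"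
| "ev (B2 a x y) = idx x y ;; testF (Test 1 (Arr a) True)"
| "ev (Neg p) = ev p ;; testF (Test 0 (Arr 2) False)"
| "ev (Con p q) = ev p ;; Cond (Test 0 (Arr 2) True) (ev q) Done"
| "ev (Ex x p) = find x (ev p) ;; testF (Test x (Cnt 0) False)"

text \<open>Counters can only be tested for equality. Counter 1 therefore runs through the numbers
  below \<open>y\<close>, and \<open>x < y\<close> holds iff it meets \<open>x\<close> on the
  way.\<close>

lemma ev_LtF:
  assumes "admissible S" "x \<in> S" "y \<in> S"
  shows "evals S (ev (LtF x y)) (sem (LtF x y))"
proof -
  let ?b = "Cond (Test 1 (Cnt x) True) (setF True) Done ;; Do (Inc 1)"
  have "\<exists>t'. runs (ev (LtF x y)) t (cnt s 0 * 6 + 5) t' \<and> agree S s t' \<and> flag t' = sem (LtF x y) s"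
    if ag: "agree S s t" for s t
  proof -
    have ne: "x \<noteq> 1" "y \<noteq> 1" and zS: "0 \<in> S" "1 \<notin> S" using assms by (auto simp: admissible_def)
    define t1 where "t1 = setc 1 0 (seta 2 (cnt t 0) False t)"
    define I where "I = (\<lambda>j u. agree S s u \<and> cnt u 1 = j \<and> flag u = (cnt s x < j))"
    have "\<exists>t'. runs (Loop (Test 1 (Cnt y) False) ?b) t1 (cnt s y * (4 + 2) + 1) t' \<and> I (cnt s y) t'"
    proof (rule runs_Loop)
      fix j u assume j: "j < cnt s y" and I: "I j u"
      have cu: "cnt u x = cnt s x" "cnt u y = cnt s y" using I assms by (auto simp: I_def agree_def)
      define u1 where "u1 = (if cnt u x = j then seta 2 (cnt u 0) True u else u)"
      have "runs (if cnt u x = j then setF True else Done) u 1 u1"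
        using runs_setF[of True u] runs_Done[of u] by (auto simp: u1_def)
      then have "runs (Cond (Test 1 (Cnt x) True) (setF True) Done) u (1 + 1) u1"
        using I by (intro runs_Cond) (auto simp: I_def)
      from runs_Then[OF this runs_Do[of "Inc 1" u1]]
      have "runs ?b u 4 (eff (Inc 1) u1)" by (simp add: numeral_eq_Suc)
      moreover have "I (Suc j) (eff (Inc 1) u1)"
      proof -
        have "agree S s u1" using I by (auto simp: u1_def I_def intro: agree_flag)
        moreover have "cnt u1 = cnt u" by (simp add: u1_def)
        ultimately have "agree S s (eff (Inc 1) u1)" using zS by (elim agree_scratch) auto
        moreover have "flag u1 = (cnt s x < Suc j)" using I cu by (auto simp: u1_def I_def)
        ultimately show ?thesis using \<open>cnt u1 = cnt u\<close> I by (auto simp: I_def)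
      qed
      ultimately show "res (Test 1 (Cnt y) False) u \<and> eff (Test 1 (Cnt y) False) u = u \<and>
         (\<exists>s'. runs ?b u 4 s' \<and> I (Suc j) s')"
        using I j cu by (auto simp: I_def)
    next
      fix u assume "I (cnt s y) u"
      then show "\<not> res (Test 1 (Cnt y) False) u \<and> eff (Test 1 (Cnt y) False) u = u"
        using assms by (auto simp: I_def agree_def)
    next
      show "I 0 t1" using ag zS by (auto simp: I_def t1_def agree_def)
    qed
    then obtain t2 where t2: "runs (Loop (Test 1 (Cnt y) False) ?b) t1 (cnt s y * (4 + 2) + 1) t2" "I (cnt s y) t2"
      by blast
    have "runs (ev (LtF x y)) t (1 + (1 + (cnt s y * (4 + 2) + 1) + 1) + 1) t2"
      unfolding ev.simps by (rule runs_Then[OF runs_setF runs_Then[OF runs_Do]]) (use t2(1) in \<open>simp add: t1_def\<close>)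
    then have "runs (ev (LtF x y)) t (cnt s 0 * 6 + 5) t2"
      by (rule runs_mono) (use agree_bound[OF ag assms(3)] in simp)
    then show ?thesis using t2(2) by (auto simp: I_def)
  qed
  then show ?thesis unfolding evals_def
    by (intro exI[of _ "\<lambda>n. n * 6 + 5"] conjI poly_bounded_add poly_bounded_mult poly_bounded_id poly_bounded_const) blast
qed

text \<open>The set \<open>S\<close> has to be general in the induction: it grows at each
  quantifier, so that evaluating the body preserves the bound variable together with all counters
  protected before.\<close>

lemma ev_correct: "admissible S \<Longrightarrow> wff S p \<Longrightarrow> evals S (ev p) (sem p)"
proof (induction p arbitrary: S)
  case (EqF x y)
  have "runs (ev (EqF x y)) t 2 (seta 2 (cnt t 0) (cnt t y = cnt t x) t)" for t
    using runs_testF[of x "Cnt y" True t] by simp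
  then show ?case using EqF unfolding evals_def
    by (intro exI[of _ "\<lambda>n. 2"] conjI poly_bounded_const allI impI)
      (rule exI, rule conjI, assumption, auto intro: agree_flag simp: agree_cnt)
next
  case (LtF x y)
  then show ?case by (intro ev_LtF) auto
next
  case (B1 a x)
  have "runs (ev (B1 a x)) t 2 (seta 2 (cnt t 0) (arr t a (cnt t x)) t)" for t
    using runs_testF[of x "Arr a" True t] by simp
  then show ?case using B1 unfolding evals_def
    by (intro exI[of _ "\<lambda>n. 2"] conjI poly_bounded_const allI impI)
      (rule exI, rule conjI, assumption, auto intro: agree_flag simp: agree_cnt agree_arr)
next
  case (B2 a x y)
  have ex: "\<exists>t'. runs (ev (B2 a x y)) t (cnt s 0 * (cnt s 0 * 5 + 7) + cnt s 0 * 5 + 9 + 2 + 1) t' \<and>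
      agree S s t' \<and> flag t' = sem (B2 a x y) s" if ag: "agree S s t" for s t
  proof -
    have S: "x \<in> S" "y \<in> S" "a \<noteq> 2" "0 \<in> S" using B2 by (auto simp: admissible_def)
    then have ne: "x \<notin> {1, 2, 3}" "y \<notin> {1, 2, 3}" using B2(1) unfolding admissible_def by auto
    have c: "cnt t x = cnt s x" "cnt t y = cnt s y" "cnt t 0 = cnt s 0" "cnt t x \<le> cnt t 0" "cnt t y \<le> cnt t 0"
      using agree_cnt[OF ag] agree_bound[OF ag] S by auto
    obtain t1 where t1: "runs (idx x y) t (cnt t 0 * (cnt t 0 * 5 + 7) + cnt t 0 * 5 + 9) t1"
      "cnt t1 1 = cnt t x * cnt t 0 + cnt t y" "\<forall>z. z \<notin> {1, 2, 3} \<longrightarrow> cnt t1 z = cnt t z" "arr t1 = arr t"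
      using runs_idx[OF ne c(4,5)] by blast
    define t2 where "t2 = seta 2 (cnt t1 0) (arr t1 a (cnt t1 1)) t1"
    have r2: "runs (testF (Test 1 (Arr a) True)) t1 2 t2" using runs_testF[of 1 "Arr a" True t1] by (simp add: t2_def)
    have "\<And>z. z \<in> S \<Longrightarrow> z \<notin> {1, 2, 3}" using B2(1) by (auto simp: admissible_def)
    then have "agree S s t1" using t1(3,4) ag by (intro agree_scratch[OF ag]) auto
    then have "agree S s t2" unfolding t2_def by (rule agree_flag)
    moreover have "flag t2 = sem (B2 a x y) s" unfolding t2_def using t1(2,4) c S agree_arr[OF ag] by simp
    ultimately show ?thesis using runs_Then[OF t1(1) r2] c(3) by auto
  qed
  show ?case unfolding evals_def
    by (intro exI[of _ "\<lambda>n. n * (n * 5 + 7) + n * 5 + 9 + 2 + 1"] conjI poly_bounded_add poly_bounded_mult poly_bounded_id poly_bounded_const allI impI) (rule ex)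
next
  case (Neg p)
  then obtain f where f: "poly_bounded f" "\<And>s t. agree S s t \<Longrightarrow>
     \<exists>t'. runs (ev p) t (f (cnt s 0)) t' \<and> agree S s t' \<and> flag t' = sem p s" unfolding evals_def by (metis wff.simps(5))
  have "\<exists>t'. runs (ev (Neg p)) t (f (cnt s 0) + 2 + 1) t' \<and> agree S s t' \<and> flag t' = sem (Neg p) s"
    if ag: "agree S s t" for s t
  proof -
    obtain t1 where t1: "runs (ev p) t (f (cnt s 0)) t1" "agree S s t1" "flag t1 = sem p s" using f(2)[OF ag] by blast
    have "runs (ev (Neg p)) t (f (cnt s 0) + 2 + 1) (seta 2 (cnt t1 0) (\<not> flag t1) t1)"
      using runs_Then[OF t1(1) runs_testF[of 0 "Arr 2" False t1]] by simp
    then show ?thesis using t1 by (intro exI[of _ "seta 2 (cnt t1 0) (\<not> flag t1) t1"]) (auto intro: agree_flag)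
  qed
  then show ?case unfolding evals_def
    by (intro exI[of _ "\<lambda>n. f n + 2 + 1"] conjI poly_bounded_add poly_bounded_const f(1)) blast
next
  case (Con p q)
  then obtain f where f: "poly_bounded f" "\<And>s t. agree S s t \<Longrightarrow>
     \<exists>t'. runs (ev p) t (f (cnt s 0)) t' \<and> agree S s t' \<and> flag t' = sem p s" unfolding evals_def by (metis wff.simps(6))
  from Con obtain g where g: "poly_bounded g" "\<And>s t. agree S s t \<Longrightarrow>
     \<exists>t'. runs (ev q) t (g (cnt s 0)) t' \<and> agree S s t' \<and> flag t' = sem q s" unfolding evals_def by (metis wff.simps(6))
  have "\<exists>t'. runs (ev (Con p q)) t (f (cnt s 0) + (g (cnt s 0) + 1) + 1) t' \<and> agree S s t' \<and> flag t' = sem (Con p q) s"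
    if ag: "agree S s t" for s t
  proof -
    obtain t1 where t1: "runs (ev p) t (f (cnt s 0)) t1" "agree S s t1" "flag t1 = sem p s" using f(2)[OF ag] by blast
    obtain t2 where t2: "runs (ev q) t1 (g (cnt s 0)) t2" "agree S s t2" "flag t2 = sem q s" using g(2)[OF t1(2)] by blast
    have "runs (Cond (Test 0 (Arr 2) True) (ev q) Done) t1 (g (cnt s 0) + 1) (if flag t1 then t2 else t1)"
      by (rule runs_Cond) (use t2(1) runs_Done in auto)
    from runs_Then[OF t1(1) this] show ?thesis using t1 t2
      by (intro exI[of _ "if flag t1 then t2 else t1"]) auto
  qed
  then show ?case unfolding evals_def
    by (intro exI[of _ "\<lambda>n. f n + (g n + 1) + 1"] conjI poly_bounded_add poly_bounded_const f(1) g(1)) blast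
next
  case (Ex x p)
  have x: "x \<notin> S" "x \<noteq> 0" and admissible': "admissible (insert x S)" using Ex by (auto simp: admissible_def)
  have "evals (insert x S) (ev p) (sem p)" using Ex.IH[OF admissible'] Ex.prems by simp
  from runs_find[OF Ex.prems(1) x(2) this] obtain f where f: "poly_bounded f" "\<And>s t. agree S s t \<Longrightarrow> 
     \<exists>t'. runs (find x (ev p)) t (f (cnt s 0)) t' \<and>
     agree (insert x S) (setc x (first (cnt s 0) (\<lambda>i. sem p (setc x i s))) s) t'" by blast
  have "\<exists>t'. runs (ev (Ex x p)) t (f (cnt s 0) + 2 + 1) t' \<and> agree S s t' \<and> flag t' = sem (Ex x p) s"
    if ag: "agree S s t" for s t
  proof -
    define k where "k = first (cnt s 0) (\<lambda>i. sem p (setc x i s))"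
    obtain t1 where t1: "runs (find x (ev p)) t (f (cnt s 0)) t1" "agree (insert x S) (setc x k s) t1"
      using f(2)[OF ag] unfolding k_def by blast
    define t2 where "t2 = seta 2 (cnt t1 0) ((cnt t1 0 = cnt t1 x) = False) t1"
    have "runs (ev (Ex x p)) t (f (cnt s 0) + 2 + 1) t2"
      using runs_Then[OF t1(1) runs_testF[of x "Cnt 0" False t1]] by (simp add: t2_def)
    moreover have "agree S s t2" unfolding t2_def
      by (rule agree_flag) (use t1(2) ag x in \<open>auto simp: agree_def\<close>)
    moreover have "flag t2 = sem (Ex x p) s"
    proof -
      have "cnt t1 0 = cnt s 0" "cnt t1 x = k" using t1(2) x Ex.prems(1) by (auto simp: agree_def admissible_def)
      then have "flag t2 = (k < cnt s 0)" unfolding t2_def using first_le[of "cnt s 0" "\<lambda>i. sem p (setc x i s)"]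
        by (auto simp: k_def)
      then show ?thesis unfolding k_def first_less_iff by simp
    qed
    ultimately show ?thesis by blast
  qed
  then show ?case unfolding evals_def
    by (intro exI[of _ "\<lambda>n. f n + 2 + 1"] conjI poly_bounded_add poly_bounded_const f(1)) blast
qed

section \<open>Commands with loops of length \<open>n\<close>\<close>

datatype cmd = Skip | Find nat fm | Put nat nat bool | Put2 nat nat nat bool
  | Seq cmd cmd | If fm cmd cmd | For nat cmd

primrec loop :: "(store \<Rightarrow> store) \<Rightarrow> nat \<Rightarrow> nat \<Rightarrow> store \<Rightarrow> store" where
  "loop f x 0 s = setc x 0 s"
| "loop f x (Suc i) s = setc x (Suc i) (f (loop f x i s))"

fun den :: "cmd \<Rightarrow> store \<Rightarrow> store" where
  "den Skip s = s"
| "den (Find x p) s = setc x (first (cnt s 0) (\<lambda>i. sem p (setc x i s))) s"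
| "den (Put a x b) s = seta a (cnt s x) b s"
| "den (Put2 a x y b) s = seta a (cnt s x * cnt s 0 + cnt s y) b s"
| "den (Seq c d) s = den d (den c s)"
| "den (If p c d) s = (if sem p s then den c s else den d s)"
| "den (For x c) s = loop (den c) x (cnt s 0) s"

fun mod_counters :: "cmd \<Rightarrow> nat set" where
  "mod_counters Skip = {}"
| "mod_counters (Find x p) = {x}"
| "mod_counters (Put a x b) = {}"
| "mod_counters (Put2 a x y b) = {}"
| "mod_counters (Seq c d) = mod_counters c \<union> mod_counters d"
| "mod_counters (If p c d) = mod_counters c \<union> mod_counters d"
| "mod_counters (For x c) = insert x (mod_counters c)"

fun mod_arrays :: "cmd \<Rightarrow> nat set" where
  "mod_arrays Skip = {}"
| "mod_arrays (Find x p) = {}"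
| "mod_arrays (Put a x b) = {a}"
| "mod_arrays (Put2 a x y b) = {a}"
| "mod_arrays (Seq c d) = mod_arrays c \<union> mod_arrays d"
| "mod_arrays (If p c d) = mod_arrays c \<union> mod_arrays d"
| "mod_arrays (For x c) = mod_arrays c"

fun wfc :: "nat set \<Rightarrow> cmd \<Rightarrow> bool" where
  "wfc S Skip = True"
| "wfc S (Find x p) = (x \<in> S \<and> x \<noteq> 0 \<and> wff S p)"
| "wfc S (Put a x b) = (a \<noteq> 2 \<and> x \<in> S)"
| "wfc S (Put2 a x y b) = (a \<noteq> 2 \<and> x \<in> S \<and> y \<in> S)"
| "wfc S (Seq c d) = (wfc S c \<and> wfc S d)"
| "wfc S (If p c d) = (wff S p \<and> wfc S c \<and> wfc S d)"
| "wfc S (For x c) = (x \<in> S \<and> x \<noteq> 0 \<and> x \<notin> mod_counters c \<and> wfc S c)"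

lemma cnt_loop_frame:
  "(\<And>s. cnt (f s) z = cnt s z) \<Longrightarrow> z \<noteq> x \<Longrightarrow> cnt (loop f x i s) z = cnt s z"
  by (induction i) auto

lemma cnt_loop_var: "cnt (loop f x i s) x = i"
  by (cases i) auto

lemma arr_loop_frame: "(\<And>s. arr (f s) a = arr s a) \<Longrightarrow> arr (loop f x i s) a = arr s a"
  by (induction i) auto

lemma cnt_den: "z \<notin> mod_counters c \<Longrightarrow> cnt (den c s) z = cnt s z"
  by (induction c arbitrary: s) (auto simp: cnt_loop_frame)

lemma arr_den: "a \<notin> mod_arrays c \<Longrightarrow> arr (den c s) a = arr s a"
  by (induction c arbitrary: s) (auto simp: arr_loop_frame)

lemma wfc_mod_counters: "wfc S c \<Longrightarrow> 0 \<notin> mod_counters c"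
  by (induction c) auto

lemma cnt0_den: "wfc S c \<Longrightarrow> cnt (den c s) 0 = cnt s 0"
  by (rule cnt_den) (rule wfc_mod_counters)

fun compile :: "cmd \<Rightarrow> com" where
  "compile Skip = Done"
| "compile (Find x p) = find x (ev p)"
| "compile (Put a x b) = Do (Write a x b)"
| "compile (Put2 a x y b) = idx x y ;; Do (Write a 1 b)"
| "compile (Seq c d) = compile c ;; compile d"
| "compile (If p c d) = ev p ;; Cond (Test 0 (Arr 2) True) (compile c) (compile d)"
| "compile (For x c) = Do (Zero x) ;; Loop (Test x (Cnt 0) False) (compile c ;; Do (Inc x))"

lemma compsI:
  assumes "poly_bounded f" "\<And>s t. agree S s t \<Longrightarrow> \<exists>t'. runs c t (f (cnt s 0)) t' \<and> agree S (g s) t'"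
  shows "comps S c g"
  using assms unfolding comps_def by blast

text \<open>Every loop of a \<open>cmd\<close> has length \<open>n\<close> and every test is a
  formula, so for a fixed command the time is polynomial. Superpolynomial cost can arise only in
  \<open>runs_while\<close>.\<close>

lemma compile_correct: "admissible S \<Longrightarrow> wfc S c \<Longrightarrow> comps S (compile c) (den c)"
proof (induction c)
  case Skip
  show ?case by (rule compsI[of "\<lambda>_. 0"]) (auto intro: runs_Done)
next
  case (Find x p)
  then have "insert x S = S" "x \<noteq> 0" "wff S p" by auto
  with runs_find[OF Find(1), of x "ev p" "sem p"] ev_correct[OF Find(1), of p]
  show ?case unfolding comps_def by simp
next
  case (Put a x b)
  have "agree S (den (Put a x b) s) (eff (Write a x b) t)" if "agree S s t" for s t
    using that Put by (auto simp: agree_def)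
  then show ?case by (intro compsI[of "\<lambda>_. 1"] poly_bounded_const) (use runs_Do[of "Write a x b"] in \<open>auto simp del: eff.simps\<close>)
next
  case (Put2 a x y b)
  show ?case
  proof (rule compsI[of "\<lambda>n. n * (n * 5 + 7) + n * 5 + 9 + 1 + 1"])
    fix s t assume ag: "agree S s t"
    have S: "x \<in> S" "y \<in> S" "a \<noteq> 2" "0 \<in> S" using Put2 by (auto simp: admissible_def)
    then have ne: "x \<notin> {1, 2, 3}" "y \<notin> {1, 2, 3}" using Put2(1) unfolding admissible_def by auto
    have c: "cnt t x = cnt s x" "cnt t y = cnt s y" "cnt t 0 = cnt s 0" "cnt t x \<le> cnt t 0" "cnt t y \<le> cnt t 0"
      using agree_cnt[OF ag] agree_bound[OF ag] S by auto
    obtain t1 where t1: "runs (idx x y) t (cnt t 0 * (cnt t 0 * 5 + 7) + cnt t 0 * 5 + 9) t1"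
      "cnt t1 1 = cnt t x * cnt t 0 + cnt t y" "\<forall>z. z \<notin> {1, 2, 3} \<longrightarrow> cnt t1 z = cnt t z" "arr t1 = arr t"
      using runs_idx[OF ne c(4,5)] by blast
    have "\<And>z. z \<in> S \<Longrightarrow> z \<notin> {1, 2, 3}" using Put2(1) by (auto simp: admissible_def)
    then have "agree S s t1" using t1(3,4) ag by (intro agree_scratch[OF ag]) auto
    then have "agree S (den (Put2 a x y b) s) (eff (Write a 1 b) t1)" using t1(2) c S(3) by (auto simp: agree_def)
    moreover have "runs (compile (Put2 a x y b)) t (cnt t 0 * (cnt t 0 * 5 + 7) + cnt t 0 * 5 + 9 + 1 + 1) (eff (Write a 1 b) t1)"
      unfolding compile.simps by (rule runs_Then[OF t1(1) runs_Do])
    ultimately show "\<exists>t'. runs (compile (Put2 a x y b)) t (cnt s 0 * (cnt s 0 * 5 + 7) + cnt s 0 * 5 + 9 + 1 + 1) t' \<and>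
        agree S (den (Put2 a x y b) s) t'" using c(3) by metis
  qed (intro poly_bounded_add poly_bounded_mult poly_bounded_id poly_bounded_const)
next
  case (Seq c d)
  from Seq obtain f where f: "poly_bounded f" "\<And>s t. agree S s t \<Longrightarrow> \<exists>t'. runs (compile c) t (f (cnt s 0)) t' \<and> agree S (den c s) t'"
    unfolding comps_def by (metis wfc.simps(5))
  from Seq obtain g where g: "poly_bounded g" "\<And>s t. agree S s t \<Longrightarrow> \<exists>t'. runs (compile d) t (g (cnt s 0)) t' \<and> agree S (den d s) t'"
    unfolding comps_def by (metis wfc.simps(5))
  have c0: "cnt (den c s) 0 = cnt s 0" for s using Seq.prems by (intro cnt0_den[of S]) simp
  show ?case
  proof (rule compsI[of "\<lambda>n. f n + g n + 1"])
    fix s t assume "agree S s t"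
    from f(2)[OF this] obtain t1 where t1: "runs (compile c) t (f (cnt s 0)) t1" "agree S (den c s) t1" by blast
    from g(2)[OF t1(2)] c0 obtain t2 where t2: "runs (compile d) t1 (g (cnt s 0)) t2" "agree S (den d (den c s)) t2" by auto
    show "\<exists>t'. runs (compile (Seq c d)) t (f (cnt s 0) + g (cnt s 0) + 1) t' \<and> agree S (den (Seq c d) s) t'"
      using runs_Then[OF t1(1) t2(1)] t2(2) by auto
  qed (intro poly_bounded_add poly_bounded_const f g)
next
  case (If p c d)
  from If obtain f where f: "poly_bounded f" "\<And>s t. agree S s t \<Longrightarrow> \<exists>t'. runs (compile c) t (f (cnt s 0)) t' \<and> agree S (den c s) t'"
    unfolding comps_def by (metis wfc.simps(6))
  from If obtain g where g: "poly_bounded g" "\<And>s t. agree S s t \<Longrightarrow> \<exists>t'. runs (compile d) t (g (cnt s 0)) t' \<and> agree S (den d s) t'"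
    unfolding comps_def by (metis wfc.simps(6))
  from ev_correct[OF If.prems(1), of p] If.prems(2) obtain h where h: "poly_bounded h" "\<And>s t. agree S s t \<Longrightarrow>
     \<exists>t'. runs (ev p) t (h (cnt s 0)) t' \<and> agree S s t' \<and> flag t' = sem p s" unfolding evals_def by auto
  show ?case
  proof (rule compsI[of "\<lambda>n. h n + ((f n + g n) + 1) + 1"])
    fix s t assume "agree S s t"
    from h(2)[OF this] obtain t1 where t1: "runs (ev p) t (h (cnt s 0)) t1" "agree S s t1" "flag t1 = sem p s" by blast
    obtain t2 where t2: "runs (if flag t1 then compile c else compile d) t1 (f (cnt s 0) + g (cnt s 0)) t2" "agree S (den (If p c d) s) t2"
      using f(2)[OF t1(2)] g(2)[OF t1(2)] t1(3) runs_mono[OF _ le_add1] runs_mono[OF _ le_add2]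
      by (cases "sem p s") (simp_all, blast+)
    have "runs (Cond (Test 0 (Arr 2) True) (compile c) (compile d)) t1 (f (cnt s 0) + g (cnt s 0) + 1) t2"
      by (rule runs_Cond) (use t2(1) in simp)
    from runs_Then[OF t1(1) this] t2(2)
    show "\<exists>t'. runs (compile (If p c d)) t (h (cnt s 0) + ((f (cnt s 0) + g (cnt s 0)) + 1) + 1) t' \<and> agree S (den (If p c d) s) t'"
      by auto
  qed (intro poly_bounded_add poly_bounded_const f g h)
next
  case (For x c)
  from For obtain f where f: "poly_bounded f" "\<And>s t. agree S s t \<Longrightarrow> \<exists>t'. runs (compile c) t (f (cnt s 0)) t' \<and> agree S (den c s) t'"
    unfolding comps_def by (metis wfc.simps(7))
  have x: "x \<in> S" "x \<noteq> 0" "x \<notin> mod_counters c" "0 \<notin> mod_counters c" "0 \<in> S" using For.prems wfc_mod_counters by (auto simp: admissible_def)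
  show ?case
  proof (rule compsI[of "\<lambda>n. 1 + (n * (f n + 1 + 1 + 2) + 1) + 1"])
    fix s t assume ag: "agree S s t"
    define n where "n = cnt s 0"
    define I where "I = (\<lambda>j. agree S (loop (den c) x j s))"
    have n: "cnt (loop (den c) x j s) 0 = n" for j
      unfolding n_def by (rule cnt_loop_frame) (use x in \<open>auto simp: cnt_den\<close>)
    have tn: "cnt u 0 = n" "cnt u x = j" if "I j u" for j u
      using that x n[of j] agree_cnt[of S _ u] cnt_loop_var[of "den c" x j s] unfolding I_def by metis+
    have "\<exists>t'. runs (Loop (Test x (Cnt 0) False) (compile c ;; Do (Inc x))) (setc x 0 t) (n * ((f n + 1 + 1) + 2) + 1) t' \<and> I n t'"
    proof (rule runs_Loop)
      fix j u assume j: "j < n" and I: "I j u"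
      from I f(2)[of "loop (den c) x j s" u] n obtain u1 where u1: "runs (compile c) u (f n) u1"
        "agree S (den c (loop (den c) x j s)) u1" unfolding I_def by auto
      have ux: "cnt u1 x = j" using agree_cnt[OF u1(2) x(1)] cnt_den[OF x(3)] cnt_loop_var by metis
      have "cnt (den c (loop (den c) x j s)) 0 = n" using cnt_den[OF x(4)] n by metis
      then have "I (Suc j) (eff (Inc x) u1)" using u1(2) ux j x(2) unfolding I_def by (auto simp: agree_def)
      then show "res (Test x (Cnt 0) False) u \<and> eff (Test x (Cnt 0) False) u = u \<and>
         (\<exists>s'. runs (compile c ;; Do (Inc x)) u (f n + 1 + 1) s' \<and> I (Suc j) s')"
        using runs_Then[OF u1(1) runs_Do[of "Inc x" u1]] tn[OF I] j by auto
    next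
      fix u assume "I n u"
      from tn[OF this] show "\<not> res (Test x (Cnt 0) False) u \<and> eff (Test x (Cnt 0) False) u = u" by simp
    next
      show "I 0 (setc x 0 t)" using ag x unfolding I_def by (auto simp: agree_def)
    qed
    then obtain t' where t': "runs (Loop (Test x (Cnt 0) False) (compile c ;; Do (Inc x))) (setc x 0 t) (n * ((f n + 1 + 1) + 2) + 1) t'" "I n t'"
      by blast
    have "runs (compile (For x c)) t (1 + (n * ((f n + 1 + 1) + 2) + 1) + 1) t'"
      unfolding compile.simps by (rule runs_Then[OF runs_Do]) (use t'(1) in simp)
    then show "\<exists>t'. runs (compile (For x c)) t (1 + (cnt s 0 * (f (cnt s 0) + 1 + 1 + 2) + 1) + 1) t' \<and> agree S (den (For x c) s) t'"
      using t'(2) unfolding I_def n_def by auto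
  qed (intro poly_bounded_add poly_bounded_mult poly_bounded_id poly_bounded_const f)
qed

text \<open>The number \<open>k\<close> of rounds stays a factor of the time, to be bounded later by
  the size of the space searched. The exit bit is array 3 at index \<open>n\<close>, addressed
  through counter 0.\<close>

lemma runs_while:
  assumes "admissible S" "wfc S c"
  shows "\<exists>f. poly_bounded f \<and> (\<forall>s t k. agree S s t \<longrightarrow> (\<forall>j<k. \<not> arr ((den c ^^ j) s) 3 (cnt s 0)) \<longrightarrow>
    arr ((den c ^^ k) s) 3 (cnt s 0) \<longrightarrow>
    (\<exists>t'. runs (Loop (Test 0 (Arr 3) False) (compile c)) t (k * f (cnt s 0) + 1) t' \<and> agree S ((den c ^^ k) s) t'))"
proof -
  from compile_correct[OF assms] obtain f where f: "poly_bounded f"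
    "\<And>s t. agree S s t \<Longrightarrow> \<exists>t'. runs (compile c) t (f (cnt s 0)) t' \<and> agree S (den c s) t'"
    unfolding comps_def by blast
  have "\<exists>t'. runs (Loop (Test 0 (Arr 3) False) (compile c)) t (k * (f (cnt s 0) + 2) + 1) t' \<and> agree S ((den c ^^ k) s) t'"
    if ag: "agree S s t" and no: "\<forall>j<k. \<not> arr ((den c ^^ j) s) 3 (cnt s 0)"
      and yes: "arr ((den c ^^ k) s) 3 (cnt s 0)" for s t k
  proof -
    have n: "cnt ((den c ^^ j) s) 0 = cnt s 0" for j
      by (induction j) (auto simp: cnt0_den[OF assms(2)])
    have test: "res (Test 0 (Arr 3) False) u = (\<not> arr ((den c ^^ j) s) 3 (cnt s 0))"
      if "agree S ((den c ^^ j) s) u" for j u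
      using that assms(1) n[of j] by (auto simp: agree_def admissible_def)
    show ?thesis
    proof (rule runs_Loop[where I = "\<lambda>j. agree S ((den c ^^ j) s)"])
      fix j u assume "j < k" "agree S ((den c ^^ j) s) u"
      then show "res (Test 0 (Arr 3) False) u \<and> eff (Test 0 (Arr 3) False) u = u \<and>
        (\<exists>s'. runs (compile c) u (f (cnt s 0)) s' \<and> agree S ((den c ^^ Suc j) s) s')"
        using test no f(2)[of "(den c ^^ j) s" u] n[of j] by auto
    qed (use test yes ag in auto)
  qed
  then show ?thesis by (intro exI[of _ "\<lambda>n. f n + 2"] conjI poly_bounded_add poly_bounded_const f(1)) blast
qed

section \<open>Knockout tournaments as chains\<close>

lemma tournament_less: "tournament n D \<Longrightarrow> D u w \<Longrightarrow> u < n \<and> w < n"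
  and tournament_irrefl: "tournament n D \<Longrightarrow> \<not> D u u"
  and tournament_total: "tournament n D \<Longrightarrow> u < n \<Longrightarrow> w < n \<Longrightarrow> u \<noteq> w \<Longrightarrow> D u w \<or> D w u"
  and tournament_asym: "tournament n D \<Longrightarrow> D u w \<Longrightarrow> \<not> D w u"
  unfolding tournament_def by blast+

lemma finite_arcs: "tournament n D \<Longrightarrow> finite (arcs D)"
  by (rule finite_subset[of _ "{..<n} \<times> {..<n}"]) (auto simp: arcs_def dest: tournament_less)

definition advance :: "(nat \<Rightarrow> nat \<Rightarrow> bool) \<Rightarrow> nat set \<Rightarrow> nat set \<Rightarrow> bool" where
  "advance D X Y \<longleftrightarrow> X \<subseteq> Y \<and> (\<exists>\<mu>. bij_betw \<mu> X (Y - X) \<and> (\<forall>p\<in>X. D p (\<mu> p)))"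

definition chain :: "(nat \<Rightarrow> nat \<Rightarrow> bool) \<Rightarrow> nat \<Rightarrow> nat \<Rightarrow> (nat \<Rightarrow> nat set) \<Rightarrow> bool" where
  "chain D v k S \<longleftrightarrow> S 0 = {v} \<and> (\<forall>j<k. advance D (S j) (S (Suc j)))"

lemma advance_card:
  assumes "advance D X Y" "finite X"
  shows "finite Y \<and> card Y = 2 * card X"
proof -
  from assms obtain \<mu> where XY: "X \<subseteq> Y" and b: "bij_betw \<mu> X (Y - X)" unfolding advance_def by blast
  then have f: "finite (Y - X)" using assms(2) bij_betw_finite by blast
  moreover have "Y = X \<union> (Y - X)" using XY by blast
  ultimately have "finite Y" using assms(2) by (metis finite_UnI)
  moreover have "card (Y - X) = card X" using bij_betw_same_card[OF b] by simp
  ultimately show ?thesis using XY card_Diff_subset[OF assms(2) XY] card_mono[of Y X] by simp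
qed

lemma chain_card: "chain D v k S \<Longrightarrow> j \<le> k \<Longrightarrow> finite (S j) \<and> card (S j) = 2 ^ j"
proof (induction j)
  case 0
  then show ?case by (simp add: chain_def)
next
  case (Suc j)
  then have "advance D (S j) (S (Suc j))" by (simp add: chain_def)
  with Suc show ?case using advance_card[of D "S j" "S (Suc j)"] by simp
qed

text \<open>The player at node \<open>i\<close> of level \<open>j\<close> of the knockout tree, with
  the root on level 0: an even child repeats its parent, an odd child is the opponent beaten in that
  match.\<close>

primrec bracket :: "nat \<Rightarrow> (nat \<Rightarrow> nat \<Rightarrow> nat) \<Rightarrow> nat \<Rightarrow> nat \<Rightarrow> nat" where
  "bracket v m 0 i = v"
| "bracket v m (Suc j) i = (if even i then bracket v m j (i div 2) else m j (bracket v m j (i div 2)))"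

lemma chain_imp_TFP:
  assumes ch: "chain D v k S" and Sk: "S k = {0..<n}"
  shows "TFP k n D v"
proof -
  have "\<forall>j. \<exists>\<mu>. j < k \<longrightarrow> bij_betw \<mu> (S j) (S (Suc j) - S j) \<and> (\<forall>p\<in>S j. D p (\<mu> p))"
    using ch unfolding chain_def advance_def by blast
  then obtain m where m: "\<And>j. j < k \<Longrightarrow> bij_betw (m j) (S j) (S (Suc j) - S j)"
      "\<And>j p. j < k \<Longrightarrow> p \<in> S j \<Longrightarrow> D p (m j p)" by metis
  have sub: "S j \<subseteq> S (Suc j)" if "j < k" for j using ch that unfolding chain_def advance_def by blast
  let ?\<sigma> = "bracket v m"
  have im: "?\<sigma> j ` {0..<2 ^ j} = S j" if "j \<le> k" for j using that
  proof (induction j)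
    case 0
    then show ?case using ch by (simp add: chain_def)
  next
    case (Suc j)
    then have IH: "?\<sigma> j ` {0..<2 ^ j} = S j" and jk: "j < k" by auto
    have eo: "?\<sigma> (Suc j) (2 * i) = ?\<sigma> j i" "?\<sigma> (Suc j) (2 * i + 1) = m j (?\<sigma> j i)" for i by auto
    have "{0..<2 ^ Suc j} = (\<lambda>i. 2 * i) ` {0..<2 ^ j} \<union> (\<lambda>i. 2 * i + 1) ` {0..<(2::nat) ^ j}"
    proof -
      have "i \<in> (\<lambda>i. 2 * i) ` {0..<2 ^ j} \<union> (\<lambda>i. 2 * i + 1) ` {0..<(2::nat) ^ j}" if "i < 2 ^ Suc j" for i
      proof (cases "even i")
        case True
        then have "i = 2 * (i div 2)" "i div 2 < 2 ^ j" using that by auto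
        then show ?thesis by (metis UnI1 atLeastLessThan_iff image_eqI zero_le)
      next
        case False
        then have "i = 2 * (i div 2) + 1" "i div 2 < 2 ^ j" using that by auto
        then show ?thesis by (metis UnI2 atLeastLessThan_iff image_eqI zero_le)
      qed
      then have "{0..<2 ^ Suc j} \<subseteq> (\<lambda>i. 2 * i) ` {0..<2 ^ j} \<union> (\<lambda>i. 2 * i + 1) ` {0..<(2::nat) ^ j}"
        unfolding subset_iff atLeastLessThan_iff by blast
      then show ?thesis by (rule subset_antisym) auto
    qed
    then have "?\<sigma> (Suc j) ` {0..<2 ^ Suc j} = ?\<sigma> j ` {0..<2 ^ j} \<union> m j ` (?\<sigma> j ` {0..<2 ^ j})"
      by (simp add: image_Un image_image del: bracket.simps)
        (simp add: image_def)
    also have "\<dots> = S j \<union> (S (Suc j) - S j)"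
      using IH m(1)[OF jk] by (simp add: bij_betw_imp_surj_on)
    finally show ?case using sub[OF jk] by auto
  qed
  \<comment> \<open>A block of \<open>2 ^ r\<close> leaves is the subtree below a node of level
    \<open>k - r\<close>, and the player at that node wins the block.\<close>
  have ko: "ko_winner D (?\<sigma> k) r (i * 2 ^ r) = ?\<sigma> (k - r) i" if "r \<le> k" "i < 2 ^ (k - r)" for r i
    using that
  proof (induction r arbitrary: i)
    case (Suc r)
    define j where "j = k - Suc r"
    have j: "k - r = Suc j" "j < k" using Suc.prems(1) by (auto simp: j_def)
    have i: "i < 2 ^ j" using Suc.prems by (simp add: j_def)
    have "ko_winner D (?\<sigma> k) r (2 * i * 2 ^ r) = ?\<sigma> (Suc j) (2 * i)"
      "ko_winner D (?\<sigma> k) r ((2 * i + 1) * 2 ^ r) = ?\<sigma> (Suc j) (2 * i + 1)"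
      using Suc.IH[of "2 * i"] Suc.IH[of "2 * i + 1"] Suc.prems(1) i j by simp_all
    then have a: "ko_winner D (?\<sigma> k) r (i * 2 ^ Suc r) = ?\<sigma> j i"
      and b: "ko_winner D (?\<sigma> k) r (i * 2 ^ Suc r + 2 ^ r) = m j (?\<sigma> j i)"
      by (simp_all add: algebra_simps)
    have "?\<sigma> j i \<in> S j" using im[of j] i j by auto
    then show ?case using m(2)[OF j(2)] a b unfolding ko_winner.simps j_def[symmetric] by (simp add: Let_def)
  qed simp
  \<comment> \<open>The leaves are mapped onto a set of the same size \<open>2 ^ k\<close>, so
    injectivity comes from counting.\<close>
  have "card (?\<sigma> k ` {0..<2 ^ k}) = card {0..<(2::nat) ^ k}"
    using im[of k] chain_card[OF ch, of k] by simp
  then have "inj_on (?\<sigma> k) {0..<2 ^ k}" by (intro eq_card_imp_inj_on) auto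
  then have "bij_betw (?\<sigma> k) {0..<2 ^ k} {0..<n}" using im[of k] Sk by (simp add: bij_betw_def)
  moreover have "ko_winner D (?\<sigma> k) k 0 = v" using ko[of k 0] by simp
  ultimately show ?thesis unfolding TFP_def by blast
qed

text \<open>\<open>S j\<close> consists of the players left when \<open>2 ^ j\<close> of them
  remain, that is, the winners of the blocks of length \<open>2 ^ (k - j)\<close>. Each of them is
  matched with the opponent it beat to get there.\<close>

lemma TFP_imp_chain:
  assumes T: "tournament n D" and "TFP k n D v"
  shows "\<exists>S. chain D v k S \<and> S k = {0..<n}"
proof -
  from assms(2) obtain s where s: "bij_betw s {0..<2 ^ k} {0..<n}" and win: "ko_winner D s k 0 = v"
    unfolding TFP_def by blast
  define W where "W = (\<lambda>r i. ko_winner D s r (i * 2 ^ r))"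
  \<comment> \<open>A winner is seeded inside its block. As blocks are disjoint and the seeding is
    injective, different blocks have different winners.\<close>
  have inblock: "\<exists>p. i * 2 ^ r \<le> p \<and> p < (i + 1) * 2 ^ r \<and> W r i = s p" for r i
  proof (induction r arbitrary: i)
    case 0
    then show ?case by (auto simp: W_def intro!: exI[of _ i])
  next
    case (Suc r)
    obtain p where p: "(2 * i) * 2 ^ r \<le> p" "p < (2 * i + 1) * 2 ^ r" "W r (2 * i) = s p" using Suc by blast
    obtain q where q: "(2 * i + 1) * 2 ^ r \<le> q" "q < (2 * i + 1 + 1) * 2 ^ r" "W r (2 * i + 1) = s q" using Suc by blast
    have "W (Suc r) i = W r (2 * i) \<or> W (Suc r) i = W r (2 * i + 1)"
      by (simp add: W_def Let_def algebra_simps)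
    then show ?case
    proof
      assume "W (Suc r) i = W r (2 * i)"
      then show ?thesis using p by (intro exI[of _ p]) (auto simp: algebra_simps)
    next
      assume "W (Suc r) i = W r (2 * i + 1)"
      then show ?thesis using q by (intro exI[of _ q]) (auto simp: algebra_simps)
    qed
  qed
  have lt: "p < 2 ^ k" if "p < (i + 1) * 2 ^ r" "i < 2 ^ (k - r)" "r \<le> k" for p i r :: nat
  proof -
    have "(i + 1) * 2 ^ r \<le> 2 ^ (k - r) * 2 ^ r" using that(2) by (intro mult_le_mono1) simp
    also have "\<dots> = 2 ^ k" using that(3) by (simp flip: power_add)
    finally show ?thesis using that(1) by simp
  qed
  have inj: "inj_on (W r) {0..<2 ^ (k - r)}" if r: "r \<le> k" for r
  proof (rule inj_onI)
    fix i j assume i: "i \<in> {0..<2 ^ (k - r)}" and j: "j \<in> {0..<2 ^ (k - r)}" and e: "W r i = W r j"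
    obtain p where p: "i * 2 ^ r \<le> p" "p < (i + 1) * 2 ^ r" "W r i = s p" using inblock by blast
    obtain q where q: "j * 2 ^ r \<le> q" "q < (j + 1) * 2 ^ r" "W r j = s q" using inblock by blast
    have "p = q" using lt[OF p(2) _ r] lt[OF q(2) _ r] i j p(3) q(3) e s
      by (auto simp: bij_betw_def inj_on_def)
    then have "i = p div 2 ^ r" "j = p div 2 ^ r"
      using p(1,2) q(1,2) by (auto intro!: div_nat_eqI[symmetric] simp: algebra_simps)
    then show "i = j" by simp
  qed
  have bound: "W r i < n" if "r \<le> k" "i < 2 ^ (k - r)" for r i
  proof -
    obtain p where p: "p < (i + 1) * 2 ^ r" "W r i = s p" using inblock by blast
    then show ?thesis using lt[OF p(1) that(2,1)] s by (auto simp: bij_betw_def)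
  qed
  define S where "S = (\<lambda>j. W (k - j) ` {0..<2 ^ j})"
  have "advance D (S j) (S (Suc j))" if jk: "j < k" for j
  proof -
    define r where "r = k - Suc j"
    have r: "k - j = Suc r" "k - r = Suc j" "r \<le> k" "Suc r \<le> k" "k - Suc r = j" using jk by (auto simp: r_def)
    define a b where "a = (\<lambda>i. W r (2 * i))" and "b = (\<lambda>i. W r (2 * i + 1))"
    define L where "L = (\<lambda>i. if D (a i) (b i) then b i else a i)"
    let ?w = "W (Suc r)"
    let ?I = "{0..<(2::nat) ^ j}"
    have w: "?w i = (if D (a i) (b i) then a i else b i)" for i
      by (simp add: W_def a_def b_def Let_def algebra_simps)
    have injr: "W r x = W r y \<longleftrightarrow> x = y" if "x < 2 ^ Suc j" "y < 2 ^ Suc j" for x y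
      using inj[OF r(3)] that r(2) by (auto simp: inj_on_def)
    have ab: "a i = a i' \<longleftrightarrow> i = i'" "b i = b i' \<longleftrightarrow> i = i'" "a i \<noteq> b i'" "b i \<noteq> a i'" if "i \<in> ?I" "i' \<in> ?I" for i i'
    proof -
      have "2 * i + 1 < 2 ^ Suc j" "2 * i' + 1 < 2 ^ Suc j" using that by auto
      then have "2 * i < 2 ^ Suc j" "2 * i' < 2 ^ Suc j" by auto
      have ar: "2 * i = 2 * i' \<longleftrightarrow> i = i'" "2 * i + 1 = 2 * i' + 1 \<longleftrightarrow> i = i'" "2 * i \<noteq> 2 * i' + 1" "2 * i + 1 \<noteq> 2 * i'"
        by presburger+
      show "a i = a i' \<longleftrightarrow> i = i'" unfolding a_def
        using injr[OF \<open>2 * i < 2 ^ Suc j\<close> \<open>2 * i' < 2 ^ Suc j\<close>] ar(1) by (rule trans)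
      show "b i = b i' \<longleftrightarrow> i = i'" unfolding b_def
        using injr[OF \<open>2 * i + 1 < 2 ^ Suc j\<close> \<open>2 * i' + 1 < 2 ^ Suc j\<close>] ar(2) by (rule trans)
      show "a i \<noteq> b i'" unfolding a_def b_def
        using injr[OF \<open>2 * i < 2 ^ Suc j\<close> \<open>2 * i' + 1 < 2 ^ Suc j\<close>] ar(3) by blast
      show "b i \<noteq> a i'" unfolding a_def b_def
        using injr[OF \<open>2 * i + 1 < 2 ^ Suc j\<close> \<open>2 * i' < 2 ^ Suc j\<close>] ar(4) by blast
    qed
    have beats: "D (?w i) (L i)" if i: "i \<in> ?I" for i
    proof -
      have "a i < n" "b i < n" unfolding a_def b_def using i r by (auto intro!: bound)
      then have "D (a i) (b i) \<or> D (b i) (a i)" using tournament_total[OF T] ab(3)[OF i i] by blast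
      then show ?thesis unfolding w L_def by auto
    qed
    have Sj: "S j = ?w ` ?I" unfolding S_def r(1) ..
    have SSj: "S (Suc j) = a ` ?I \<union> b ` ?I"
    proof -
      have kk: "k - Suc j = r" by (simp add: r_def)
      have "W r x \<in> a ` ?I \<union> b ` ?I" if "x < 2 ^ Suc j" for x
      proof (cases "even x")
        case True
        then have "x = 2 * (x div 2)" "x div 2 \<in> ?I" using that by auto
        then show ?thesis unfolding a_def by (metis UnI1 image_eqI)
      next
        case False
        then have "x = 2 * (x div 2) + 1" "x div 2 \<in> ?I" using that by auto
        then show ?thesis unfolding b_def by (metis UnI2 image_eqI)
      qed
      then have "W r ` {0..<2 ^ Suc j} \<subseteq> a ` ?I \<union> b ` ?I" by (intro image_subsetI) simp
      then show ?thesis unfolding S_def kk by (rule subset_antisym) (auto simp: a_def b_def)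
    qed
    have wL: "?w i \<noteq> L i'" if "i \<in> ?I" "i' \<in> ?I" for i i'
      using ab[OF that] ab[OF that(2,1)] unfolding w L_def by (auto split: if_splits)
    have injL: "inj_on L ?I"
    proof (rule inj_onI)
      fix i i' assume *: "i \<in> ?I" "i' \<in> ?I" "L i = L i'"
      then show "i = i'" using ab[OF *(1,2)] ab[OF *(2,1)] unfolding L_def by (auto split: if_splits)
    qed
    have LS: "L ` ?I = S (Suc j) - S j"
    proof
      show "L ` ?I \<subseteq> S (Suc j) - S j"
        unfolding SSj Sj using wL by (force simp: L_def)
      show "S (Suc j) - S j \<subseteq> L ` ?I"
      proof
        fix x assume x: "x \<in> S (Suc j) - S j"
        then obtain i where i: "i \<in> ?I" "x = a i \<or> x = b i" unfolding SSj by blast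
        have "x \<noteq> ?w i" using x i unfolding Sj by blast
        then have "x = L i" using i(2) unfolding w L_def by (auto split: if_splits)
        then show "x \<in> L ` ?I" using i by blast
      qed
    qed
    have bw: "bij_betw ?w ?I (S j)" using inj[OF r(4)] r(5) Sj by (simp add: bij_betw_def)
    define \<mu> where "\<mu> = L \<circ> the_inv_into ?I ?w"
    have "bij_betw \<mu> (S j) (S (Suc j) - S j)" unfolding \<mu>_def
      by (rule bij_betw_trans[OF bij_betw_the_inv_into[OF bw]]) (use injL LS in \<open>simp add: bij_betw_def\<close>)
    moreover have "D p (\<mu> p)" if "p \<in> S j" for p
    proof -
      have "p \<in> ?w ` ?I" using that Sj by simp
      then obtain i where i: "i \<in> ?I" "p = ?w i" by (elim imageE)
      have "\<mu> p = L i" unfolding \<mu>_def i(2) comp_apply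
        by (subst the_inv_into_f_f[OF bij_betw_imp_inj_on[OF bw] i(1)]) (rule refl)
      then show ?thesis using beats[OF i(1)] i(2) by metis
    qed
    moreover have "S j \<subseteq> S (Suc j)" unfolding Sj SSj using w by auto
    ultimately show ?thesis unfolding advance_def by blast
  qed
  moreover have "S 0 = {v}" using win by (simp add: S_def W_def)
  moreover have "S k = {0..<n}" using s by (simp add: S_def W_def bij_betw_def)
  ultimately show ?thesis unfolding chain_def by blast
qed

section \<open>Orders with few back arcs\<close>

text \<open>Topological sorting: a source gets rank 0, and the ranks of the rest, obtained by
  induction, move up by one.\<close>

lemma acyclic_rank:
  assumes "finite V" "finite E" "acyclic E"
  shows "\<exists>r::nat \<Rightarrow> nat. inj_on r V \<and> (\<forall>u\<in>V. \<forall>w\<in>V. (u, w) \<in> E \<longrightarrow> r u < r w)"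
  using assms(1)
proof (induction "card V" arbitrary: V)
  case 0
  then show ?case by auto
next
  case (Suc c)
  have "wf E" using assms(2,3) by (rule finite_acyclic_wf)
  moreover obtain x where "x \<in> V" using Suc.hyps(2) by fastforce
  ultimately obtain z where z: "z \<in> V" "\<And>y. (y, z) \<in> E \<Longrightarrow> y \<notin> V" by (metis wfE_min)
  have "c = card (V - {z})" "finite (V - {z})" using Suc.hyps(2) Suc.prems z(1) by auto
  from Suc.hyps(1)[OF this] obtain r :: "nat \<Rightarrow> nat" where r: "inj_on r (V - {z})"
    "\<forall>u\<in>V - {z}. \<forall>w\<in>V - {z}. (u, w) \<in> E \<longrightarrow> r u < r w" by blast
  have irr: "(z, z) \<notin> E" using assms(3) by (auto simp: acyclic_def)
  show ?case
  proof (intro exI conjI ballI impI)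
    show "inj_on (\<lambda>u. if u = z then 0 else Suc (r u)) V"
      using r(1) by (auto simp: inj_on_def)
  next
    fix u w assume "u \<in> V" "w \<in> V" "(u, w) \<in> E"
    then show "(if u = z then 0 else Suc (r u)) < (if w = z then 0 else Suc (r w))"
      using r(2) z irr by (cases "w = z"; cases "u = z") auto
  qed
qed

text \<open>\<open>LEAST\<close> carries information only once some \<open>F\<close> qualifies.
  Reversing every arc from a larger to a smaller number leaves arcs along \<open><\<close> only,
  hence no cycle at all.\<close>

lemma sfas_num_witness:
  assumes "tournament n D"
  shows "\<exists>F. F \<subseteq> arcs D \<and> finite F \<and> card F = sfas_num D S \<and>
    (\<forall>u\<in>S. (u, u) \<notin> (reverse_arcs (arcs D) F)\<^sup>+)"
proof -
  have fin: "finite (arcs D)" using assms by (rule finite_arcs)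
  let ?Q = "\<lambda>c. \<exists>F. F \<subseteq> arcs D \<and> card F = c \<and> (\<forall>u\<in>S. (u, u) \<notin> (reverse_arcs (arcs D) F)\<^sup>+)"
  define F where "F = {(u, w). D u w \<and> w < u}"
  have "reverse_arcs (arcs D) F \<subseteq> less_than"
    using tournament_irrefl[OF assms] by (auto simp: reverse_arcs_def arcs_def F_def) (metis linorder_neqE_nat)
  then have "(reverse_arcs (arcs D) F)\<^sup>+ \<subseteq> less_than\<^sup>+" by (meson subsetI trancl_mono)
  then have "(u, u) \<notin> (reverse_arcs (arcs D) F)\<^sup>+" for u by (auto simp: trancl_id)
  moreover have "F \<subseteq> arcs D" by (auto simp: F_def arcs_def)
  ultimately have "?Q (card F)" by blast
  then have "?Q (LEAST c. ?Q c)" by (rule LeastI)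
  then show ?thesis unfolding sfas_num_def using finite_subset[OF _ fin] by blast
qed

text \<open>Deleting arcs can replace reversing them: \<open>E\<close> is contained in both reversed
  digraphs, so a cycle of \<open>E\<close> through a neighbour of \<open>v\<close> would survive in
  one of them.\<close>

lemma back_arcs_le_sfas:
  assumes T: "tournament n D" and v: "v < n"
  shows "\<exists>r::nat \<Rightarrow> nat. inj_on r {..<n} \<and>
    card {(u, w). D u w \<and> r w < r u} \<le> sfas_in D v + sfas_out D v"
proof -
  obtain F1 where F1: "F1 \<subseteq> arcs D" "finite F1" "card F1 = sfas_in D v"
    "\<forall>u\<in>N_in D v. (u, u) \<notin> (reverse_arcs (arcs D) F1)\<^sup>+"
    using sfas_num_witness[OF T] unfolding sfas_in_def by blast
  obtain F2 where F2: "F2 \<subseteq> arcs D" "finite F2" "card F2 = sfas_out D v"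
    "\<forall>u\<in>N_out D v. (u, u) \<notin> (reverse_arcs (arcs D) F2)\<^sup>+"
    using sfas_num_witness[OF T] unfolding sfas_out_def by blast
  define E where "E = arcs D - (F1 \<union> F2)"
  have sub: "E \<subseteq> reverse_arcs (arcs D) F1" "E \<subseteq> reverse_arcs (arcs D) F2"
    by (auto simp: E_def reverse_arcs_def)
  have noc: "(x, x) \<notin> E\<^sup>+" if "x \<noteq> v" for x
  proof
    assume c: "(x, x) \<in> E\<^sup>+"
    then obtain y where "(x, y) \<in> E" by (meson tranclD)
    then have "x < n" using tournament_less[OF T] by (auto simp: E_def arcs_def)
    then have "x \<in> N_in D v \<or> x \<in> N_out D v" using tournament_total[OF T _ v that] unfolding N_in_def N_out_def by blast
    then show False using trancl_mono[OF c sub(1)] trancl_mono[OF c sub(2)] F1(4) F2(4) by blast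
  qed
  have "acyclic E" unfolding acyclic_def
  proof (intro allI notI)
    fix x assume c: "(x, x) \<in> E\<^sup>+"
    then have "x = v" using noc by blast
    \<comment> \<open>A closed walk at \<open>v\<close> also passes the successor of
      \<open>v\<close>, which is a different vertex and therefore already excluded.\<close>
    from c obtain y where y: "(x, y) \<in> E" "(y, x) \<in> E\<^sup>*" by (meson tranclD)
    then have "(y, y) \<in> E\<^sup>+" by (meson rtrancl_into_trancl1)
    moreover have "y \<noteq> x" using y(1) tournament_irrefl[OF T] by (auto simp: E_def arcs_def)
    ultimately show False using noc \<open>x = v\<close> by blast
  qed
  have "finite E" unfolding E_def using finite_arcs[OF T] by simp
  from acyclic_rank[OF finite_lessThan this \<open>acyclic E\<close>, of n] obtain r :: "nat \<Rightarrow> nat" where r: "inj_on r {..<n}"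
    "\<forall>u\<in>{..<n}. \<forall>w\<in>{..<n}. (u, w) \<in> E \<longrightarrow> r u < r w" by blast
  have "{(u, w). D u w \<and> r w < r u} \<subseteq> F1 \<union> F2"
  proof clarify
    fix u w assume uw: "D u w" "r w < r u" "(u, w) \<notin> F2"
    then have "u < n" "w < n" using tournament_less[OF T] by auto
    then have "(u, w) \<notin> E" using r(2) uw(2) by fastforce
    then show "(u, w) \<in> F1" using uw by (auto simp: E_def arcs_def)
  qed
  then have "card {(u, w). D u w \<and> r w < r u} \<le> card (F1 \<union> F2)" using F1(2) F2(2) by (intro card_mono) auto
  also have "\<dots> \<le> sfas_in D v + sfas_out D v" using card_Un_le[of F1 F2] F1(3) F2(3) by simp
  finally show ?thesis using r(1) by blast
qed

section \<open>Cyclic triangles\<close>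

definition flip :: "(nat \<Rightarrow> nat \<Rightarrow> bool) \<Rightarrow> nat \<Rightarrow> nat \<Rightarrow> nat \<Rightarrow> nat \<Rightarrow> bool" where
  "flip T x y = (\<lambda>u w. if u = x \<and> w = y then False else if u = y \<and> w = x then True else T u w)"

definition cyc :: "(nat \<Rightarrow> nat \<Rightarrow> bool) \<Rightarrow> nat \<Rightarrow> nat \<Rightarrow> nat \<Rightarrow> bool" where
  "cyc T x y z \<longleftrightarrow> T x y \<and> T y z \<and> T z x"

lemma tournament_flip:
  assumes "tournament n T" "T x y" shows "tournament n (flip T x y)"
proof -
  have xy: "x < n" "y < n" "x \<noteq> y"
    using assms(2) tournament_less[OF assms(1)] tournament_irrefl[OF assms(1)] by blast+
  have "u < n \<and> w < n \<and> u \<noteq> w" if "flip T x y u w" for u w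
    using that xy tournament_less[OF assms(1), of u w] tournament_irrefl[OF assms(1), of u]
    unfolding flip_def by (auto split: if_splits)
  moreover have "flip T x y u w = (\<not> flip T x y w u)" if "u < n" "w < n" "u \<noteq> w" for u w
  proof -
    have "T u w = (\<not> T w u)" using tournament_total[OF assms(1) that] tournament_asym[OF assms(1)] by blast
    then show ?thesis using xy by (simp add: flip_def)
  qed
  ultimately show ?thesis unfolding tournament_def by blast
qed

definition back_arcs :: "(nat \<Rightarrow> nat) \<Rightarrow> (nat \<Rightarrow> nat \<Rightarrow> bool) \<Rightarrow> (nat \<times> nat) set" where
  "back_arcs r T = {(u, w). T u w \<and> r w < r u}"

lemma card_back_arcs_flip:
  assumes T: "tournament n T" and xy: "T x y" "r y < r x"
  shows "Suc (card (back_arcs r (flip T x y))) = card (back_arcs r T)"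
proof -
  have fin: "finite (back_arcs r T)" by (rule finite_subset[OF _ finite_arcs[OF T]]) (auto simp: back_arcs_def arcs_def)
  have "back_arcs r (flip T x y) = back_arcs r T - {(x, y)}" using xy by (auto simp: back_arcs_def flip_def split: if_splits)
  then show ?thesis using card_Suc_Diff1[OF fin, of "(x, y)"] xy by (simp only: back_arcs_def) simp
qed

text \<open>Ranks cannot rise all the way around a cycle. Whatever order is fixed in the analysis,
  one of the three branches at a triangle therefore reverses one of its back arcs.\<close>

lemma cyc_back_arc:
  fixes r :: "nat \<Rightarrow> nat"
  assumes T: "tournament n T" and inj: "inj_on r {..<n}" and c: "cyc T x y z"
  shows "r y < r x \<or> r z < r y \<or> r x < r z"
proof -
  have "x < n" "y < n" "x \<noteq> y" using c tournament_less[OF T] tournament_irrefl[OF T] by (auto simp: cyc_def)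
  then have "r x \<noteq> r y" using inj by (auto simp: inj_on_def)
  then show ?thesis by linarith
qed

text \<open>The in-degree serves as rank: if \<open>T u w\<close> and no triangle is cyclic, then
  whoever beats \<open>u\<close> also beats \<open>w\<close>, and \<open>u\<close> is one
  more.\<close>

lemma no_cyc_rank:
  assumes T: "tournament n T" and nc: "\<And>x y z. \<not> cyc T x y z"
  shows "\<exists>r::nat \<Rightarrow> nat. inj_on r {..<n} \<and> (\<forall>u<n. \<forall>w<n. T u w \<longleftrightarrow> r u < r w)"
proof -
  define r where "r = (\<lambda>u. card {x. T x u})"
  have fin: "finite {x. T x u}" for u using tournament_less[OF T] by (auto intro: finite_subset[of _ "{..<n}"])
  have mono: "r u < r w" if "T u w" for u w
  proof -
    have "T x w" if "T x u" for x
    proof (rule ccontr)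
      assume n: "\<not> T x w"
      show False
      proof (cases "x = w")
        case True
        then show ?thesis using that \<open>T u w\<close> tournament_asym[OF T] by auto
      next
        case False
        then have "T w x" using n that \<open>T u w\<close> tournament_less[OF T] tournament_total[OF T] by blast
        then show ?thesis using nc[of x u w] that \<open>T u w\<close> by (simp add: cyc_def)
      qed
    qed
    moreover have "\<not> T u u" using tournament_irrefl[OF T] .
    ultimately have "{x. T x u} \<subset> {x. T x w}" using that by blast
    then show ?thesis unfolding r_def using fin psubset_card_mono by blast
  qed
  have tot: "T u w \<or> T w u" if "u < n" "w < n" "u \<noteq> w" for u w using tournament_total[OF T that] .
  have "inj_on r {..<n}"
  proof (rule inj_onI, rule ccontr)
    fix u w assume "u \<in> {..<n}" "w \<in> {..<n}" "r u = r w" "u \<noteq> w"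
    then show False using tot[of u w] mono[of u w] mono[of w u] by auto
  qed
  moreover have "T u w \<longleftrightarrow> r u < r w" if "u < n" "w < n" for u w
    using mono[of u w] mono[of w u] tot[OF that] by (cases "u = w") auto
  ultimately show ?thesis by blast
qed

section \<open>Greedy completion of a guess\<close>

text \<open>These counts are the measure by which a greedy set is compared with a given solution.
  For sets of equal size, \<open>below r Q t <= below r P t\<close> for all \<open>t\<close> means
  that the players of \<open>P\<close>, listed by rank, are nowhere later than those of
  \<open>Q\<close>.\<close>

definition below :: "(nat \<Rightarrow> nat) \<Rightarrow> nat set \<Rightarrow> nat \<Rightarrow> nat" where
  "below r P t = card {x \<in> P. r x < t}"

lemma below_remove:
  assumes "finite P" "q \<in> P"
  shows "below r P t = below r (P - {q}) t + (if r q < t then 1 else 0)"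
proof (cases "r q < t")
  case True
  then have "{x \<in> P. r x < t} = insert q {x \<in> P - {q}. r x < t}" using assms(2) by auto
  then show ?thesis using assms(1) True by (simp add: below_def)
next
  case False
  then have "{x \<in> P. r x < t} = {x \<in> P - {q}. r x < t}" by auto
  then show ?thesis using False by (simp add: below_def)
qed

lemma below_mono: "finite P \<Longrightarrow> t \<le> t' \<Longrightarrow> below r P t \<le> below r P t'"
  unfolding below_def by (rule card_mono) auto

lemma below_le_card: "finite P \<Longrightarrow> below r P t \<le> card P"
  unfolding below_def by (rule card_mono) auto

lemma ex_before:
  assumes dom: "\<And>t. below r Q t \<le> below r P t" and "finite Q" "p \<in> Q" "r p < ra"
  shows "\<exists>q\<in>P. r q < ra"
proof -
  have "{x \<in> Q. r x < ra} \<noteq> {}" "finite {x \<in> Q. r x < ra}" using assms by auto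
  then have "0 < below r Q ra" unfolding below_def using card_gt_0_iff by blast
  then have "0 < below r P ra" using dom[of ra] by simp
  then have "{x \<in> P. r x < ra} \<noteq> {}" unfolding below_def by (metis card.empty less_irrefl)
  then show ?thesis by blast
qed

text \<open>Removing \<open>q\<close> and \<open>p\<close> hurts only at thresholds with
  \<open>r q < t <= r p\<close>. As \<open>q\<close> is the latest of \<open>P\<close> before
  \<open>ra\<close>, no player of \<open>P\<close> lies between \<open>t\<close> and
  \<open>ra\<close>, so \<open>P\<close> has as many players before \<open>t\<close> as before
  \<open>ra\<close>, where the comparison with \<open>Q\<close> still counts
  \<open>p\<close>.\<close>

lemma remove_latest:
  assumes fin: "finite P" "finite Q" and dom: "\<And>t. below r Q t \<le> below r P t"
    and p: "p \<in> Q" "r p < ra" and q: "q \<in> P" "r q < ra" "\<And>q'. q' \<in> P \<Longrightarrow> r q' < ra \<Longrightarrow> r q' \<le> r q"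
  shows "below r (Q - {p}) t \<le> below r (P - {q}) t"
proof (cases "r q < t \<and> \<not> r p < t")
  case True
  then have "{x \<in> P. r x < t} = {x \<in> P. r x < ra}" using q p(2) by force
  then have "below r P t = below r P ra" by (simp add: below_def)
  also have "\<dots> \<ge> below r Q ra" by (rule dom)
  finally have 1: "below r Q ra \<le> below r P t" .
  have "below r (Q - {p}) t \<le> below r (Q - {p}) ra" using True p(2) fin by (intro below_mono) auto
  moreover have "below r Q ra = below r (Q - {p}) ra + 1" using below_remove[OF fin(2) p(1), of r ra] p(2) by simp
  ultimately have "below r (Q - {p}) t + 1 \<le> below r P t" using 1 by simp
  then show ?thesis using below_remove[OF fin(1) q(1), of r t] True by simp
next
  case False
  then show ?thesis using below_remove[OF fin(1) q(1), of r t] below_remove[OF fin(2) p(1), of r t] dom[of t] by (auto split: if_splits)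
qed

text \<open>A Hall condition in disguise. \<open>F\<close> are the free players, \<open>P\<close>
  the parents still to be served and \<open>G\<close> the players to be left over. Subtracting
  \<open>inv\<close> from \<open>tot\<close> says that behind rank \<open>t\<close> there are enough
  free players for all parents of rank at least \<open>t\<close> and for the part of
  \<open>G\<close> behind \<open>t\<close>. \<open>Suc t\<close> on the side of the children
  expresses that a child lies strictly behind its parent.\<close>

lemma take_earliest:
  assumes fin: "finite F" "finite P" "finite G" and q: "q \<in> P"
    and inv: "\<And>t. below r F (Suc t) \<le> below r P t + below r G (Suc t)" and tot: "card F = card P + card G"
  shows "\<exists>u\<in>F. r q < r u"
    and "u \<in> F \<Longrightarrow> r q < r u \<Longrightarrow> (\<And>w. w \<in> F \<Longrightarrow> r q < r w \<Longrightarrow> r u \<le> r w) \<Longrightarrow>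
      below r (F - {u}) (Suc t) \<le> below r (P - {q}) t + below r G (Suc t)"
proof -
  have Pq: "below r P (r q) + 1 \<le> card P"
    using below_remove[OF fin(2) q, of r "r q"] below_le_card[of "P - {q}" r "r q"] card_Suc_Diff1[OF fin(2) q] fin(2)
    by simp
  show "\<exists>u\<in>F. r q < r u"
  proof (rule ccontr)
    assume "\<not> ?thesis"
    then have "{x \<in> F. r x < Suc (r q)} = F" by force
    then have "card F = below r F (Suc (r q))" by (simp add: below_def)
    then show False using inv[of "r q"] tot Pq below_le_card[OF fin(3), of r "Suc (r q)"] by simp
  qed
  assume u: "u \<in> F" "r q < r u" "\<And>w. w \<in> F \<Longrightarrow> r q < r w \<Longrightarrow> r u \<le> r w"
  show "below r (F - {u}) (Suc t) \<le> below r (P - {q}) t + below r G (Suc t)"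
  proof (cases "r q < t \<and> \<not> r u < Suc t")
    \<comment> \<open>Thresholds between \<open>q\<close> and \<open>u\<close> are the critical
      ones. No free player lies there, because \<open>u\<close> is the earliest one behind
      \<open>q\<close>, so the condition at \<open>r q\<close> can be used; \<open>q\<close> itself
      does not count there.\<close>
    case True
    then have "{x \<in> F - {u}. r x < Suc t} = {x \<in> F. r x < Suc (r q)}" using u by force
    then have "below r (F - {u}) (Suc t) = below r F (Suc (r q))" by (simp add: below_def)
    also have "\<dots> \<le> below r P (r q) + below r G (Suc (r q))" by (rule inv)
    also have "\<dots> \<le> below r (P - {q}) t + below r G (Suc t)"
    proof (rule add_mono)
      have "below r P (r q) = below r (P - {q}) (r q)" using below_remove[OF fin(2) q, of r "r q"] by simp
      then show "below r P (r q) \<le> below r (P - {q}) t" using True fin by (simp add: below_mono)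
    qed (use True fin in \<open>auto intro: below_mono\<close>)
    finally show ?thesis .
  next
    case False
    then show ?thesis
      using below_remove[OF fin(1) u(1), of r "Suc t"] below_remove[OF fin(2) q, of r t] inv[of t]
      by (auto split: if_splits)
  qed
qed

lemma below_Un:
  assumes "finite P" "finite Q" "P \<inter> Q = {}"
  shows "below r (P \<union> Q) t = below r P t + below r Q t"
proof -
  have "{x \<in> P \<union> Q. r x < t} = {x \<in> P. r x < t} \<union> {x \<in> Q. r x < t}" by auto
  then show ?thesis unfolding below_def using assms by (subst card_Un_disjoint[symmetric]) auto
qed

lemma below_compl:
  assumes "finite W" "X \<subseteq> W" "S \<subseteq> W" "\<And>t. below r (W - X) t \<le> below r (W - S) t"
  shows "below r S t \<le> below r X t"
proof -
  have f: "finite X" "finite S" using assms finite_subset by blast+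
  have "below r W t = below r X t + below r (W - X) t" "below r W t = below r S t + below r (W - S) t"
    using below_Un[of X "W - X" r t] below_Un[of S "W - S" r t] assms(1-3) f
    by (simp_all add: Un_absorb1)
  then show ?thesis using assms(4)[of t] by simp
qed

text \<open>A child of rank at most \<open>t\<close> has a parent of rank less than
  \<open>t\<close>. Every solution thus satisfies the inequality that the greedy step
  \<open>take_earliest\<close> maintains.\<close>

lemma matching_below:
  assumes "finite P" "inj_on m P" "\<And>p. p \<in> P \<Longrightarrow> r p < r (m p)"
  shows "below r (m ` P) (Suc t) \<le> below r P t"
proof -
  have "{x \<in> m ` P. r x < Suc t} \<subseteq> m ` {p \<in> P. r p < t}" using assms(3) by fastforce
  then have "card {x \<in> m ` P. r x < Suc t} \<le> card (m ` {p \<in> P. r p < t})" using assms(1) by (intro card_mono) auto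
  also have "\<dots> \<le> card {p \<in> P. r p < t}" using assms(1) by (intro card_image_le) auto
  finally show ?thesis by (simp add: below_def)
qed

text \<open>One end outside \<open>A\<close> is enough for an arc to follow the ranks. The rank
  function belongs to the analysis only: \<open>aff_parent\<close> and \<open>free_child\<close>
  find the latest parent and the earliest child by means of \<open>D\<close>, which orders the
  unaffected players.\<close>

definition ordered :: "nat \<Rightarrow> (nat \<Rightarrow> nat \<Rightarrow> bool) \<Rightarrow> nat set \<Rightarrow> (nat \<Rightarrow> nat) \<Rightarrow> bool" where
  "ordered n D A r \<longleftrightarrow> inj_on r {..<n} \<and>
     (\<forall>u<n. \<forall>w<n. u \<notin> A \<or> w \<notin> A \<longrightarrow> (D u w \<longleftrightarrow> r u < r w))"

text \<open>\<open>pr a = a\<close> encodes the guess that the parent of \<open>a\<close> is unaffected.\<close>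
definition aff_parent :: "nat \<Rightarrow> (nat \<Rightarrow> nat \<Rightarrow> bool) \<Rightarrow> nat set \<Rightarrow> (nat \<Rightarrow> nat) \<Rightarrow> nat set \<Rightarrow> nat \<Rightarrow> nat \<Rightarrow> bool" where
  "aff_parent n D A pr P a p \<longleftrightarrow> p \<in> P \<and> D p a \<and>
     (if pr a = a then p \<notin> A \<and> \<not> (\<exists>q<n. q \<in> P \<and> q \<notin> A \<and> D q a \<and> D p q) else pr a = p)"

definition free_child :: "nat \<Rightarrow> (nat \<Rightarrow> nat \<Rightarrow> bool) \<Rightarrow> nat set \<Rightarrow> nat set \<Rightarrow> nat \<Rightarrow> nat \<Rightarrow> bool" where
  "free_child n D A I p u \<longleftrightarrow> u \<notin> I \<and> u \<notin> A \<and> D p u \<and>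
     \<not> (\<exists>w<n. w \<notin> I \<and> w \<notin> A \<and> D p w \<and> D w u)"

section \<open>Checking one guess of stages and parents\<close>

context
  fixes n :: nat and D :: "nat \<Rightarrow> nat \<Rightarrow> bool" and v :: nat and A :: "nat set"
    and st pr :: "nat \<Rightarrow> nat"
begin

text \<open>The triple holds the parents still without a child, the players entered so far, and
  whether nothing has failed. \<open>v\<close> is passed over whatever its guessed stage, since it
  is in the chain from the start.\<close>

primrec affl :: "nat \<Rightarrow> nat set \<Rightarrow> bool \<Rightarrow> nat \<Rightarrow> nat set \<times> nat set \<times> bool" where
  "affl j X ok 0 = (X, X, ok)"
| "affl j X ok (Suc a) = (case affl j X ok a of (P, I, b) \<Rightarrow>
     if a \<in> A \<and> st a = j \<and> a \<noteq> v then
       (let p = first n (aff_parent n D A pr P a) in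
        if p = n \<or> a \<in> I then (P, I, False) else (P - {p}, insert a I, b))
     else (P, I, b))"

primrec unafl :: "nat set \<Rightarrow> nat set \<Rightarrow> bool \<Rightarrow> nat \<Rightarrow> nat set \<times> bool" where
  "unafl P I ok 0 = (I, ok)"
| "unafl P I ok (Suc p) = (case unafl P I ok p of (I, b) \<Rightarrow>
     if p \<in> P then (let u = first n (free_child n D A I p) in
       if u = n then (I, False) else (insert u I, b))
     else (I, b))"

text \<open>A full set is a fixed point. This allows \<open>chk\<close> to run for \<open>n\<close>
  rounds, the length of every available loop, although a tournament has only
  \<open>k\<close>.\<close>

definition stage1 :: "nat \<Rightarrow> nat set \<times> bool \<Rightarrow> nat set \<times> bool" where
  "stage1 j Ib = (if {..<n} \<subseteq> fst Ib then Ib else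
     case affl j (fst Ib) (snd Ib) n of (P, I, b) \<Rightarrow> unafl P I b n)"

primrec chk :: "nat \<Rightarrow> nat set \<times> bool" where
  "chk 0 = ({v}, True)"
| "chk (Suc j) = stage1 j (chk j)"

definition accepts :: bool where
  "accepts \<longleftrightarrow> snd (chk n) \<and> {..<n} \<subseteq> fst (chk n)"

lemma bij_betw_insert_upd:
  assumes "bij_betw m X Y" "a \<notin> X" "b \<notin> Y"
  shows "bij_betw (m(a := b)) (insert a X) (insert b Y)"
proof -
  have "m(a := b) ` X = m ` X" "inj_on (m(a := b)) X"
    using assms by (auto simp: bij_betw_def inj_on_def)
  then show ?thesis using assms unfolding bij_betw_def by auto
qed

text \<open>\<open>X - P\<close> are the parents used up and \<open>I - X\<close> the newcomers; the
  matching built so far connects them, and \<open>unafl_sound\<close> extends it to the rest of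
  \<open>X\<close>.\<close>

lemma affl_sound:
  assumes X: "X \<subseteq> {..<n}" and "i \<le> n" and "affl j X ok i = (P, I, True)"
  shows "ok \<and> P \<subseteq> X \<and> X \<subseteq> I \<and> I \<subseteq> {..<n} \<and>
    (\<exists>m. bij_betw m (X - P) (I - X) \<and> (\<forall>p\<in>X - P. D p (m p)))"
  using assms(2,3)
proof (induction i arbitrary: P I)
  case 0
  then show ?case using X by (auto simp: bij_betw_def)
next
  case (Suc a)
  obtain P0 I0 b where p0: "affl j X ok a = (P0, I0, b)" by (cases "affl j X ok a") auto
  show ?case
  proof (cases "a \<in> A \<and> st a = j \<and> a \<noteq> v")
    case False
    then show ?thesis using Suc p0 by (auto split: if_splits)
  next
    case True
    define p where "p = first n (aff_parent n D A pr P0 a)"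
    have r: "p \<noteq> n" "a \<notin> I0" "P = P0 - {p}" "I = insert a I0" "b"
      using Suc.prems p0 True by (auto simp: Let_def p_def split: if_splits)
    then have "p < n" using first_le unfolding p_def by (metis le_neq_implies_less)
    then have ap: "aff_parent n D A pr P0 a p" unfolding p_def by (rule first_holds)
    have IH: "ok" "P0 \<subseteq> X" "X \<subseteq> I0" "I0 \<subseteq> {..<n}" using Suc.IH[OF _ p0[unfolded eqTrueI[OF r(5)]]] Suc.prems(1) r(5) by auto
    obtain m where m: "bij_betw m (X - P0) (I0 - X)" "\<forall>p\<in>X - P0. D p (m p)"
      using Suc.IH[of P0 I0] p0 Suc.prems(1) r(5) by auto
    have pX: "p \<in> P0" "D p a" using ap by (auto simp: aff_parent_def)
    have "X - P = insert p (X - P0)" using pX IH r(3) by auto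
    moreover have "I - X = insert a (I0 - X)" using r(2,4) IH by auto
    moreover have "bij_betw (m(p := a)) (insert p (X - P0)) (insert a (I0 - X))"
      using m(1) by (rule bij_betw_insert_upd) (use pX r in auto)
    moreover have "\<forall>q\<in>insert p (X - P0). D q ((m(p := a)) q)" using m(2) pX by auto
    ultimately have "\<exists>m. bij_betw m (X - P) (I - X) \<and> (\<forall>p\<in>X - P. D p (m p))" by metis
    then show ?thesis using IH r Suc.prems(1) by auto
  qed
qed

lemma unafl_sound:
  assumes X: "X \<subseteq> {..<n}" and "P \<subseteq> X" "X \<subseteq> I" "I \<subseteq> {..<n}"
    and m: "\<exists>m. bij_betw m (X - P) (I - X) \<and> (\<forall>p\<in>X - P. D p (m p))"
    and "i \<le> n" "unafl P I ok i = (J, True)"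
  shows "ok \<and> X \<subseteq> J \<and> J \<subseteq> {..<n} \<and>
    (\<exists>m. bij_betw m (X - {p \<in> P. i \<le> p}) (J - X) \<and> (\<forall>p\<in>X - {p \<in> P. i \<le> p}. D p (m p)))"
  using assms(6,7)
proof (induction i arbitrary: J)
  case 0
  then show ?case using assms by auto
next
  case (Suc p)
  obtain J0 b where p0: "unafl P I ok p = (J0, b)" by (cases "unafl P I ok p") auto
  show ?case
  proof (cases "p \<in> P")
    case False
    then have "{q \<in> P. Suc p \<le> q} = {q \<in> P. p \<le> q}" using Suc_le_eq le_neq_implies_less by (auto simp: Suc_le_eq order_less_le)
    then show ?thesis using Suc p0 False by (auto split: if_splits)
  next
    case True
    define u where "u = first n (free_child n D A J0 p)"
    have r: "u \<noteq> n" "J = insert u J0" "b"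
      using Suc.prems p0 True by (auto simp: Let_def u_def split: if_splits)
    then have "u < n" using first_le unfolding u_def by (metis le_neq_implies_less)
    then have ap: "free_child n D A J0 p u" unfolding u_def by (rule first_holds)
    have IH: "ok" "X \<subseteq> J0" "J0 \<subseteq> {..<n}" using Suc.IH[of J0] p0 Suc.prems(1) r(3) by auto
    obtain m where m: "bij_betw m (X - {q \<in> P. p \<le> q}) (J0 - X)" "\<forall>q\<in>X - {q \<in> P. p \<le> q}. D q (m q)"
      using Suc.IH[of J0] p0 Suc.prems(1) r(3) by auto
    have pX: "p \<in> X" "D p u" "u \<notin> J0" using ap True assms(2) by (auto simp: free_child_def)
    have e: "X - {q \<in> P. Suc p \<le> q} = insert p (X - {q \<in> P. p \<le> q})" using pX True by auto
    moreover have "J - X = insert u (J0 - X)" using r IH pX by auto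
    moreover have "bij_betw (m(p := u)) (insert p (X - {q \<in> P. p \<le> q})) (insert u (J0 - X))"
      using m(1) by (rule bij_betw_insert_upd) (use pX True in auto)
    moreover have "\<forall>q\<in>insert p (X - {q \<in> P. p \<le> q}). D q ((m(p := u)) q)" using m(2) pX by auto
    ultimately have "\<exists>m. bij_betw m (X - {q \<in> P. Suc p \<le> q}) (J - X) \<and>
        (\<forall>q\<in>X - {q \<in> P. Suc p \<le> q}. D q (m q))" by metis
    then show ?thesis using IH \<open>u < n\<close> r by auto
  qed
qed

lemma stage1_sound:
  assumes "X \<subseteq> {..<n}" "stage1 j (X, ok) = (Y, True)"
  shows "ok \<and> Y \<subseteq> {..<n} \<and> (Y = X \<or> advance D X Y)"
proof (cases "{..<n} \<subseteq> X")
  case True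
  then show ?thesis using assms by (auto simp: stage1_def)
next
  case False
  obtain P I b where a: "affl j X ok n = (P, I, b)" by (cases "affl j X ok n") auto
  with assms False have u: "unafl P I b n = (Y, True)" by (simp add: stage1_def)
  have b
  proof (rule ccontr)
    assume nb: "\<not> b"
    have "\<not> snd (unafl P I False i)" for i
      by (induction i) (auto simp: Let_def split: prod.splits if_splits)
    then show False using u nb by (metis (full_types) snd_conv)
  qed
  from affl_sound[OF assms(1) order_refl a[unfolded eqTrueI[OF this]]]
  have s: "ok" "P \<subseteq> X" "X \<subseteq> I" "I \<subseteq> {..<n}" "\<exists>m. bij_betw m (X - P) (I - X) \<and> (\<forall>p\<in>X - P. D p (m p))" by auto
  from unafl_sound[OF assms(1) s(2-5) order_refl u] have "X \<subseteq> Y" "Y \<subseteq> {..<n}" and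
    m: "\<exists>m. bij_betw m (X - {p \<in> P. n \<le> p}) (Y - X) \<and> (\<forall>p\<in>X - {p \<in> P. n \<le> p}. D p (m p))" by auto
  moreover have "{p \<in> P. n \<le> p} = {}" using s(2) assms(1) by fastforce
  ultimately show ?thesis using s(1) unfolding advance_def by auto
qed

text \<open>The length \<open>i\<close> of the chain may be smaller than \<open>j\<close>, because
  rounds after completion do not extend it.\<close>

lemma chk_sound:
  assumes "v < n" "chk j = (Y, True)"
  shows "Y \<subseteq> {..<n} \<and> (\<exists>i S. chain D v i S \<and> S i = Y)"
  using assms(2)
proof (induction j arbitrary: Y)
  case 0
  then show ?case using assms(1) by (auto simp: chain_def intro!: exI[of _ 0] exI[of _ "\<lambda>_. {v}"])
next
  case (Suc j)
  obtain X ok where c: "chk j = (X, ok)" by (cases "chk j") auto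
  have X: "X \<subseteq> {..<n}" if ok using Suc.IH[of X] c that by simp
  have st: "stage1 j (X, ok) = (Y, True)" using Suc.prems c by simp
  have ok
  proof (rule ccontr)
    assume nok: "\<not> ok"
    have "\<not> snd (snd (affl j X False i))" for i
      by (induction i) (auto simp: Let_def split: prod.splits if_splits)
    moreover have "\<not> snd (unafl P I False i)" for P I i
      by (induction i) (auto simp: Let_def split: prod.splits if_splits)
    ultimately have "\<not> snd (stage1 j (X, False))"
      unfolding stage1_def by (auto split: prod.splits) (metis snd_conv)
    then show False using st nok by simp
  qed
  from stage1_sound[OF X[OF this] st] have Y: "Y \<subseteq> {..<n}" "Y = X \<or> advance D X Y" by auto
  from Suc.IH[of X] c \<open>ok\<close> obtain i S where S: "chain D v i S" "S i = X" by auto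
  show ?case
  proof (cases "Y = X")
    case True
    then show ?thesis using S Y by blast
  next
    case False
    then have "chain D v (Suc i) (S(Suc i := Y))" using S Y(2) unfolding chain_def by (auto simp: less_Suc_eq)
    moreover have "(S(Suc i := Y)) (Suc i) = Y" by simp
    ultimately show ?thesis using Y(1) by blast
  qed
qed

lemma accepts_sound:
  assumes "v < n" "n = 2 ^ k" accepts
  shows "TFP k n D v"
proof -
  obtain Y where Y: "chk n = (Y, True)" "{..<n} \<subseteq> Y" using assms(3) unfolding accepts_def by (cases "chk n") auto
  from chk_sound[OF assms(1) Y(1)] obtain i S where S: "chain D v i S" "S i = Y" "Y \<subseteq> {..<n}" by blast
  have Si: "S i = {0..<n}" unfolding S(2) atLeast0LessThan using S(3) Y(2) by (rule subset_antisym)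
  moreover have "card (S i) = 2 ^ i" using chain_card[OF S(1) order_refl] by blast
  \<comment> \<open>The length of the chain is recovered from its last set:
    \<open>2 ^ i = n = 2 ^ k\<close>.\<close>
  ultimately have "2 ^ i = (2::nat) ^ k" using assms(2) by (metis card_atLeastLessThan diff_zero)
  then have "i = k" by simp
  then show ?thesis using chain_imp_TFP[OF S(1)] Si by blast
qed

text \<open>A round of a given solution, from \<open>S\<close> to \<open>S'\<close> along
  \<open>\<mu>\<close>, runs beside the greedy one. The parents left in the solution are those whose
  child is unaffected or not yet processed. The greedy ones agree with them inside \<open>A\<close>,
  are equally many, and outside \<open>A\<close> are at least as early.\<close>

lemma affl_complete:
  assumes ord: "ordered n D A r" and AV: "A \<subseteq> {..<n}"
    and S: "S \<subseteq> S'" "S' \<subseteq> {..<n}" and \<mu>: "bij_betw \<mu> S (S' - S)" "\<And>p. p \<in> S \<Longrightarrow> D p (\<mu> p)"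
    and X: "X \<subseteq> {..<n}" "X \<inter> A = S \<inter> A" "\<And>t. below r (S - A) t \<le> below r (X - A) t" "card X = card S"
    and st: "\<And>a. a \<in> A \<Longrightarrow> st a = j \<and> a \<noteq> v \<longleftrightarrow> a \<in> S' - S"
    and pr: "\<And>p. p \<in> S \<Longrightarrow> \<mu> p \<in> A \<Longrightarrow> pr (\<mu> p) = (if p \<in> A then p else \<mu> p)"
    and irr: "\<And>u. \<not> D u u"
    and i: "i \<le> n"
  shows "\<exists>P. affl j X True i = (P, X \<union> {a \<in> A. a < i \<and> a \<in> S' - S}, True) \<and> P \<subseteq> X \<and>
    P \<inter> A = {p \<in> S. \<not> (\<mu> p \<in> A \<and> \<mu> p < i)} \<inter> A \<and>
    (\<forall>t. below r ({p \<in> S. \<not> (\<mu> p \<in> A \<and> \<mu> p < i)} - A) t \<le> below r (P - A) t) \<and>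
    card P = card {p \<in> S. \<not> (\<mu> p \<in> A \<and> \<mu> p < i)}"
  using i
proof (induction i)
  case 0
  then show ?case using X by auto
next
  case (Suc a)
  define Q where "Q = {p \<in> S. \<not> (\<mu> p \<in> A \<and> \<mu> p < a)}"
  define Q' where "Q' = {p \<in> S. \<not> (\<mu> p \<in> A \<and> \<mu> p < Suc a)}"
  define I where "I = X \<union> {b \<in> A. b < a \<and> b \<in> S' - S}"
  have finS: "finite S" by (rule finite_subset[OF subset_trans[OF S] finite_lessThan])
  then have finQ: "finite Q" by (simp add: Q_def)
  have "a \<le> n" using Suc.prems by simp
  from Suc.IH[OF this, folded Q_def I_def] obtain P where P: "affl j X True a = (P, I, True)" "P \<subseteq> X" "P \<inter> A = Q \<inter> A"
    "\<And>t. below r (Q - A) t \<le> below r (P - A) t" "card P = card Q" by blast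
  have finP: "finite P" by (rule finite_subset[OF subset_trans[OF P(2) X(1)] finite_lessThan])
  show ?case
  proof (cases "a \<in> A \<and> a \<in> S' - S")
    case False
    have "\<mu> p < Suc a \<longleftrightarrow> \<mu> p < a" if "p \<in> S" "\<mu> p \<in> A" for p
      using False that \<mu>(1) by (auto simp: less_Suc_eq bij_betw_def)
    then have "Q' = Q" unfolding Q_def Q'_def by auto
    moreover have "X \<union> {b \<in> A. b < Suc a \<and> b \<in> S' - S} = I" using False unfolding I_def by (auto simp: less_Suc_eq)
    moreover have "\<not> (a \<in> A \<and> st a = j \<and> a \<noteq> v)" using False st by blast
    ultimately show ?thesis using P unfolding Q'_def[symmetric] by (intro exI[of _ P]) auto
  next
    case True
    then have cond: "a \<in> A \<and> st a = j \<and> a \<noteq> v" using st by blast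
    have "a \<in> \<mu> ` S" using True \<mu>(1) by (simp add: bij_betw_def)
    then obtain p0 where p0: "p0 \<in> S" "\<mu> p0 = a" by blast
    have p0Q: "p0 \<in> Q" using p0 by (simp add: Q_def)
    have inj: "\<mu> p = a \<longleftrightarrow> p = p0" if "p \<in> S" for p using \<mu>(1) p0 that by (auto simp: bij_betw_def inj_on_def)
    have Q': "Q' = Q - {p0}" unfolding Q_def Q'_def using inj True by (auto simp: less_Suc_eq)
    have an: "a < n" "p0 < n" using True AV p0 S by auto
    have D0: "D p0 a" using \<mu>(2)[OF p0(1)] p0(2) by simp
    have aI: "a \<notin> I" using True X(2) by (auto simp: I_def)
    define q where "q = first n (aff_parent n D A pr P a)"
    have pra: "pr a = (if p0 \<in> A then p0 else a)" using pr[OF p0(1)] p0(2) True by simp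
    have ex: "\<exists>q<n. aff_parent n D A pr P a q"
    proof (cases "p0 \<in> A")
      case T: True
      have "p0 \<in> P" using P(3) p0Q T by blast
      moreover have "p0 \<noteq> a" using D0 irr by blast
      ultimately show ?thesis using pra T D0 an by (auto simp: aff_parent_def)
    next
      case F: False
      have r0: "r p0 < r a" using ord D0 F an unfolding ordered_def by blast
      \<comment> \<open>In the solution \<open>p0\<close> precedes \<open>a\<close>, and the greedy
        side has at least as many unaffected parents before \<open>a\<close>. The last of them is
        the parent asked for by \<open>aff_parent\<close>.\<close>
      have "\<exists>q\<in>P - A. r q < r a" by (rule ex_before[OF P(4), of p0]) (use finQ p0Q F r0 in auto)
      then have ne: "{q \<in> P - A. r q < r a} \<noteq> {}" "finite {q \<in> P - A. r q < r a}" using finP by auto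
      then have "Max (r ` {q \<in> P - A. r q < r a}) \<in> r ` {q \<in> P - A. r q < r a}" by (intro Max_in) auto
      then obtain q where q: "q \<in> P - A" "r q < r a" "r q = Max (r ` {q \<in> P - A. r q < r a})" by auto
      have qmax: "r q' \<le> r q" if "q' \<in> P - A" "r q' < r a" for q' unfolding q(3) using that ne(2) by (intro Max_ge) auto
      have qn: "q < n" using q(1) P(2) X(1) by auto
      have "D q a" using ord q(1,2) qn an unfolding ordered_def by blast
      moreover have "\<not> (\<exists>q'<n. q' \<in> P \<and> q' \<notin> A \<and> D q' a \<and> D q q')"
      proof
        assume "\<exists>q'<n. q' \<in> P \<and> q' \<notin> A \<and> D q' a \<and> D q q'"
        then obtain q' where q': "q' < n" "q' \<in> P" "q' \<notin> A" "D q' a" "D q q'" by blast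
        then have "r q' < r a" "r q < r q'" using ord qn an unfolding ordered_def by blast+
        then show False using qmax[of q'] q' by auto
      qed
      ultimately have "aff_parent n D A pr P a q" unfolding aff_parent_def pra using F q(1) by auto
      then show ?thesis using qn by blast
    qed
    then have qn: "q < n" unfolding q_def by (simp add: first_less_iff)
    then have qp: "aff_parent n D A pr P a q" unfolding q_def by (rule first_holds)
    have step: "affl j X True (Suc a) = (P - {q}, insert a I, True)"
      using P(1) cond aI qn unfolding affl.simps q_def[symmetric] by (simp add: q_def[symmetric])
    have qP: "q \<in> P" using qp by (simp add: aff_parent_def)
    have I': "X \<union> {b \<in> A. b < Suc a \<and> b \<in> S' - S} = insert a I" using True unfolding I_def by (auto simp: less_Suc_eq)
    have card': "card (P - {q}) = card Q'" unfolding Q' using P(5) qP p0Q finP finQ by simp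
    have "(P - {q}) \<inter> A = Q' \<inter> A \<and> (\<forall>t. below r (Q' - A) t \<le> below r (P - {q} - A) t)"
    proof (cases "p0 \<in> A")
      case T: True
      have "pr a \<noteq> a" using pra T D0 irr by auto
      then have "q = p0" using qp pra T by (auto simp: aff_parent_def)
      moreover have "Q' - A = Q - A" "P - {q} - A = P - A" using T \<open>q = p0\<close> Q' by auto
      ultimately show ?thesis using P(3,4) Q' by auto
    next
      case F: False
      then have q': "q \<in> P" "q \<notin> A" "D q a" "\<And>q'. q' < n \<Longrightarrow> q' \<in> P \<Longrightarrow> q' \<notin> A \<Longrightarrow> D q' a \<Longrightarrow> \<not> D q q'"
        using qp pra by (auto simp: aff_parent_def)
      have r0: "r p0 < r a" "r q < r a" using ord D0 F an q' qn unfolding ordered_def by blast+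
      have mx: "r x \<le> r q" if "x \<in> P - A" "r x < r a" for x
      proof -
        have "x < n" using that P(2) X(1) by auto
        then have "D x a" using ord that an unfolding ordered_def by blast
        then have "\<not> D q x" using q'(4) that \<open>x < n\<close> by blast
        then show ?thesis using ord that \<open>x < n\<close> qn unfolding ordered_def by (metis Diff_iff not_le)
      qed
      have "below r (Q - A - {p0}) t \<le> below r (P - A - {q}) t" for t
        by (rule remove_latest[OF _ _ P(4), where ra = "r a"]) (use finP finQ p0Q F r0 q' mx in auto)
      moreover have "Q' - A = Q - A - {p0}" "P - {q} - A = P - A - {q}" unfolding Q' by auto
      moreover have "(P - {q}) \<inter> A = Q' \<inter> A" using P(3) q'(2) F unfolding Q' by auto
      ultimately show ?thesis by simp
    qed
    then show ?thesis using step I' card' P(2) unfolding Q'_def[symmetric] by (intro exI[of _ "P - {q}"]) auto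
  qed
qed

text \<open>\<open>G\<close> is meant to be the set of unaffected players that the given solution
  leaves out of this round. Once all parents are served, the invariant compares the players left out
  by the greedy side with \<open>G\<close>.\<close>

lemma unafl_complete:
  assumes ord: "ordered n D A r" and I: "I \<subseteq> {..<n}" and P: "P \<subseteq> {..<n}" and fG: "finite G"
    and inv: "\<And>t. below r ({..<n} - A - I) (Suc t) \<le> below r P t + below r G (Suc t)"
    and tot: "card ({..<n} - A - I) = card P + card G" and i: "i \<le> n"
  shows "\<exists>J. unafl P I True i = (J, True) \<and> J \<subseteq> {..<n} \<and> J \<inter> A = I \<inter> A \<and>
    (\<forall>t. below r ({..<n} - A - J) (Suc t) \<le> below r {p \<in> P. i \<le> p} t + below r G (Suc t)) \<and>
    card ({..<n} - A - J) = card {p \<in> P. i \<le> p} + card G"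
  using i
proof (induction i)
  case 0
  then show ?case using assms by auto
next
  case (Suc p)
  define R where "R = {q \<in> P. p \<le> q}"
  have finR: "finite R" using finite_subset[OF P finite_lessThan] unfolding R_def by simp
  have "p \<le> n" using Suc.prems by simp
  from Suc.IH[OF this, folded R_def] obtain J where J: "unafl P I True p = (J, True)" "J \<subseteq> {..<n}" "J \<inter> A = I \<inter> A"
    "\<And>t. below r ({..<n} - A - J) (Suc t) \<le> below r R t + below r G (Suc t)"
    "card ({..<n} - A - J) = card R + card G" by blast
  show ?case
  proof (cases "p \<in> P")
    case False
    then have "{q \<in> P. Suc p \<le> q} = R" unfolding R_def using le_eq_less_or_eq by (auto simp: Suc_le_eq)
    then show ?thesis using J False by (intro exI[of _ J]) auto
  next
    case True
    let ?F = "{..<n} - A - J"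
    have pR: "p \<in> R" using True by (simp add: R_def)
    have pn: "p < n" using True P by auto
    have R': "{q \<in> P. Suc p \<le> q} = R - {p}" unfolding R_def by auto
    define u where "u = first n (free_child n D A J p)"
    have Dr: "D x y \<longleftrightarrow> r x < r y" if "x < n" "y \<in> ?F" for x y using ord that unfolding ordered_def by blast
    have "\<exists>u<n. free_child n D A J p u"
    proof -
      have "\<exists>u\<in>?F. r p < r u" by (rule take_earliest(1)[OF _ finR fG pR J(4,5)]) simp
      then have ne: "{u \<in> ?F. r p < r u} \<noteq> {}" "finite {u \<in> ?F. r p < r u}" by auto
      then have "Min (r ` {u \<in> ?F. r p < r u}) \<in> r ` {u \<in> ?F. r p < r u}" by (intro Min_in) auto
      then obtain u where u: "u \<in> ?F" "r p < r u" "r u = Min (r ` {u \<in> ?F. r p < r u})" by auto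
      have "r u \<le> r w" if "w \<in> ?F" "r p < r w" for w unfolding u(3) using that ne(2) by (intro Min_le) auto
      then have "\<not> (D p w \<and> D w u)" if "w \<in> ?F" for w using that Dr[of p w] Dr[of w u] pn u(1) by fastforce
      then show ?thesis using u Dr[of p u] pn unfolding free_child_def by (intro exI[of _ u]) auto
    qed
    then have un: "u < n" unfolding u_def by (simp add: first_less_iff)
    then have uc: "free_child n D A J p u" unfolding u_def by (rule first_holds)
    have uF: "u \<in> ?F" "D p u" using uc un by (auto simp: free_child_def)
    have ur: "r p < r u" using Dr[OF pn uF(1)] uF(2) by simp
    have mn: "r u \<le> r w" if "w \<in> ?F" "r p < r w" for w
    proof -
      have "D p w" using Dr[OF pn that(1)] that(2) by simp
      then have "\<not> D w u" using uc that(1) unfolding free_child_def by auto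
      then show ?thesis using Dr[of w u] uF(1) that(1) by auto
    qed
    have step: "unafl P I True (Suc p) = (insert u J, True)"
      using J(1) True un by (simp add: u_def[symmetric] Let_def)
    have e: "{..<n} - A - insert u J = ?F - {u}" by auto
    have "below r (?F - {u}) (Suc t) \<le> below r (R - {p}) t + below r G (Suc t)" for t
      by (rule take_earliest(2)[OF _ finR fG pR J(4,5) uF(1) ur mn]) auto
    moreover have "card (?F - {u}) = card (R - {p}) + card G"
      using J(5) card_Suc_Diff1[OF finR pR] card_Suc_Diff1[of ?F u] uF(1) by simp
    ultimately show ?thesis unfolding R' using step e J(2,3) uF un
      by (intro exI[of _ "insert u J"]) auto
  qed
qed

text \<open>The invariant carried through the rounds concerns the players still outside: both sides
  agree on \<open>A\<close>, leave out equally many unaffected players, and the greedy side leaves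
  out later ones.\<close>

lemma stage1_complete:
  assumes ord: "ordered n D A r" and AV: "A \<subseteq> {..<n}"
    and S: "S \<subseteq> S'" "S' \<subseteq> {..<n}" and \<mu>: "bij_betw \<mu> S (S' - S)" "\<And>p. p \<in> S \<Longrightarrow> D p (\<mu> p)"
    and ne: "S \<noteq> {..<n}"
    and X: "X \<subseteq> {..<n}" "X \<inter> A = S \<inter> A" "card ({..<n} - A - X) = card ({..<n} - A - S)"
      "\<And>t. below r ({..<n} - A - X) t \<le> below r ({..<n} - A - S) t"
    and st: "\<And>a. a \<in> A \<Longrightarrow> st a = j \<and> a \<noteq> v \<longleftrightarrow> a \<in> S' - S"
    and pr: "\<And>p. p \<in> S \<Longrightarrow> \<mu> p \<in> A \<Longrightarrow> pr (\<mu> p) = (if p \<in> A then p else \<mu> p)"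
    and irr: "\<And>u. \<not> D u u"
  shows "\<exists>Y. stage1 j (X, True) = (Y, True) \<and> Y \<subseteq> {..<n} \<and> Y \<inter> A = S' \<inter> A \<and>
    card ({..<n} - A - Y) = card ({..<n} - A - S') \<and>
    (\<forall>t. below r ({..<n} - A - Y) t \<le> below r ({..<n} - A - S') t)"
proof -
  let ?V = "{..<n}"
  have program_vars: "S \<subseteq> ?V" using S by (rule subset_trans)
  have fin: "finite S" "finite X" "finite S'" using program_vars X(1) S(2) by (auto intro: finite_subset[OF _ finite_lessThan])
  have nX: "\<not> ?V \<subseteq> X"
  proof
    assume "?V \<subseteq> X"
    then have "?V - A - X = {}" by auto
    then have "?V - A - S = {}" using X(3) by (metis card_0_eq card.empty finite_Diff finite_lessThan)
    moreover have "A \<subseteq> S" using X(2) \<open>?V \<subseteq> X\<close> AV by blast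
    ultimately show False using ne program_vars by blast
  qed
  \<comment> \<open>Later players outside means earlier players inside, the form in which parents
    are compared.\<close>
  have b1: "below r (S - A) t \<le> below r (X - A) t" for t
  proof (rule below_compl[of "?V - A"])
    have "?V - A - (X - A) = ?V - A - X" "?V - A - (S - A) = ?V - A - S" by auto
    then show "\<And>t. below r (?V - A - (X - A)) t \<le> below r (?V - A - (S - A)) t" using X(4) by simp
  qed (use X program_vars in auto)
  have cXS: "card X = card S"
  proof -
    have c: "card (?V - A) = card (Z - A) + card (?V - A - Z)" if "Z \<subseteq> ?V" for Z
      using that by (subst card_Un_disjoint[symmetric]) (auto intro: arg_cong[of _ _ card] finite_subset[OF _ finite_lessThan])
    have c2: "card Z = card (Z \<inter> A) + card (Z - A)" if "finite Z" for Z
      using that by (subst card_Un_disjoint[symmetric]) (auto intro: arg_cong[of _ _ card])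
    show ?thesis using c[OF X(1)] c[OF program_vars] c2[OF fin(1)] c2[OF fin(2)] X(2,3) by simp
  qed
  define Q where "Q = {p \<in> S. \<mu> p \<notin> A}"
  have "{p \<in> S. \<not> (\<mu> p \<in> A \<and> \<mu> p < n)} = Q" using AV unfolding Q_def by auto
  moreover have "X \<union> {a \<in> A. a < n \<and> a \<in> S' - S} = X \<union> (A \<inter> (S' - S))" using AV by auto
  moreover note affl_complete[OF ord AV S \<mu> X(1,2) b1 cXS st pr irr order_refl]
  ultimately obtain P where P: "affl j X True n = (P, X \<union> (A \<inter> (S' - S)), True)" "P \<subseteq> X" "P \<inter> A = Q \<inter> A"
    "\<And>t. below r (Q - A) t \<le> below r (P - A) t" "card P = card Q" by auto
  define I where "I = X \<union> (A \<inter> (S' - S))"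
  define G where "G = ?V - A - S'"
  have finQ: "finite Q" using fin by (simp add: Q_def)
  have finP: "finite P" using P(2) fin(2) by (rule finite_subset)
  have imQ: "\<mu> ` Q = S' - S - A" using \<mu>(1) unfolding Q_def by (auto simp: bij_betw_def)
  have injQ: "inj_on \<mu> Q" using \<mu>(1) by (auto simp: bij_betw_def Q_def inj_on_def)
  have split: "?V - A - S = \<mu> ` Q \<union> G" "\<mu> ` Q \<inter> G = {}" using S program_vars unfolding imQ G_def by auto
  have fas_inv: "?V - A - I = ?V - A - X" unfolding I_def by auto
  have finG: "finite G" by (simp add: G_def)
  have part: "below r Z t = below r (Z \<inter> A) t + below r (Z - A) t" if "finite Z" for Z t
    using below_Un[of "Z \<inter> A" "Z - A" r t] that by (simp add: Int_Diff_Un Int_Diff_disjoint)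
  have inv: "below r (?V - A - I) (Suc t) \<le> below r P t + below r G (Suc t)" for t
  proof -
    have "below r (?V - A - I) (Suc t) \<le> below r (\<mu> ` Q) (Suc t) + below r G (Suc t)"
      unfolding fas_inv using X(4)[of "Suc t"] below_Un[OF _ finG split(2), of r "Suc t"] finQ split(1) by simp
    moreover have "below r (\<mu> ` Q) (Suc t) \<le> below r Q t"
    proof (rule matching_below[OF finQ injQ])
      fix p assume "p \<in> Q"
      then have "p \<in> S" "\<mu> p \<notin> A" by (auto simp: Q_def)
      moreover have "\<mu> p \<in> S'" using \<open>p \<in> S\<close> \<mu>(1) by (auto simp: bij_betw_def)
      ultimately show "r p < r (\<mu> p)" using ord \<mu>(2)[of p] program_vars S(2) unfolding ordered_def by blast
    qed
    moreover have "below r Q t \<le> below r P t" using part[OF finQ, of t] part[OF finP, of t] P(3) P(4)[of t] by simp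
    ultimately show ?thesis by simp
  qed
  have tot: "card (?V - A - I) = card P + card G"
    unfolding fas_inv X(3) split(1) using card_Un_disjoint[OF _ finG split(2)] finQ card_image[OF injQ] P(5) by simp
  have IV: "I \<subseteq> ?V" using X(1) S(2) unfolding I_def by auto
  have "P \<subseteq> ?V" using P(2) X(1) by auto
  from unafl_complete[OF ord IV this finG inv tot order_refl] obtain Y where
    Y: "unafl P I True n = (Y, True)" "Y \<subseteq> ?V" "Y \<inter> A = I \<inter> A"
    "\<And>t. below r (?V - A - Y) (Suc t) \<le> below r {p \<in> P. n \<le> p} t + below r G (Suc t)"
    "card (?V - A - Y) = card {p \<in> P. n \<le> p} + card G" by blast
  have e: "{p \<in> P. n \<le> p} = {}" using \<open>P \<subseteq> ?V\<close> by auto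
  have "stage1 j (X, True) = (Y, True)" using nX P(1) Y(1) unfolding stage1_def I_def by simp
  moreover have "Y \<inter> A = S' \<inter> A" using Y(3) X(2) S(1) unfolding I_def by auto
  \<comment> \<open>The bound is available for successors only; nothing lies before rank 0.\<close>
  moreover have "below r (?V - A - Y) t \<le> below r G t" for t
    using Y(4)[of "t - 1"] unfolding e by (cases t) (auto simp: below_def)
  ultimately show ?thesis using Y(2,5) e unfolding G_def by auto
qed

lemma accepts_complete:
  assumes T: "tournament n D" and v: "v < n" "v \<in> A" and AV: "A \<subseteq> {..<n}" and n: "n = 2 ^ k"
    and ord: "ordered n D A r" and ch: "chain D v k S" and Sk: "S k = {..<n}"
    and \<mu>: "\<And>j. j < k \<Longrightarrow> bij_betw (\<mu> j) (S j) (S (Suc j) - S j)" "\<And>j p. j < k \<Longrightarrow> p \<in> S j \<Longrightarrow> D p (\<mu> j p)"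
    and st: "\<And>a j. a \<in> A \<Longrightarrow> j < k \<Longrightarrow> st a = j \<and> a \<noteq> v \<longleftrightarrow> a \<in> S (Suc j) - S j"
    and pr: "\<And>j p. j < k \<Longrightarrow> p \<in> S j \<Longrightarrow> \<mu> j p \<in> A \<Longrightarrow> pr (\<mu> j p) = (if p \<in> A then p else \<mu> j p)"
  shows accepts
proof -
  let ?V = "{..<n}"
  have sub: "S j \<subseteq> S (Suc j)" if "j < k" for j using ch that unfolding chain_def advance_def by blast
  have program_vars: "S j \<subseteq> ?V" if "j \<le> k" for j using that
  proof (induction "k - j" arbitrary: j)
    case 0
    then show ?case using Sk by simp
  next
    case (Suc d)
    then have "S (Suc j) \<subseteq> ?V" by (intro Suc.hyps(1)) auto
    moreover have "j < k" using Suc.hyps(2) by simp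
    ultimately show ?case using sub[of j] by auto
  qed
  have inv: "\<exists>I. chk j = (I, True) \<and> I \<subseteq> ?V \<and> I \<inter> A = S j \<inter> A \<and> card (?V - A - I) = card (?V - A - S j) \<and>
    (\<forall>t. below r (?V - A - I) t \<le> below r (?V - A - S j) t)" if "j \<le> k" for j
    using that
  proof (induction j)
    case 0
    then show ?case using ch v by (auto simp: chain_def)
  next
    case (Suc j)
    then obtain I where I: "chk j = (I, True)" "I \<subseteq> ?V" "I \<inter> A = S j \<inter> A" "card (?V - A - I) = card (?V - A - S j)"
      "\<And>t. below r (?V - A - I) t \<le> below r (?V - A - S j) t" by auto
    have jk: "j < k" using Suc.prems by simp
    have "card (S j) = 2 ^ j" using chain_card[OF ch, of j] jk by simp
    then have ne: "S j \<noteq> ?V" using power_strict_increasing[OF jk, of "2::nat"] unfolding n by (metis card_lessThan less_irrefl one_less_numeral_iff semiring_norm(76))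
    from stage1_complete[OF ord AV sub[OF jk] program_vars[OF Suc.prems] \<mu>(1)[OF jk] \<mu>(2)[OF jk] ne I(2-5) st[OF _ jk] pr[OF jk]
        tournament_irrefl[OF T]]
    show ?case unfolding chk.simps I(1) .
  qed
  then obtain I where I: "chk k = (I, True)" "I \<subseteq> ?V" "I \<inter> A = S k \<inter> A" "card (?V - A - I) = card (?V - A - S k)" by blast
  have "?V - A - S k = {}" using Sk by auto
  then have "card (?V - A - I) = 0" using I(4) by simp
  then have "?V - A - I = {}" by simp
  moreover have "A \<subseteq> I" using I(3) Sk AV by blast
  ultimately have full: "?V \<subseteq> I" by auto
  have "chk (k + d) = (I, True)" for d by (induction d) (use I(1) full in \<open>auto simp: stage1_def\<close>)
  moreover have "k \<le> n" using n less_exp[of k] by simp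
  ultimately have "chk n = (I, True)" by (metis le_add_diff_inverse)
  then show ?thesis using full unfolding accepts_def by simp
qed

end

text \<open>The guess is read off a chain. \<open>st a\<close> is the round in which
  \<open>a\<close> enters, and \<open>pr a\<close> is its parent if affected and \<open>a\<close>
  itself otherwise. In this way \<open>pr\<close> takes values in \<open>A\<close> alone, which
  keeps the space of guesses independent of \<open>n\<close> but for the stages. \<open>v\<close>,
  which never enters, gets harmless values.\<close>

lemma TFP_imp_accepts:
  assumes T: "tournament n D" and v: "v < n" "v \<in> A" and AV: "A \<subseteq> {..<n}" and n: "n = 2 ^ k"
    and ord: "ordered n D A r" and "TFP k n D v"
  shows "\<exists>st pr. (\<forall>a\<in>A. st a \<le> k \<and> pr a \<in> A) \<and> accepts n D v A st pr"
proof -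
  from TFP_imp_chain[OF T assms(7)] obtain S where ch: "chain D v k S" and Sk: "S k = {..<n}"
    by (auto simp: atLeast0LessThan)
  have "\<forall>j. \<exists>\<mu>. j < k \<longrightarrow> bij_betw \<mu> (S j) (S (Suc j) - S j) \<and> (\<forall>p\<in>S j. D p (\<mu> p))"
    using ch unfolding chain_def advance_def by blast
  then obtain \<mu> where \<mu>: "\<And>j. j < k \<Longrightarrow> bij_betw (\<mu> j) (S j) (S (Suc j) - S j)"
      "\<And>j p. j < k \<Longrightarrow> p \<in> S j \<Longrightarrow> D p (\<mu> j p)" by metis
  have sub: "S j \<subseteq> S (Suc j)" if "j < k" for j using ch that unfolding chain_def advance_def by blast
  have mono: "S i \<subseteq> S j" if "i \<le> j" "j \<le> k" for i j
    using that
  proof (induction j rule: dec_induct)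
    case (step m)
    then show ?case using sub[of m] by auto
  qed simp
  have S0: "S 0 = {v}" using ch by (simp add: chain_def)
  define st where "st = (\<lambda>a. if a = v then 0 else LEAST j. a \<in> S (Suc j))"
  define pr where "pr = (\<lambda>a. if a = v then v else
     let p = inv_into (S (st a)) (\<mu> (st a)) a in if p \<in> A then p else a)"
  have vS: "v \<in> S j" if "j \<le> k" for j using mono[of 0 j] that S0 by auto
  have uni: "st a = j" if "a \<in> S (Suc j) - S j" "j < k" for a j
  proof -
    have "(LEAST j. a \<in> S (Suc j)) = j"
    proof (rule Least_equality)
      fix i assume "a \<in> S (Suc i)"
      then show "j \<le> i" using that mono[of "Suc i" j] by (metis DiffE le_less_linear less_imp_le Suc_leI subsetD)
    qed (use that in simp)
    moreover have "a \<noteq> v" using that vS[of j] by auto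
    ultimately show ?thesis by (simp add: st_def)
  qed
  have ex: "\<exists>j<k. a \<in> S (Suc j) - S j" if a: "a < n" "a \<noteq> v" for a
  proof -
    have "a \<in> S k" using Sk a by simp
    define i where "i = (LEAST i. a \<in> S i)"
    have "a \<in> S i" "i \<le> k" unfolding i_def using \<open>a \<in> S k\<close> by (auto intro: LeastI Least_le)
    moreover have "i \<noteq> 0" using \<open>a \<in> S i\<close> a(2) S0 by (cases i) auto
    moreover have "a \<notin> S (i - 1)" using \<open>i \<noteq> 0\<close> not_less_Least[of "i - 1" "\<lambda>i. a \<in> S i"] unfolding i_def by simp
    ultimately show ?thesis by (intro exI[of _ "i - 1"]) auto
  qed
  have st: "st a = j \<and> a \<noteq> v \<longleftrightarrow> a \<in> S (Suc j) - S j" if "a \<in> A" "j < k" for a j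
  proof
    assume a: "st a = j \<and> a \<noteq> v"
    then show "a \<in> S (Suc j) - S j" using ex[of a] uni that AV by blast
  next
    assume "a \<in> S (Suc j) - S j"
    then show "st a = j \<and> a \<noteq> v" using uni that vS[of j] by auto
  qed
  have pr: "pr (\<mu> j p) = (if p \<in> A then p else \<mu> j p)" if "j < k" "p \<in> S j" for j p
  proof -
    have m: "\<mu> j p \<in> S (Suc j) - S j" using \<mu>(1)[OF that(1)] that(2) by (auto simp: bij_betw_def)
    then have "st (\<mu> j p) = j" using uni that by blast
    moreover have "\<mu> j p \<noteq> v" using m vS[of j] that by auto
    moreover have "inv_into (S j) (\<mu> j) (\<mu> j p) = p" using \<mu>(1)[OF that(1)] that(2) by (simp add: bij_betw_inv_into_left)
    ultimately show ?thesis unfolding pr_def by simp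
  qed
  have "accepts n D v A st pr"
    by (rule accepts_complete[OF T v AV n ord ch Sk \<mu> st pr])
  moreover have "st a \<le> k" if "a \<in> A" for a
  proof (cases "a = v")
    case False
    have "a < n" using that AV by auto
    from ex[OF this False] obtain j where "j < k" "a \<in> S (Suc j) - S j" by blast
    then show ?thesis using uni by fastforce
  qed (simp add: st_def)
  moreover have "pr a \<in> A" if "a \<in> A" for a unfolding pr_def using that v(2) by (auto simp: Let_def)
  ultimately show ?thesis by blast
qed

section \<open>Odometers\<close>

context
  fixes n :: nat and R X :: "nat \<Rightarrow> bool"
begin

text \<open>Adds one to a number whose digits stand in the rows satisfying \<open>R\<close>, lowest
  row as least significant, the digits being the elements of \<open>X\<close> below \<open>n\<close>
  in increasing order. The second component is the carry; at the end it says that the string has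
  wrapped around and all strings have been seen.\<close>

primrec odo :: "nat \<Rightarrow> (nat \<Rightarrow> nat) \<Rightarrow> (nat \<Rightarrow> nat) \<times> bool" where
  "odo 0 f = (f, True)"
| "odo (Suc i) f = (case odo i f of (g, c) \<Rightarrow>
     if c \<and> R i then (let q = first n (\<lambda>q. X q \<and> g i < q) in
       if q = n then (g(i := first n X), True) else (g(i := q), False))
     else (g, c))"

text \<open>The numerical value of the digit \<open>y\<close>: digits are arbitrary indices, and
  their value is their position among the admissible ones.\<close>

definition digit_index :: "nat \<Rightarrow> nat" where "digit_index y = card {q. q < n \<and> X q \<and> q < y}"

definition radix :: nat where "radix = card {q. q < n \<and> X q}"

definition row_count :: "nat \<Rightarrow> nat" where "row_count i = card {a. a < i \<and> R a}"

primrec rank :: "nat \<Rightarrow> (nat \<Rightarrow> nat) \<Rightarrow> nat" where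
  "rank 0 f = 0"
| "rank (Suc i) f = rank i f + (if R i then digit_index (f i) * radix ^ row_count i else 0)"

definition valid :: "(nat \<Rightarrow> nat) \<Rightarrow> bool" where
  "valid f \<longleftrightarrow> (\<forall>a<n. R a \<longrightarrow> f a < n \<and> X (f a))"

lemma odo_frame: "i \<le> a \<Longrightarrow> fst (odo i f) a = f a"
  by (induction i) (auto simp: Let_def split: prod.splits)

lemma first_X: "\<exists>q<n. X q \<Longrightarrow> first n X < n \<and> X (first n X)"
  using first_less_iff first_holds by blast

lemma odo_valid: "\<exists>q<n. X q \<Longrightarrow> valid f \<Longrightarrow> valid (fst (odo i f))"
proof (induction i)
  case (Suc i)
  obtain g c where g: "odo i f = (g, c)" by (cases "odo i f") auto
  define q where "q = first n (\<lambda>q. X q \<and> g i < q)"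
  have "q < n \<Longrightarrow> X q" using first_holds unfolding q_def by blast
  moreover have "q \<le> n" unfolding q_def by (rule first_le)
  ultimately show ?case using Suc g first_X[OF Suc.prems(1)] by (auto simp: valid_def Let_def q_def[symmetric])
qed auto

lemma row_count_Suc: "row_count (Suc i) = (if R i then Suc (row_count i) else row_count i)"
proof -
  have "{a. a < Suc i \<and> R a} = (if R i then insert i {a. a < i \<and> R a} else {a. a < i \<and> R a})"
    by (auto simp: less_Suc_eq)
  then show ?thesis by (simp add: row_count_def)
qed

lemma digit_index_less: "y < n \<Longrightarrow> X y \<Longrightarrow> digit_index y < radix"
  unfolding digit_index_def radix_def by (rule psubset_card_mono) auto

lemma rank_cong: "(\<And>a. a < i \<Longrightarrow> f a = g a) \<Longrightarrow> rank i f = rank i g"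
  by (induction i) auto

lemma rank_less: "valid f \<Longrightarrow> i \<le> n \<Longrightarrow> rank i f < radix ^ row_count i"
proof (induction i)
  case 0
  show ?case by (simp add: row_count_def)
next
  case (Suc i)
  show ?case
  proof (cases "R i")
    case True
    have "digit_index (f i) + 1 \<le> radix" using Suc.prems True digit_index_less[of "f i"] by (auto simp: valid_def Suc_le_eq)
    then have "(digit_index (f i) + 1) * radix ^ row_count i \<le> radix * radix ^ row_count i" by (rule mult_le_mono1)
    then show ?thesis using Suc True by (simp add: row_count_Suc)
  qed (use Suc in \<open>simp add: row_count_Suc\<close>)
qed

lemma digit_index_first: "digit_index (first n X) = 0"
  unfolding digit_index_def using first_least[of _ n X] by auto

text \<open>Counting, restricted to the rows below \<open>i\<close>: with a carry these rows held
  the largest number and now hold 0, without one the number has grown by one. Hence repeated steps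
  from rank 0 meet every rank in turn.\<close>

lemma odo_rank:
  assumes "\<exists>q<n. X q" "valid f"
  shows "i \<le> n \<Longrightarrow> (case odo i f of (g, c) \<Rightarrow>
    if c then rank i g = 0 \<and> rank i f + 1 = radix ^ row_count i else rank i g = rank i f + 1)"
proof (induction i)
  case 0
  show ?case by (simp add: row_count_def)
next
  case (Suc i)
  obtain g c where g: "odo i f = (g, c)" by (cases "odo i f") auto
  have gi: "g i = f i" using odo_frame[of i i f] g by simp
  have rkg: "rank i (g(i := y)) = rank i g" for y by (rule rank_cong) simp
  show ?case
  proof (cases "c \<and> R i")
    case False
    then show ?thesis using Suc g gi by (auto simp: row_count_Suc split: if_splits)
  next
    case True
    define q where "q = first n (\<lambda>q. X q \<and> g i < q)"
    have IH: "rank i g = 0" "rank i f + 1 = radix ^ row_count i" using Suc g True by auto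
    have fi: "f i < n" "X (f i)" using assms(2) Suc.prems True by (auto simp: valid_def)
    show ?thesis
    proof (cases "q = n")
      case T: True
      \<comment> \<open>No admissible digit exceeds \<open>f i\<close>, so its value is
        \<open>radix - 1\<close>.\<close>
      have "X y \<Longrightarrow> y < n \<Longrightarrow> y \<le> f i" for y
        using first_least[of y n "\<lambda>q. X q \<and> g i < q"] T gi unfolding q_def by (metis not_le)
      then have "{q. q < n \<and> X q} = insert (f i) {q. q < n \<and> X q \<and> q < f i}" using fi by force
      then have b: "radix = digit_index (f i) + 1" by (simp add: radix_def digit_index_def)
      have "rank (Suc i) f + 1 = radix ^ row_count i + digit_index (f i) * radix ^ row_count i" using IH True by simp
      also have "\<dots> = radix ^ row_count (Suc i)" using True b by (simp add: row_count_Suc)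
      finally show ?thesis using T True g IH rkg digit_index_first by (simp add: q_def[symmetric])
    next
      case F: False
      then have qn: "q < n" using first_le[of n "\<lambda>q. X q \<and> g i < q"] unfolding q_def by simp
      then have q: "X q" "f i < q" using first_holds[of n "\<lambda>q. X q \<and> g i < q"] gi unfolding q_def by auto
      have "y \<le> f i" if "X y" "y < q" for y
        using first_least[of y n "\<lambda>q. X q \<and> g i < q"] that gi unfolding q_def by (metis not_le)
      then have "{y. y < n \<and> X y \<and> y < q} = insert (f i) {y. y < n \<and> X y \<and> y < f i}" using fi q qn by force
      then have "digit_index q = digit_index (f i) + 1" by (simp add: digit_index_def)
      then have "rank (Suc i) (g(i := q)) = rank (Suc i) f + 1" using True rkg IH by simp
      then show ?thesis using F True g by (simp add: q_def[symmetric])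
    qed
  qed
qed

text \<open>Uniqueness of positional notation: division by the weight of the top row isolates its
  digit. Only the rows in \<open>R\<close> are determined.\<close>

lemma rank_inj:
  assumes "valid f" "valid g" "i \<le> n" "rank i f = rank i g" "a < i" "R a"
  shows "f a = g a"
  using assms(3-6)
proof (induction i)
  case (Suc i)
  show ?case
  proof (cases "R i")
    case True
    define B where "B = radix ^ row_count i"
    have l: "rank i f < B" "rank i g < B" using rank_less assms(1,2) Suc.prems(1) unfolding B_def by auto
    have e: "rank i f + digit_index (f i) * B = rank i g + digit_index (g i) * B" using Suc.prems(2) True by (simp add: B_def)
    then have "(rank i f + digit_index (f i) * B) div B = (rank i g + digit_index (g i) * B) div B" by simp
    then have ii: "digit_index (f i) = digit_index (g i)" using l by simp
    then have "rank i f = rank i g" using e by simp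
    then have "f a = g a" if "a < i" using Suc.IH Suc.prems that by simp
    moreover have "f i = g i"
    proof (rule ccontr)
      assume ne: "f i \<noteq> g i"
      have v: "f i < n" "X (f i)" "g i < n" "X (g i)" using assms(1,2) Suc.prems(1) True by (auto simp: valid_def)
      have lt: "digit_index x < digit_index y" if "x < y" "x < n" "X x" for x y
        unfolding digit_index_def by (rule psubset_card_mono) (use that in auto)
      show False using ne lt[of "f i" "g i"] lt[of "g i" "f i"] v ii by (metis linorder_neqE_nat less_irrefl)
    qed
    ultimately show ?thesis using Suc.prems(3) by (auto simp: less_Suc_eq)
  next
    case False
    then show ?thesis using Suc by (auto simp: less_Suc_eq)
  qed
qed simp

text \<open>A nonzero digit in row \<open>a\<close> makes the rank at least the weight of that row.
  Read backwards, a small rank confines the nonzero digits to low rows, which later bounds the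
  number of reversed arcs.\<close>

lemma rank_ge: "a < i \<Longrightarrow> R a \<Longrightarrow> digit_index (f a) * radix ^ row_count a \<le> rank i f"
proof (induction i)
  case (Suc i)
  then show ?case by (cases "a = i") auto
qed simp

lemma rank_zero_above: "j \<le> i \<Longrightarrow> (\<And>a. j \<le> a \<Longrightarrow> a < i \<Longrightarrow> digit_index (f a) = 0) \<Longrightarrow> rank i f = rank j f"
  by (induction i rule: dec_induct) auto

end

section \<open>Searching a feedback arc set\<close>

context
  fixes n :: nat and D :: "nat \<Rightarrow> nat \<Rightarrow> bool"
begin

text \<open>\<open>tx\<close>, \<open>ty\<close>, \<open>tz\<close> form the lexicographically first
  cyclic triangle; \<open>tx T = n\<close> is the sign that there is none.\<close>

definition tx :: "(nat \<Rightarrow> nat \<Rightarrow> bool) \<Rightarrow> nat" where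
  "tx T = first n (\<lambda>x. \<exists>y<n. \<exists>z<n. cyc T x y z)"

definition ty :: "(nat \<Rightarrow> nat \<Rightarrow> bool) \<Rightarrow> nat" where
  "ty T = first n (\<lambda>y. \<exists>z<n. cyc T (tx T) y z)"

definition tz :: "(nat \<Rightarrow> nat \<Rightarrow> bool) \<Rightarrow> nat" where
  "tz T = first n (\<lambda>z. cyc T (tx T) (ty T) z)"

text \<open>Without a triangle the digit is ignored, so surplus digits do no harm and all strings
  can have the full length \<open>n\<close>. Digit 0 is idle in any case.\<close>

definition fas1 :: "nat \<Rightarrow> (nat \<Rightarrow> nat \<Rightarrow> bool) \<times> nat set \<Rightarrow> (nat \<Rightarrow> nat \<Rightarrow> bool) \<times> nat set" where
  "fas1 d TA = (case TA of (T, A) \<Rightarrow>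
     if tx T = n then (T, A)
     else if d = 1 then (flip T (tx T) (ty T), insert (tx T) (insert (ty T) A))
     else if d = 2 then (flip T (ty T) (tz T), insert (ty T) (insert (tz T) A))
     else if d = 3 then (flip T (tz T) (tx T), insert (tz T) (insert (tx T) A))
     else (T, A))"

primrec fasrun :: "(nat \<Rightarrow> nat) \<Rightarrow> nat \<Rightarrow> (nat \<Rightarrow> nat \<Rightarrow> bool) \<times> nat set" where
  "fasrun f 0 = (D, {})"
| "fasrun f (Suc i) = fas1 (f i) (fasrun f i)"

lemma tri_found:
  assumes "tx T \<noteq> n"
  shows "tx T < n \<and> ty T < n \<and> tz T < n \<and> cyc T (tx T) (ty T) (tz T)"
proof -
  have x: "tx T < n" using assms first_le unfolding tx_def by (metis le_neq_implies_less)
  then have ex: "\<exists>y<n. \<exists>z<n. cyc T (tx T) y z" unfolding tx_def by (rule first_holds)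
  then have y: "ty T < n" unfolding ty_def by (simp add: first_less_iff)
  then have ez: "\<exists>z<n. cyc T (tx T) (ty T) z" unfolding ty_def by (rule first_holds)
  then have z: "tz T < n" unfolding tz_def by (simp add: first_less_iff)
  then have "cyc T (tx T) (ty T) (tz T)" unfolding tz_def by (rule first_holds)
  with x y z show ?thesis by blast
qed

lemma tri_none: "tournament n T \<Longrightarrow> tx T = n \<Longrightarrow> \<not> cyc T x y z"
proof
  assume T: "tournament n T" and e: "tx T = n" and c: "cyc T x y z"
  then have "x < n" "y < n" "z < n" using tournament_less[OF T] by (auto simp: cyc_def)
  then have "\<exists>x<n. \<exists>y<n. \<exists>z<n. cyc T x y z" using c by blast
  then have "tx T < n" unfolding tx_def first_less_iff by blast
  then show False using e by simp
qed

text \<open>A reversal adds at most two players to \<open>A\<close>. Counting nonzero digits instead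
  of positions keeps this bound small although \<open>n\<close> digits are read.\<close>

lemma fasrun_inv:
  assumes T: "tournament n D"
  shows "case fasrun f i of (T, A) \<Rightarrow> tournament n T \<and> A \<subseteq> {..<n} \<and>
    (\<forall>u w. u \<notin> A \<or> w \<notin> A \<longrightarrow> T u w = D u w) \<and> card A \<le> 2 * card {a. a < i \<and> f a \<noteq> 0}"
proof (induction i)
  case 0
  show ?case using T by simp
next
  case (Suc i)
  obtain T A where TA: "fasrun f i = (T, A)" by (cases "fasrun f i") auto
  with Suc have IH: "tournament n T" "A \<subseteq> {..<n}" "\<And>u w. u \<notin> A \<or> w \<notin> A \<Longrightarrow> T u w = D u w"
    "card A \<le> 2 * card {a. a < i \<and> f a \<noteq> 0}" by auto
  have sub: "{a. a < i \<and> f a \<noteq> 0} \<subseteq> {a. a < Suc i \<and> f a \<noteq> 0}" by auto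
  have mono: "card {a. a < i \<and> f a \<noteq> 0} \<le> card {a. a < Suc i \<and> f a \<noteq> 0}" by (rule card_mono[OF _ sub]) simp
  have suc: "card {a. a < Suc i \<and> f a \<noteq> 0} = card {a. a < i \<and> f a \<noteq> 0} + 1" if "f i \<noteq> 0"
  proof -
    have "{a. a < Suc i \<and> f a \<noteq> 0} = insert i {a. a < i \<and> f a \<noteq> 0}" using that by (auto simp: less_Suc_eq)
    then show ?thesis by simp
  qed
  have step: "case (flip T x y, insert x (insert y A)) of (T, A) \<Rightarrow> tournament n T \<and> A \<subseteq> {..<n} \<and>
    (\<forall>u w. u \<notin> A \<or> w \<notin> A \<longrightarrow> T u w = D u w) \<and> card A \<le> 2 * card {a. a < Suc i \<and> f a \<noteq> 0}"
    if xy: "x < n" "y < n" "T x y" "f i \<noteq> 0" for x y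
  proof -
    have "tournament n (flip T x y)" using tournament_flip[OF IH(1) xy(3)] .
    moreover have "flip T x y u w = D u w" if "u \<notin> insert x (insert y A) \<or> w \<notin> insert x (insert y A)" for u w
    proof -
      have "\<not> (u = x \<and> w = y)" "\<not> (u = y \<and> w = x)" "T u w = D u w" using that IH(3) by blast+
      then show ?thesis unfolding flip_def by argo
    qed
    moreover have "card (insert x (insert y A)) \<le> card A + 2"
      using finite_subset[OF IH(2) finite_lessThan] by (simp add: card_insert_if)
    then have "card (insert x (insert y A)) \<le> 2 * card {a. a < Suc i \<and> f a \<noteq> 0}"
      unfolding suc[OF xy(4)] using IH(4) by simp
    moreover have "insert x (insert y A) \<subseteq> {..<n}" using IH(2) xy by simp
    ultimately show ?thesis by blast
  qed
  show ?case
  proof (cases "tx T = n \<or> f i \<notin> {1, 2, 3}")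
    case True
    then have "fasrun f (Suc i) = (T, A)" using TA by (auto simp: fas1_def)
    then show ?thesis using IH mono by auto
  next
    case False
    then have t: "tx T < n" "ty T < n" "tz T < n" "T (tx T) (ty T)" "T (ty T) (tz T)" "T (tz T) (tx T)"
      using tri_found[of T] by (auto simp: cyc_def)
    show ?thesis using False step[OF t(1,2,4)] step[OF t(2,3,5)] step[OF t(3,1,6)] TA
      by (auto simp: fas1_def)
  qed
qed

lemma fasrun_cong: "(\<And>a. a < i \<Longrightarrow> f a = g a) \<Longrightarrow> fasrun f i = fasrun g i"
  by (induction i) auto

text \<open>The order \<open>r\<close> guides the choice: each digit picks an arc of the triangle
  that is a back arc of \<open>r\<close>, so every digit used lowers the number of back arcs by
  one.\<close>

lemma fas_digits:
  assumes T: "tournament n D" and inj: "inj_on r {..<n}"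
  shows "\<exists>f. (\<forall>a. f a \<le> 3) \<and> (\<forall>a\<ge>j. f a = 0) \<and>
    (tx (fst (fasrun f j)) = n \<or> card (back_arcs r (fst (fasrun f j))) + j \<le> card (back_arcs r D))"
proof (induction j)
  case 0
  show ?case by (rule exI[of _ "\<lambda>_. 0"]) simp
next
  case (Suc j)
  then obtain f where f: "\<forall>a. f a \<le> 3" "\<forall>a\<ge>j. f a = 0"
    "tx (fst (fasrun f j)) = n \<or> card (back_arcs r (fst (fasrun f j))) + j \<le> card (back_arcs r D)" by blast
  obtain T A where TA: "fasrun f j = (T, A)" by (cases "fasrun f j") auto
  have T': "tournament n T" using fasrun_inv[OF T, where f = f and i = j] TA by simp
  show ?case
  proof (cases "tx T = n")
    case True
    then show ?thesis using f TA by (intro exI[of _ f]) (auto simp: fas1_def)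
  next
    case False
    then have t: "cyc T (tx T) (ty T) (tz T)" using tri_found by blast
    from cyc_back_arc[OF T' inj t] obtain d x y where d: "d \<in> {1, 2, 3}" "T x y" "r y < r x" "fst (fas1 d (T, A)) = flip T x y"
    proof (elim disjE)
      assume "r (ty T) < r (tx T)"
      then show thesis using that[of 1 "tx T" "ty T"] t False by (auto simp: fas1_def cyc_def)
    next
      assume "r (tz T) < r (ty T)"
      then show thesis using that[of 2 "ty T" "tz T"] t False by (auto simp: fas1_def cyc_def)
    next
      assume "r (tx T) < r (tz T)"
      then show thesis using that[of 3 "tz T" "tx T"] t False by (auto simp: fas1_def cyc_def)
    qed
    define g where "g = f(j := d)"
    have "fasrun g j = (T, A)" using fasrun_cong[of j g f] TA by (auto simp: g_def)
    then have "fst (fasrun g (Suc j)) = flip T x y" using d(4) by (simp add: g_def)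
    moreover have "Suc (card (back_arcs r (flip T x y))) = card (back_arcs r T)" by (rule card_back_arcs_flip[OF T' d(2,3)])
    moreover have "card (back_arcs r T) + j \<le> card (back_arcs r D)" using f(3) TA False by simp
    moreover have "(\<forall>a. g a \<le> 3) \<and> (\<forall>a\<ge>Suc j. g a = 0)" using f d(1) by (auto simp: g_def)
    ultimately show ?thesis by (intro exI[of _ g]) auto
  qed
qed

text \<open>When all back arcs are used up, no triangle can remain. The digits from position
  \<open>b\<close> on are 0, where \<open>b\<close> is the number of back arcs, so the rank of this
  string is below \<open>4 ^ b\<close>.\<close>

lemma fas_exists:
  assumes T: "tournament n D" and inj: "inj_on r {..<n}" and b: "card (back_arcs r D) \<le> n"
  shows "\<exists>f. (\<forall>a. f a \<le> 3) \<and> (\<forall>a\<ge>card (back_arcs r D). f a = 0) \<and> tx (fst (fasrun f n)) = n"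
proof -
  let ?b = "card (back_arcs r D)"
  obtain f where f: "\<forall>a. f a \<le> 3" "\<forall>a\<ge>?b. f a = 0"
    "tx (fst (fasrun f ?b)) = n \<or> card (back_arcs r (fst (fasrun f ?b))) + ?b \<le> ?b"
    using fas_digits[OF T inj, of ?b] by blast
  obtain TT A where TA: "fasrun f ?b = (TT, A)" by (cases "fasrun f ?b") auto
  have T': "tournament n TT" using fasrun_inv[OF T, where f = f and i = ?b] TA by simp
  have "tx TT = n"
  proof (rule ccontr)
    assume ne: "tx TT \<noteq> n"
    then have "card (back_arcs r TT) = 0" using f(3) TA by simp
    moreover have "finite (back_arcs r TT)" by (rule finite_subset[OF _ finite_arcs[OF T']]) (auto simp: back_arcs_def arcs_def)
    ultimately have "back_arcs r TT = {}" by simp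
    then show False using cyc_back_arc[OF T' inj] tri_found[OF ne] unfolding back_arcs_def cyc_def by blast
  qed
  have "fasrun f (?b + d) = (TT, A)" for d
    by (induction d) (use TA \<open>tx TT = n\<close> in \<open>auto simp: fas1_def\<close>)
  then have "fasrun f n = (TT, A)" using b by (metis le_add_diff_inverse)
  then show ?thesis using f \<open>tx TT = n\<close> by (intro exI[of _ f]) auto
qed

end

section \<open>The program\<close>

text \<open>
  Counters: 0 \<open>n\<close>; 4 \<open>v\<close>; 5 stage or digit position; 6, 7, 8 vertices of a triangle; 9 affected player;
  10 parent; 11 child; 12 to 15 the digits 0 to 3.
  Arrays: 0 \<open>D\<close>; 3 loop exit; 4 the tournament with reversed arcs; 5 affected players; 6, 7, 8 digit string
  of the branching, its digits and its positions; 9 carry; 11 guessed stages; 12 guessed parents;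
  13 stages; 14 players entered so far; 15 players still without a child in the current stage;
  16 no failure so far; 17 accepted. Single bits are stored at index \<open>n\<close>, and a binary relation
  stores the pair \<open>(i, j)\<close> at index \<open>i * n + j\<close>.
\<close>
definition rel :: "nat \<Rightarrow> store \<Rightarrow> nat \<Rightarrow> nat \<Rightarrow> bool" where
  "rel a s = (\<lambda>i j. i < cnt s 0 \<and> j < cnt s 0 \<and> arr s a (i * cnt s 0 + j))"

definition elems :: "nat \<Rightarrow> store \<Rightarrow> nat set" where
  "elems a s = {i. i < cnt s 0 \<and> arr s a i}"

lemma rel_frame: "cnt s' 0 = cnt s 0 \<Longrightarrow> arr s' a = arr s a \<Longrightarrow> rel a s' = rel a s"
  and elems_frame: "cnt s' 0 = cnt s 0 \<Longrightarrow> arr s' a = arr s a \<Longrightarrow> elems a s' = elems a s"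
  by (simp_all add: rel_def elems_def)

lemma rel_setc [simp]: "x \<noteq> 0 \<Longrightarrow> rel a (setc x i s) = rel a s"
  and elems_setc [simp]: "x \<noteq> 0 \<Longrightarrow> elems a (setc x i s) = elems a s"
  and rel_seta_other [simp]: "a \<noteq> b \<Longrightarrow> rel a (seta b k c s) = rel a s"
  and elems_seta_other [simp]: "a \<noteq> b \<Longrightarrow> elems a (seta b k c s) = elems a s"
  by (simp_all add: rel_def elems_def)

lemma index_eq_iff: "(j::nat) < n \<Longrightarrow> j' < n \<Longrightarrow> i * n + j = i' * n + j' \<longleftrightarrow> i = i' \<and> j = j'"
  by (metis add_diff_cancel_right' div_mult_self3 div_less add.commute add_0 mod_less mod_mult_self3 less_nat_zero_code)

lemma rel_put:
  assumes "cnt s 0 = n" "x < n" "y < n"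
  shows "rel a (seta a (x * n + y) b s) = (\<lambda>i j. if i = x \<and> j = y then b else rel a s i j)"
  using assms index_eq_iff[of _ n y] by (auto simp: rel_def fun_eq_iff)

lemma elems_put:
  assumes "x < cnt s 0"
  shows "elems a (seta a x b s) = (if b then insert x (elems a s) else elems a s - {x})"
  using assms by (auto simp: elems_def)

lemma arr_rel: "i < cnt s 0 \<Longrightarrow> j < cnt s 0 \<Longrightarrow> arr s a (i * cnt s 0 + j) = rel a s i j"
  by (simp add: rel_def)

lemma arr_elems: "i < cnt s 0 \<Longrightarrow> arr s a i \<longleftrightarrow> i \<in> elems a s"
  by (simp add: elems_def)

lemma first_cong: "(\<And>i. i < n \<Longrightarrow> P i = Q i) \<Longrightarrow> first n P = first n Q"
  unfolding first_def by (rule arg_cong[of _ _ Least]) auto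

lemma loop_rule:
  assumes "I 0 (setc x 0 s)"
    and "\<And>i u. i < n \<Longrightarrow> I i u \<Longrightarrow> cnt u x = i \<Longrightarrow> I (Suc i) (setc x (Suc i) (f u))"
  shows "I n (loop f x n s)"
proof -
  have "i \<le> n \<Longrightarrow> I i (loop f x i s)" for i
    by (induction i) (use assms cnt_loop_var[of f x _ s] in auto)
  then show ?thesis by simp
qed

section \<open>Filling, copying and counting as commands\<close>

definition fill :: "nat \<Rightarrow> bool \<Rightarrow> cmd" where "fill a b = For 6 (Put a 6 b)"

lemma den_fill: "elems a (den (fill a b) s) = (if b then {..<cnt s 0} else {})"
proof -
  define n where "n = cnt s 0"
  define I where "I = (\<lambda>i (u::store). cnt u 0 = n \<and> (\<forall>k<i. arr u a k = b))"
  have "I n (loop (den (Put a 6 b)) 6 n s)"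
    by (rule loop_rule) (auto simp: I_def n_def less_Suc_eq)
  then show ?thesis by (auto simp: fill_def elems_def I_def n_def)
qed

definition copy1 :: "nat \<Rightarrow> nat \<Rightarrow> cmd" where
  "copy1 a b = For 6 (If (B1 a 6) (Put b 6 True) (Put b 6 False))"

lemma den_copy1: "a \<noteq> b \<Longrightarrow> elems b (den (copy1 a b) s) = elems a s"
proof -
  assume ab: "a \<noteq> b"
  define n where "n = cnt s 0"
  define I where "I = (\<lambda>i (u::store). cnt u 0 = n \<and> arr u a = arr s a \<and> (\<forall>k<i. arr u b k = arr s a k))"
  have "I n (loop (den (If (B1 a 6) (Put b 6 True) (Put b 6 False))) 6 n s)"
    by (rule loop_rule) (use ab in \<open>auto simp: I_def n_def less_Suc_eq\<close>)
  then show ?thesis by (auto simp: copy1_def elems_def I_def n_def)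
qed

definition copy2 :: "nat \<Rightarrow> nat \<Rightarrow> cmd" where
  "copy2 a b = For 6 (For 7 (If (B2 a 6 7) (Put2 b 6 7 True) (Put2 b 6 7 False)))"

lemma den_copy2: "a \<noteq> b \<Longrightarrow> rel b (den (copy2 a b) s) = rel a s"
proof -
  assume ab: "a \<noteq> b"
  define n where "n = cnt s 0"
  let ?c = "If (B2 a 6 7) (Put2 b 6 7 True) (Put2 b 6 7 False)"
  define J where "J = (\<lambda>i j (u::store). cnt u 0 = n \<and> cnt u 6 = i \<and> rel a u = rel a s \<and>
    (\<forall>k<n. \<forall>l<n. k < i \<or> k = i \<and> l < j \<longrightarrow> rel b u k l = rel a s k l))"
  have inner: "J i n (loop (den ?c) 7 n u)" if "i < n" "J i 0 u" for i u
  proof (rule loop_rule)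
    show "J i 0 (setc 7 0 u)" using that by (simp add: J_def)
  next
    fix j w assume j: "j < n" and w: "J i j w" "cnt w 7 = j"
    have "sem (B2 a 6 7) w = rel a s i j" using w j that(1) arr_rel[of i w j a] by (simp add: J_def)
    then have "den ?c w = seta b (i * n + j) (rel a s i j) w" using w by (simp add: J_def)
    moreover have "rel b (seta b (i * n + j) (rel a s i j) w) =
        (\<lambda>k l. if k = i \<and> l = j then rel a s i j else rel b w k l)"
      by (rule rel_put) (use w j that(1) in \<open>auto simp: J_def\<close>)
    ultimately show "J i (Suc j) (setc 7 (Suc j) (den ?c w))" using w ab by (auto simp: J_def less_Suc_eq)
  qed
  define I where "I = (\<lambda>i (u::store). cnt u 0 = n \<and> rel a u = rel a s \<and>
    (\<forall>k<n. \<forall>l<n. k < i \<longrightarrow> rel b u k l = rel a s k l))"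
  have "I n (loop (den (For 7 ?c)) 6 n s)"
  proof (rule loop_rule)
    fix i u assume i: "i < n" "I i u" "cnt u 6 = i"
    then have "J i n (loop (den ?c) 7 n u)" by (intro inner) (auto simp: I_def J_def)
    moreover have "cnt u 0 = n" using i by (simp add: I_def)
    ultimately show "I (Suc i) (setc 6 (Suc i) (den (For 7 ?c) u))"
      by (auto simp: I_def J_def less_Suc_eq)
  qed (simp add: I_def n_def)
  then have "\<forall>k<n. \<forall>l<n. rel b (den (copy2 a b) s) k l = rel a s k l" "cnt (den (copy2 a b) s) 0 = n"
    by (simp_all add: I_def copy2_def n_def)
  then show ?thesis by (auto simp: fun_eq_iff rel_def n_def)
qed

definition odo_cmd :: "nat \<Rightarrow> nat \<Rightarrow> nat \<Rightarrow> cmd" where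
  "odo_cmd R rows X = Seq (Put 9 0 True) (For 9 (If (Con (B1 9 0) (B1 rows 9))
     (Seq (Find 10 (B2 R 9 10))
     (Seq (Find 11 (Con (B1 X 11) (LtF 10 11)))
     (Seq (Put2 R 9 10 False)
     (If (EqF 11 0)
       (Seq (Find 11 (B1 X 11)) (Put2 R 9 11 True))
       (Seq (Put2 R 9 11 True) (Put 9 0 False)))))) Skip))"

text \<open>Digits are stored one-hot: row \<open>a\<close> of the array has its single bit in
  column \<open>f a\<close>. Thus reading a digit is a bit test and comparing digits needs no
  arithmetic.\<close>

definition reps :: "store \<Rightarrow> nat \<Rightarrow> nat \<Rightarrow> (nat \<Rightarrow> nat) \<Rightarrow> bool" where
  "reps s R rows f \<longleftrightarrow> (\<forall>a\<in>elems rows s. f a < cnt s 0 \<and> (\<forall>q<cnt s 0. rel R s a q \<longleftrightarrow> q = f a))"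

lemma reps_upd:
  assumes "reps s R rows f" "i < cnt s 0" "y < cnt s 0" "i \<in> elems rows s"
    "cnt s' 0 = cnt s 0" "elems rows s' = elems rows s"
    "rel R s' = (\<lambda>a q. if a = i \<and> q = y then True else if a = i \<and> q = f i then False else rel R s a q)"
  shows "reps s' R rows (f(i := y))"
  using assms unfolding reps_def by auto

lemma den_odo:
  fixes s :: store
  defines "n \<equiv> cnt s 0"
  assumes R: "R \<noteq> rows" "R \<noteq> X" "R \<noteq> 9" "rows \<noteq> 9" "X \<noteq> 9" and ex: "\<exists>q<n. arr s X q"
    and rp: "reps s R rows f"
  shows "reps (den (odo_cmd R rows X) s) R rows (fst (odo n (arr s rows) (arr s X) n f))"
    and "arr (den (odo_cmd R rows X) s) 9 n = snd (odo n (arr s rows) (arr s X) n f)"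
proof -
  let ?odo = "odo n (arr s rows) (arr s X)"
  let ?body = "If (Con (B1 9 0) (B1 rows 9))
     (Seq (Find 10 (B2 R 9 10))
     (Seq (Find 11 (Con (B1 X 11) (LtF 10 11)))
     (Seq (Put2 R 9 10 False)
     (If (EqF 11 0)
       (Seq (Find 11 (B1 X 11)) (Put2 R 9 11 True))
       (Seq (Put2 R 9 11 True) (Put 9 0 False)))))) Skip"
  define I where "I = (\<lambda>i (u::store). cnt u 0 = n \<and> arr u rows = arr s rows \<and> arr u X = arr s X \<and>
    reps u R rows (fst (?odo i f)) \<and> arr u 9 n = snd (?odo i f))"
  have "I n (loop (den ?body) 9 n (seta 9 n True s))"
  proof (rule loop_rule)
    show "I 0 (setc 9 0 (seta 9 n True s))" using R rp by (simp add: I_def n_def reps_def)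
  next
    fix i u assume i: "i < n" and I: "I i u" and ci: "cnt u 9 = i"
    obtain g c where g: "?odo i f = (g, c)" by (cases "?odo i f") auto
    have un: "cnt u 0 = n" and rows: "arr u rows = arr s rows" and X: "arr u X = arr s X"
      and rg: "reps u R rows g" and c: "arr u 9 n = c" using I g by (auto simp: I_def)
    show "I (Suc i) (setc 9 (Suc i) (den ?body u))"
    proof (cases "c \<and> arr s rows i")
      case False
      then have "\<not> sem (Con (B1 9 0) (B1 rows 9)) u" using un c ci rows by simp
      then have "den ?body u = u" by (simp only: den.simps if_False)
      then show ?thesis using I g False by (auto simp: I_def reps_def)
    next
      case True
      have iS: "i \<in> elems rows u" using True i un rows by (simp add: elems_def)
      have gi: "g i < n" and gq: "\<And>q. q < n \<Longrightarrow> rel R u i q \<longleftrightarrow> q = g i" using rg iS un by (auto simp: reps_def)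
      define q where "q = first n (\<lambda>q. arr s X q \<and> g i < q)"
      have "first n (\<lambda>k. arr u R (i * n + k)) = g i"
        by (rule first_eqI) (use gi gq un i arr_rel[of i u] in auto)
      then have f1: "den (Find 10 (B2 R 9 10)) u = setc 10 (g i) u" using un ci by simp
      have f2: "den (Find 11 (Con (B1 X 11) (LtF 10 11))) (setc 10 (g i) u) = setc 11 q (setc 10 (g i) u)"
        using un X by (simp add: q_def)
      define u1 where "u1 = seta R (i * n + g i) False (setc 11 q (setc 10 (g i) u))"
      have r1: "rel R u1 = (\<lambda>a l. if a = i \<and> l = g i then False else rel R u a l)"
        unfolding u1_def using rel_put[of "setc 11 q (setc 10 (g i) u)" n i "g i" R False] un i gi by simp
      have d1: "den ?body u = den (If (EqF 11 0)
         (Seq (Find 11 (B1 X 11)) (Put2 R 9 11 True))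
         (Seq (Put2 R 9 11 True) (Put 9 0 False))) u1"
        using True c un ci rows f1 f2 unfolding u1_def by simp
      have u1c: "cnt u1 0 = n" "cnt u1 9 = i" "cnt u1 11 = q" "arr u1 X = arr s X" "arr u1 rows = arr s rows" "arr u1 9 = arr u 9"
        using un ci rows X R by (auto simp: u1_def)
      show ?thesis
      proof (cases "q = n")
        case T: True
        define q' where "q' = first n (arr s X)"
        have q': "q' < n" using ex unfolding q'_def by (simp add: first_less_iff)
        define u2 where "u2 = seta R (i * n + q') True (setc 11 q' u1)"
        have d2: "den ?body u = u2" unfolding d1 u2_def using u1c T by (simp add: q'_def)
        have r2: "rel R u2 = (\<lambda>a l. if a = i \<and> l = q' then True else rel R u1 a l)"
          unfolding u2_def using rel_put[of "setc 11 q' u1" n i q' R True] u1c i q' by simp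
        have "?odo (Suc i) f = (g(i := q'), True)" using g True T by (simp add: q_def[symmetric] q'_def)
        moreover have "reps u2 R rows (g(i := q'))"
          by (rule reps_upd[OF rg]) (use i q' un u1c iS r1 r2 R rows in \<open>auto simp: u2_def elems_def\<close>)
        moreover have "cnt u2 0 = n" "arr u2 rows = arr s rows" "arr u2 X = arr s X" "arr u2 9 n"
          using u1c R c True by (auto simp: u2_def)
        ultimately show ?thesis unfolding d2 I_def by (simp add: reps_def)
      next
        case F: False
        then have qn: "q < n" using first_le[of n "\<lambda>q. arr s X q \<and> g i < q"] unfolding q_def by simp
        define u2 where "u2 = seta 9 n False (seta R (i * n + q) True u1)"
        have d2: "den ?body u = u2" unfolding d1 u2_def using u1c F by simp
        have r2: "rel R u2 = (\<lambda>a l. if a = i \<and> l = q then True else rel R u1 a l)"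
          unfolding u2_def using rel_put[of u1 n i q R True] u1c i qn R by simp
        have "?odo (Suc i) f = (g(i := q), False)" using g True F by (simp add: q_def[symmetric])
        moreover have "reps u2 R rows (g(i := q))"
          by (rule reps_upd[OF rg]) (use i qn un u1c iS r1 r2 R rows in \<open>auto simp: u2_def elems_def\<close>)
        moreover have "cnt u2 0 = n" "arr u2 rows = arr s rows" "arr u2 X = arr s X" "\<not> arr u2 9 n"
          using u1c R by (auto simp: u2_def)
        ultimately show ?thesis unfolding d2 I_def by (simp add: reps_def)
      qed
    qed
  qed
  moreover have "den (odo_cmd R rows X) s = loop (den ?body) 9 n (seta 9 n True s)"
    by (simp add: odo_cmd_def n_def)
  ultimately have "I n (den (odo_cmd R rows X) s)" by metis
  then show "reps (den (odo_cmd R rows X) s) R rows (fst (?odo n f))"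
    "arr (den (odo_cmd R rows X) s) 9 n = snd (?odo n f)" by (auto simp: I_def)
qed

section \<open>Replaying one branch of the search for an order\<close>

definition cycf :: "nat \<Rightarrow> nat \<Rightarrow> nat \<Rightarrow> fm" where
  "cycf x y z = Con (B2 4 x y) (Con (B2 4 y z) (B2 4 z x))"

lemma sem_cycf:
  "cnt s x < cnt s 0 \<Longrightarrow> cnt s y < cnt s 0 \<Longrightarrow> cnt s z < cnt s 0 \<Longrightarrow>
    sem (cycf x y z) s = cyc (rel 4 s) (cnt s x) (cnt s y) (cnt s z)"
  by (simp add: cycf_def cyc_def rel_def)

definition rev_cmd :: "nat \<Rightarrow> nat \<Rightarrow> cmd" where
  "rev_cmd x y = Seq (Put2 4 y x True) (Seq (Put2 4 x y False) (Seq (Put 5 y True) (Put 5 x True)))"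

lemma den_rev:
  assumes "cnt s x < cnt s 0" "cnt s y < cnt s 0"
  shows "rel 4 (den (rev_cmd x y) s) = flip (rel 4 s) (cnt s x) (cnt s y)"
    and "elems 5 (den (rev_cmd x y) s) = insert (cnt s x) (insert (cnt s y) (elems 5 s))"
  using assms rel_put[of "seta 4 (cnt s y * cnt s 0 + cnt s x) True s" "cnt s 0" "cnt s x" "cnt s y" 4 False]
    rel_put[of s "cnt s 0" "cnt s y" "cnt s x" 4 True]
  by (auto simp: rev_cmd_def elems_put flip_def fun_eq_iff)

definition fas_step :: cmd where
  "fas_step = Seq (Find 6 (Ex 30 (Ex 31 (cycf 6 30 31)))) (If (EqF 6 0) Skip
     (Seq (Find 7 (Ex 31 (cycf 6 7 31))) (Seq (Find 8 (cycf 6 7 8))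
       (If (B2 6 5 13) (rev_cmd 6 7) (If (B2 6 5 14) (rev_cmd 7 8) (If (B2 6 5 15) (rev_cmd 8 6) Skip))))))"

text \<open>Arrays are addressed through counters only, so the columns 1, 2, 3 are named by the
  counters 13, 14, 15, which hold these values. No bit there means digit 0.\<close>

definition digit :: "store \<Rightarrow> nat \<Rightarrow> nat" where
  "digit s i = (if arr s 6 (i * cnt s 0 + cnt s 13) then 1 else if arr s 6 (i * cnt s 0 + cnt s 14) then 2
     else if arr s 6 (i * cnt s 0 + cnt s 15) then 3 else 0)"

lemma den_fas_step:
  "(rel 4 (den fas_step s), elems 5 (den fas_step s)) =
     fas1 (cnt s 0) (digit s (cnt s 5)) (rel 4 s, elems 5 s)"
proof -
  define n where "n = cnt s 0"
  define T where "T = rel 4 s"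
  let ?x = "tx n T" let ?y = "ty n T" let ?z = "tz n T"
  have "first n (\<lambda>i. sem (Ex 30 (Ex 31 (cycf 6 30 31))) (setc 6 i s)) = ?x"
    unfolding tx_def by (rule first_cong) (simp add: sem_cycf n_def T_def cong: conj_cong)
  then have x: "den (Find 6 (Ex 30 (Ex 31 (cycf 6 30 31)))) s = setc 6 ?x s" by (simp add: n_def)
  show ?thesis
  proof (cases "?x = n")
    case True
    have "den fas_step s = setc 6 ?x s" unfolding fas_step_def using x True by (simp add: n_def)
    then show ?thesis using True by (simp add: fas1_def n_def T_def)
  next
    case False
    then have t: "?x < n" "?y < n" "?z < n" using tri_found by blast+
    have "first n (\<lambda>i. sem (Ex 31 (cycf 6 7 31)) (setc 7 i (setc 6 ?x s))) = ?y"
      unfolding ty_def by (rule first_cong) (use t in \<open>simp add: sem_cycf n_def T_def cong: conj_cong\<close>)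
    then have y: "den (Find 7 (Ex 31 (cycf 6 7 31))) (setc 6 ?x s) = setc 7 ?y (setc 6 ?x s)" by (simp add: n_def)
    have "first n (\<lambda>i. sem (cycf 6 7 8) (setc 8 i (setc 7 ?y (setc 6 ?x s)))) = ?z"
      unfolding tz_def by (rule first_cong) (use t in \<open>simp add: sem_cycf n_def T_def\<close>)
    then have z: "den (Find 8 (cycf 6 7 8)) (setc 7 ?y (setc 6 ?x s)) = setc 8 ?z (setc 7 ?y (setc 6 ?x s))" by (simp add: n_def)
    define s1 where "s1 = setc 8 ?z (setc 7 ?y (setc 6 ?x s))"
    have d: "den fas_step s = den (If (B2 6 5 13) (rev_cmd 6 7) (If (B2 6 5 14) (rev_cmd 7 8) (If (B2 6 5 15) (rev_cmd 8 6) Skip))) s1"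
      unfolding fas_step_def using x y z False by (simp add: n_def s1_def)
    have s1: "cnt s1 0 = n" "cnt s1 6 = ?x" "cnt s1 7 = ?y" "cnt s1 8 = ?z" "rel 4 s1 = T" "elems 5 s1 = elems 5 s"
      by (simp_all add: s1_def n_def T_def)
    have b: "sem (B2 6 5 13) s1 = arr s 6 (cnt s 5 * n + cnt s 13)" "sem (B2 6 5 14) s1 = arr s 6 (cnt s 5 * n + cnt s 14)"
      "sem (B2 6 5 15) s1 = arr s 6 (cnt s 5 * n + cnt s 15)" by (simp_all add: s1_def n_def)
    have r: "rel 4 (den (rev_cmd 6 7) s1) = flip T ?x ?y" "elems 5 (den (rev_cmd 6 7) s1) = insert ?x (insert ?y (elems 5 s))"
      "rel 4 (den (rev_cmd 7 8) s1) = flip T ?y ?z" "elems 5 (den (rev_cmd 7 8) s1) = insert ?y (insert ?z (elems 5 s))"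
      "rel 4 (den (rev_cmd 8 6) s1) = flip T ?z ?x" "elems 5 (den (rev_cmd 8 6) s1) = insert ?z (insert ?x (elems 5 s))"
      using den_rev[of s1 6 7] den_rev[of s1 7 8] den_rev[of s1 8 6] s1 t by simp_all
    show ?thesis unfolding d den.simps(6) b digit_def n_def[symmetric] T_def[symmetric]
      using r s1 False by (simp add: fas1_def)
  qed
qed

text \<open>Every round starts again from a fresh copy of \<open>D\<close> and replays its digit
  string. This replaces backtracking and its stack at the price of a polynomial factor.\<close>

definition fas_cmd :: cmd where
  "fas_cmd = Seq (copy2 0 4) (Seq (fill 5 False) (For 5 fas_step))"

lemma fas_step_frame:
  "z \<notin> {6, 7, 8} \<Longrightarrow> cnt (den fas_step s) z = cnt s z"
  "a \<notin> {4, 5} \<Longrightarrow> arr (den fas_step s) a = arr s a"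
  by (auto intro!: cnt_den arr_den simp: fas_step_def rev_cmd_def)

lemma den_fas_cmd:
  "(rel 4 (den fas_cmd s), elems 5 (den fas_cmd s)) = fasrun (cnt s 0) (rel 0 s) (digit s) (cnt s 0)"
proof -
  define n where "n = cnt s 0"
  define s1 where "s1 = den (fill 5 False) (den (copy2 0 4) s)"
  have c1: "cnt s1 z = cnt s z" if "z \<notin> {6, 7}" for z
    unfolding s1_def using that by (subst cnt_den; (subst cnt_den)?) (auto simp: fill_def copy2_def)
  have a1: "arr s1 a = arr s a" if "a \<notin> {4, 5}" for a
    unfolding s1_def using that by (subst arr_den; (subst arr_den)?) (auto simp: fill_def copy2_def)
  have "cnt (den (fill 5 False) t) 0 = cnt t 0" "arr (den (fill 5 False) t) 4 = arr t 4" for t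
    by (rule cnt_den arr_den, simp add: fill_def)+
  from rel_frame[OF this] have s1: "rel 4 s1 = rel 0 s" "elems 5 s1 = {}"
    unfolding s1_def using den_fill[of 5 False "den (copy2 0 4) s"] den_copy2[of 0 4 s] by simp_all
  define I where "I = (\<lambda>i (u::store). cnt u 0 = n \<and> (\<forall>z\<in>{13,14,15}. cnt u z = cnt s z) \<and> arr u 6 = arr s 6 \<and>
    (rel 4 u, elems 5 u) = fasrun n (rel 0 s) (digit s) i)"
  have "I n (loop (den fas_step) 5 n s1)"
  proof (rule loop_rule)
    show "I 0 (setc 5 0 s1)" using s1 c1 a1 by (simp add: I_def n_def)
  next
    fix i u assume i: "i < n" "I i u" "cnt u 5 = i"
    have "digit u i = digit s i" using i(2) by (simp add: digit_def I_def n_def)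
    then show "I (Suc i) (setc 5 (Suc i) (den fas_step u))"
      using i den_fas_step[of u] fas_step_frame[of _ u] by (simp add: I_def)
  qed
  moreover have "den fas_cmd s = loop (den fas_step) 5 n s1"
    using c1[of 0] by (simp add: fas_cmd_def s1_def n_def)
  ultimately show ?thesis by (simp add: I_def n_def)
qed

section \<open>The check of one guess as a command\<close>

abbreviation Or :: "fm \<Rightarrow> fm \<Rightarrow> fm" where "Or p q \<equiv> Neg (Con (Neg p) (Neg q))"

text \<open>The guess is stored one-hot, so the diagonal entry \<open>(a, a)\<close> of array 12
  says \<open>pr a = a\<close>, the case of an unaffected parent.\<close>

definition parent_fm :: fm where
  "parent_fm = Con (B1 15 10) (Con (B2 0 10 9) (Or
     (Con (B2 12 9 9) (Con (Neg (B1 5 10))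
        (Neg (Ex 30 (Con (B1 15 30) (Con (Neg (B1 5 30)) (Con (B2 0 30 9) (B2 0 10 30))))))))
     (Con (Neg (B2 12 9 9)) (B2 12 9 10))))"

definition child_fm :: fm where
  "child_fm = Con (Neg (B1 14 11)) (Con (Neg (B1 5 11)) (Con (B2 0 10 11)
     (Neg (Ex 30 (Con (Neg (B1 14 30)) (Con (Neg (B1 5 30)) (Con (B2 0 10 30) (B2 0 30 11))))))))"

definition aff_step :: cmd where
  "aff_step = If (Con (B1 5 9) (Con (B2 11 9 5) (Neg (EqF 9 4))))
     (Seq (Find 10 parent_fm) (If (Or (EqF 10 0) (B1 14 9)) (Put 16 0 False)
        (Seq (Put 15 10 False) (Put 14 9 True)))) Skip"

definition una_step :: cmd where
  "una_step = If (B1 15 10) (Seq (Find 11 child_fm) (If (EqF 11 0) (Put 16 0 False) (Put 14 11 True))) Skip"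

definition stage_cmd :: cmd where
  "stage_cmd = If (Ex 30 (Neg (B1 14 30))) (Seq (copy1 14 15) (Seq (For 9 aff_step) (For 10 una_step))) Skip"

definition check_cmd :: cmd where
  "check_cmd = Seq (fill 14 False) (Seq (Put 14 4 True) (Seq (Put 16 0 True) (For 5 stage_cmd)))"

text \<open>The data that a check reads without altering; the frame rules below carry it through all
  loops of the check.\<close>

definition Env :: "nat \<Rightarrow> (nat \<Rightarrow> nat \<Rightarrow> bool) \<Rightarrow> nat \<Rightarrow> nat set \<Rightarrow> (nat \<Rightarrow> nat) \<Rightarrow> (nat \<Rightarrow> nat) \<Rightarrow> store \<Rightarrow> bool" where
  "Env n D v A st pr u \<longleftrightarrow> cnt u 0 = n \<and> cnt u 4 = v \<and> v < n \<and> rel 0 u = D \<and> elems 5 u = A \<and>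
     reps u 11 5 st \<and> reps u 12 5 pr"

lemma Env_frame:
  assumes "Env n D v A st pr u" "cnt u' 0 = cnt u 0" "cnt u' 4 = cnt u 4" "\<And>a. a \<in> {0, 5, 11, 12} \<Longrightarrow> arr u' a = arr u a"
  shows "Env n D v A st pr u'"
proof -
  have "rel 0 u' = rel 0 u" "rel 11 u' = rel 11 u" "rel 12 u' = rel 12 u" "elems 5 u' = elems 5 u"
    using assms rel_frame[OF assms(2)] elems_frame[OF assms(2)] by auto
  then show ?thesis using assms(1-3) unfolding Env_def reps_def by metis
qed

lemma aff_step_frame:
  "z \<noteq> 10 \<Longrightarrow> cnt (den aff_step s) z = cnt s z" "a \<notin> {14, 15, 16} \<Longrightarrow> arr (den aff_step s) a = arr s a"
  by (rule cnt_den, simp add: aff_step_def) (rule arr_den, simp add: aff_step_def)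

lemma una_step_frame:
  "z \<noteq> 11 \<Longrightarrow> cnt (den una_step s) z = cnt s z" "a \<notin> {14, 16} \<Longrightarrow> arr (den una_step s) a = arr s a"
  by (rule cnt_den, simp add: una_step_def) (rule arr_den, simp add: una_step_def)

lemma den_aff_step:
  assumes E: "Env n D v A st pr u" and a: "cnt u 9 = a" "a < n" and j: "cnt u 5 = j" "j < n"
  shows "(elems 15 (den aff_step u), elems 14 (den aff_step u), arr (den aff_step u) 16 n) =
    (if a \<in> A \<and> st a = j \<and> a \<noteq> v then
       (let p = first n (aff_parent n D A pr (elems 15 u) a) in
        if p = n \<or> a \<in> elems 14 u then (elems 15 u, elems 14 u, False)
        else (elems 15 u - {p}, insert a (elems 14 u), arr u 16 n))
     else (elems 15 u, elems 14 u, arr u 16 n))"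
proof -
  have e: "cnt u 0 = n" "cnt u 4 = v" "v < n" "rel 0 u = D" "elems 5 u = A" "reps u 11 5 st" "reps u 12 5 pr"
    using E by (auto simp: Env_def)
  have c: "sem (Con (B1 5 9) (Con (B2 11 9 5) (Neg (EqF 9 4)))) u \<longleftrightarrow> a \<in> A \<and> st a = j \<and> a \<noteq> v"
  proof -
    have "sem (Con (B1 5 9) (Con (B2 11 9 5) (Neg (EqF 9 4)))) u \<longleftrightarrow> a \<in> A \<and> rel 11 u a j \<and> a \<noteq> v"
      using e(1,2,5) a j arr_elems[of a u 5] arr_rel[of a u j 11] by simp
    also have "\<dots> \<longleftrightarrow> a \<in> A \<and> st a = j \<and> a \<noteq> v" using e(1,5,6) j by (auto simp: reps_def)
    finally show ?thesis .
  qed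
  show ?thesis
  proof (cases "a \<in> A \<and> st a = j \<and> a \<noteq> v")
    case False
    then have "den aff_step u = u" using c unfolding aff_step_def by (simp only: den.simps if_False)
    then show ?thesis using False by argo
  next
    case True
    define p where "p = first n (aff_parent n D A pr (elems 15 u) a)"
    have pra: "rel 12 u a q \<longleftrightarrow> pr a = q" if "q < n" for q using e(1,5,7) True that by (auto simp: reps_def)
    have "sem parent_fm (setc 10 p u) = aff_parent n D A pr (elems 15 u) a p" if p: "p < n" for p
    proof -
      let ?w = "setc 10 p u"
      have "sem (Ex 30 (Con (B1 15 30) (Con (Neg (B1 5 30)) (Con (B2 0 30 9) (B2 0 10 30))))) ?w \<longleftrightarrow>
        (\<exists>q<n. q \<in> elems 15 u \<and> q \<notin> A \<and> D q a \<and> D p q)"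
        using e(1,4,5) a p arr_elems[of _ u] arr_rel[of _ u] by auto
      moreover have "arr u 15 p \<longleftrightarrow> p \<in> elems 15 u" "arr u 5 p \<longleftrightarrow> p \<in> A" "arr u 0 (p * n + a) \<longleftrightarrow> D p a"
        "arr u 12 (a * n + a) \<longleftrightarrow> pr a = a" "arr u 12 (a * n + p) \<longleftrightarrow> pr a = p"
        using e(1,4,5) a p arr_elems[of p u] arr_rel[of _ u] pra by auto
      ultimately show ?thesis using e(1) a(1) unfolding parent_fm_def aff_parent_def by auto
    qed
    then have "first n (\<lambda>i. sem parent_fm (setc 10 i u)) = p" unfolding p_def by (rule first_cong)
    then have d1: "den (Find 10 parent_fm) u = setc 10 p u" using e(1) by simp
    have d2: "den aff_step u = den (If (Or (EqF 10 0) (B1 14 9)) (Put 16 0 False)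
        (Seq (Put 15 10 False) (Put 14 9 True))) (setc 10 p u)"
    proof -
      have "sem (Con (B1 5 9) (Con (B2 11 9 5) (Neg (EqF 9 4)))) u" using c True by blast
      then show ?thesis unfolding aff_step_def den.simps(5,6) d1 by (simp only: if_True)
    qed
    have pn: "p \<le> n" unfolding p_def by (rule first_le)
    have c2: "sem (Or (EqF 10 0) (B1 14 9)) (setc 10 p u) \<longleftrightarrow> p = n \<or> a \<in> elems 14 u"
      using e(1) a arr_elems[of a u 14] by auto
    show ?thesis
    proof (cases "p = n \<or> a \<in> elems 14 u")
      case T: True
      then have "den aff_step u = seta 16 n False (setc 10 p u)" using d2 c2 e(1) by simp
      then show ?thesis using T True by (simp add: p_def)
    next
      case F: False
      then have "p < n" using pn by simp
      have "den aff_step u = seta 14 a True (seta 15 p False (setc 10 p u))" using F d2 c2 e(1) a by simp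
      then show ?thesis using F True \<open>p < n\<close> a e(1) by (simp add: p_def elems_put)
    qed
  qed
qed

lemma den_una_step:
  assumes E: "Env n D v A st pr u" and p: "cnt u 10 = p" "p < n"
  shows "(elems 14 (den una_step u), arr (den una_step u) 16 n) =
    (if p \<in> elems 15 u then (let w = first n (free_child n D A (elems 14 u) p) in
       if w = n then (elems 14 u, False) else (insert w (elems 14 u), arr u 16 n))
     else (elems 14 u, arr u 16 n))"
proof -
  have e: "cnt u 0 = n" "rel 0 u = D" "elems 5 u = A"
    using E by (auto simp: Env_def)
  have c: "sem (B1 15 10) u \<longleftrightarrow> p \<in> elems 15 u" using e p arr_elems[of p u 15] by simp
  show ?thesis
  proof (cases "p \<in> elems 15 u")
    case False
    then have "den una_step u = u" using c unfolding una_step_def by (simp only: den.simps if_False)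
    then show ?thesis using False by simp
  next
    case True
    define w where "w = first n (free_child n D A (elems 14 u) p)"
    have "sem child_fm (setc 11 i u) = free_child n D A (elems 14 u) p i" if i: "i < n" for i
    proof -
      have "sem (Ex 30 (Con (Neg (B1 14 30)) (Con (Neg (B1 5 30)) (Con (B2 0 10 30) (B2 0 30 11))))) (setc 11 i u) \<longleftrightarrow>
         (\<exists>q<n. q \<notin> elems 14 u \<and> q \<notin> A \<and> D p q \<and> D q i)"
        using e p i arr_elems[of _ u] arr_rel[of _ u] by auto
      moreover have "arr u 14 i \<longleftrightarrow> i \<in> elems 14 u" "arr u 5 i \<longleftrightarrow> i \<in> A" "arr u 0 (p * n + i) \<longleftrightarrow> D p i"
        using e p i arr_elems[of i u] arr_rel[of p u i] by auto
      ultimately show ?thesis using e(1) p(1) unfolding child_fm_def free_child_def by auto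
    qed
    then have "first n (\<lambda>i. sem child_fm (setc 11 i u)) = w" unfolding w_def by (rule first_cong)
    then have d1: "den (Find 11 child_fm) u = setc 11 w u" using e(1) by simp
    have d2: "den una_step u = den (If (EqF 11 0) (Put 16 0 False) (Put 14 11 True)) (setc 11 w u)"
    proof -
      have "sem (B1 15 10) u" using c True by blast
      then show ?thesis unfolding una_step_def den.simps(5,6) d1 by (simp only: if_True)
    qed
    have "w \<le> n" unfolding w_def by (rule first_le)
    then show ?thesis using d2 True e(1) by (cases "w = n") (auto simp: w_def elems_put)
  qed
qed

lemma stage_cmd_frame:
  "z \<notin> {6, 9, 10, 11} \<Longrightarrow> cnt (den stage_cmd s) z = cnt s z"
  "a \<notin> {14, 15, 16} \<Longrightarrow> arr (den stage_cmd s) a = arr s a"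
  by (rule cnt_den, simp add: stage_cmd_def aff_step_def una_step_def copy1_def) (rule arr_den, simp add: stage_cmd_def aff_step_def una_step_def copy1_def)

lemma den_stage_cmd:
  assumes E: "Env n D v A st pr u" and j: "cnt u 5 = j" "j < n"
  shows "(elems 14 (den stage_cmd u), arr (den stage_cmd u) 16 n) =
    stage1 n D v A st pr j (elems 14 u, arr u 16 n)"
proof -
  have n: "cnt u 0 = n" using E by (simp add: Env_def)
  have c: "sem (Ex 30 (Neg (B1 14 30))) u \<longleftrightarrow> \<not> {..<n} \<subseteq> elems 14 u"
    using n by (auto simp: elems_def)
  show ?thesis
  proof (cases "{..<n} \<subseteq> elems 14 u")
    case True
    then have "den stage_cmd u = u" using c unfolding stage_cmd_def by (simp only: den.simps if_False simp_thms)
    then show ?thesis using True by (simp add: stage1_def)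
  next
    case False
    define u1 where "u1 = den (copy1 14 15) u"
    have u1c: "cnt u1 z = cnt u z" if "z \<noteq> 6" for z unfolding u1_def by (rule cnt_den) (use that in \<open>simp add: copy1_def\<close>)
    have u1a: "arr u1 a = arr u a" if "a \<noteq> 15" for a unfolding u1_def by (rule arr_den) (use that in \<open>simp add: copy1_def\<close>)
    have E1: "Env n D v A st pr u1" by (rule Env_frame[OF E]) (auto simp: u1c u1a)
    have s1: "elems 15 u1 = elems 14 u" "elems 14 u1 = elems 14 u" "arr u1 16 = arr u 16"
      using den_copy1[of 14 15 u] elems_frame[of u1 u 14] u1c u1a by (auto simp: u1_def)
    define X where "X = elems 14 u"
    define ok where "ok = arr u 16 n"
    define I where "I = (\<lambda>i w. Env n D v A st pr w \<and> cnt w 5 = j \<and>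
      (elems 15 w, elems 14 w, arr w 16 n) = affl n D v A st pr j X ok i)"
    have "I n (loop (den aff_step) 9 n u1)"
    proof (rule loop_rule)
      have "Env n D v A st pr (setc 9 0 u1)" by (rule Env_frame[OF E1]) auto
      then show "I 0 (setc 9 0 u1)" using s1 u1c j by (simp add: I_def X_def ok_def)
    next
      fix i w assume i: "i < n" "I i w" "cnt w 9 = i"
      then have Ew: "Env n D v A st pr w" "cnt w 5 = j" and af: "affl n D v A st pr j X ok i = (elems 15 w, elems 14 w, arr w 16 n)"
        by (auto simp: I_def)
      have "Env n D v A st pr (setc 9 (Suc i) (den aff_step w))"
        by (rule Env_frame[OF Ew(1)]) (use aff_step_frame in auto)
      moreover have "(elems 15 (den aff_step w), elems 14 (den aff_step w), arr (den aff_step w) 16 n) = affl n D v A st pr j X ok (Suc i)"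
        unfolding den_aff_step[OF Ew(1) i(3,1) Ew(2) j(2)] using af by simp
      ultimately show "I (Suc i) (setc 9 (Suc i) (den aff_step w))"
        unfolding I_def using Ew(2) aff_step_frame(1)[of 5 w] by simp
    qed
    then obtain u2 where u2d: "u2 = loop (den aff_step) 9 n u1" and I2: "I n u2" by blast
    obtain P J b where af: "affl n D v A st pr j X ok n = (P, J, b)" by (cases "affl n D v A st pr j X ok n") auto
    have E2: "Env n D v A st pr u2" "elems 15 u2 = P" "elems 14 u2 = J" "arr u2 16 n = b" using I2 af by (auto simp: I_def)
    define K where "K = (\<lambda>i w. Env n D v A st pr w \<and> elems 15 w = P \<and>
      (elems 14 w, arr w 16 n) = unafl n D A P J b i)"
    have K: "K n (loop (den una_step) 10 n u2)"
    proof (rule loop_rule)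
      have "Env n D v A st pr (setc 10 0 u2)" by (rule Env_frame[OF E2(1)]) auto
      then show "K 0 (setc 10 0 u2)" using E2 by (simp add: K_def)
    next
      fix i w assume i: "i < n" "K i w" "cnt w 10 = i"
      then have Ew: "Env n D v A st pr w" "elems 15 w = P" and af: "unafl n D A P J b i = (elems 14 w, arr w 16 n)"
        by (auto simp: K_def)
      have fr: "cnt (den una_step w) 0 = cnt w 0" "arr (den una_step w) 15 = arr w 15"
        using una_step_frame by auto
      have "Env n D v A st pr (setc 10 (Suc i) (den una_step w))"
        by (rule Env_frame[OF Ew(1)]) (use una_step_frame in auto)
      moreover have "(elems 14 (den una_step w), arr (den una_step w) 16 n) = unafl n D A P J b (Suc i)"
        unfolding den_una_step[OF Ew(1) i(3,1)] using af Ew(2) by simp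
      ultimately show "K (Suc i) (setc 10 (Suc i) (den una_step w))"
        unfolding K_def using Ew(2) elems_frame[OF fr] by simp
    qed
    have "cnt u2 0 = n" "cnt u1 0 = n" using E1 E2 by (auto simp: Env_def)
    then have "den stage_cmd u = loop (den una_step) 10 n u2"
      using c False unfolding stage_cmd_def u2d u1_def by simp
    then show ?thesis using K False af unfolding K_def stage1_def X_def ok_def by simp
  qed
qed

lemma check_cmd_frame:
  "z \<notin> {5, 6, 9, 10, 11} \<Longrightarrow> cnt (den check_cmd s) z = cnt s z"
  "a \<notin> {14, 15, 16} \<Longrightarrow> arr (den check_cmd s) a = arr s a"
  by (rule cnt_den, simp add: check_cmd_def stage_cmd_def aff_step_def una_step_def copy1_def fill_def) (rule arr_den, simp add: check_cmd_def stage_cmd_def aff_step_def una_step_def copy1_def fill_def)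

lemma den_check_cmd:
  assumes E: "Env n D v A st pr s"
  shows "(elems 14 (den check_cmd s), arr (den check_cmd s) 16 n) = chk n D v A st pr n"
proof -
  have n: "cnt s 0 = n" "cnt s 4 = v" "v < n" using E by (auto simp: Env_def)
  define s0 where "s0 = den (fill 14 False) s"
  define s1 where "s1 = seta 16 n True (seta 14 v True s0)"
  have c0: "cnt s0 z = cnt s z" if "z \<noteq> 6" for z unfolding s0_def by (rule cnt_den) (use that in \<open>simp add: fill_def\<close>)
  have a0: "arr s0 a = arr s a" if "a \<noteq> 14" for a unfolding s0_def by (rule arr_den) (use that in \<open>simp add: fill_def\<close>)
  have E1: "Env n D v A st pr s1" by (rule Env_frame[OF E]) (auto simp: s1_def c0 a0)
  have i1: "elems 14 s1 = {v}" "arr s1 16 n" using den_fill[of 14 False s] n c0 by (auto simp: s1_def s0_def elems_put)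
  define I where "I = (\<lambda>i w. Env n D v A st pr w \<and> (elems 14 w, arr w 16 n) = chk n D v A st pr i)"
  have "I n (loop (den stage_cmd) 5 n s1)"
  proof (rule loop_rule)
    have "Env n D v A st pr (setc 5 0 s1)" by (rule Env_frame[OF E1]) auto
    then show "I 0 (setc 5 0 s1)" using i1 by (simp add: I_def)
  next
    fix i w assume i: "i < n" "I i w" "cnt w 5 = i"
    then have Ew: "Env n D v A st pr w" and ch: "chk n D v A st pr i = (elems 14 w, arr w 16 n)" by (auto simp: I_def)
    have "Env n D v A st pr (setc 5 (Suc i) (den stage_cmd w))"
      by (rule Env_frame[OF Ew]) (use stage_cmd_frame in auto)
    then show "I (Suc i) (setc 5 (Suc i) (den stage_cmd w))"
      unfolding I_def using den_stage_cmd[OF Ew i(3,1)] ch by simp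
  qed
  moreover have "den check_cmd s = loop (den stage_cmd) 5 n s1"
    using n c0 unfolding check_cmd_def s1_def s0_def by simp
  ultimately show ?thesis by (simp add: I_def)
qed

lemma sem_full: "sem (Neg (Ex 30 (Neg (B1 14 30)))) s \<longleftrightarrow> {..<cnt s 0} \<subseteq> elems 14 s"
  by (auto simp: elems_def)

lemma affl_cong:
  assumes "\<And>a. a \<in> A \<Longrightarrow> st a = st' a \<and> pr a = pr' a"
  shows "affl n D v A st pr j X ok i = affl n D v A st' pr' j X ok i"
proof (induction i)
  case (Suc a)
  have "aff_parent n D A pr P a = aff_parent n D A pr' P a" if "a \<in> A" for P
    using assms[OF that] by (simp add: aff_parent_def fun_eq_iff)
  then show ?case using Suc assms by (auto split: prod.splits)
qed simp

text \<open>Strings of equal rank coincide on the affected rows only, and the check looks at no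
  other rows.\<close>

lemma accepts_cong:
  assumes "\<And>a. a \<in> A \<Longrightarrow> st a = st' a \<and> pr a = pr' a"
  shows "accepts n D v A st pr = accepts n D v A st' pr'"
proof -
  have "chk n D v A st pr i = chk n D v A st' pr' i" for i
    by (induction i) (simp_all add: stage1_def affl_cong[OF assms])
  then show ?thesis by (simp add: accepts_def)
qed

section \<open>The two searches and their initial values\<close>

definition init_cmd :: cmd where
  "init_cmd = Seq (Find 12 (EqF 12 12)) (Seq (Find 13 (Neg (EqF 13 12)))
     (Seq (Find 14 (Con (Neg (EqF 14 12)) (Neg (EqF 14 13))))
     (Seq (Find 15 (Con (Neg (EqF 15 12)) (Con (Neg (EqF 15 13)) (Neg (EqF 15 14)))))
     (Seq (Put 7 12 True) (Seq (Put 7 13 True) (Seq (Put 7 14 True) (Seq (Put 7 15 True)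
     (Seq (fill 8 True) (For 6 (Put2 6 6 12 True))))))))))"

text \<open>If all strings fail, every player is declared affected. This is correct for any order,
  and within the intended bound, since it happens only when there are at least \<open>n\<close> back
  arcs.\<close>

definition fas_body :: cmd where
  "fas_body = Seq fas_cmd (If (Ex 30 (Ex 31 (Ex 32 (cycf 30 31 32))))
     (Seq (odo_cmd 6 8 7) (If (B1 9 0) (Seq (fill 5 True) (Put 3 0 True)) Skip)) (Put 3 0 True))"

text \<open>Both strings get rank 0. The digits of array 12 are the affected players themselves, so
  its lowest digit is the least element of the extended array 5.\<close>

definition prep_cmd :: cmd where
  "prep_cmd = Seq (Put 5 4 True) (Seq (Put 3 0 False) (For 9 (Seq (Find 11 (EqF 11 11)) (Seq (Put2 11 9 11 True)
     (Seq (Find 11 (B1 5 11)) (Put2 12 9 11 True))))))"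

text \<open>Two odometers in series: the parents turn fastest, and their carry advances the stages.
  A carry of the stages ends the search with array 17 still unset, that is, with rejection.\<close>

definition search_body :: cmd where
  "search_body = Seq check_cmd (If (Con (B1 16 0) (Neg (Ex 30 (Neg (B1 14 30))))) (Seq (Put 17 0 True) (Put 3 0 True))
     (Seq (odo_cmd 12 5 5) (If (B1 9 0) (Seq (odo_cmd 11 5 13) (If (B1 9 0) (Put 3 0 True) Skip)) Skip)))"

text \<open>The digits 0 to 3 serve as column indices, hence \<open>4 <= n\<close>.\<close>

lemma den_init_cmd:
  assumes n: "cnt s 0 = n" "4 \<le> n" and a: "arr s 6 = (\<lambda>_. False)" "arr s 7 = (\<lambda>_. False)"
  shows "cnt (den init_cmd s) 13 = 1" "cnt (den init_cmd s) 14 = 2" "cnt (den init_cmd s) 15 = 3"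
    "\<forall>q<n. arr (den init_cmd s) 7 q \<longleftrightarrow> q < 4" "\<forall>q<n. arr (den init_cmd s) 8 q"
    "reps (den init_cmd s) 6 8 (\<lambda>_. 0)"
proof -
  define s1 where "s1 = setc 15 3 (setc 14 2 (setc 13 1 (setc 12 0 s)))"
  have f: "first n (\<lambda>i. True) = 0" "first n (\<lambda>i. i \<noteq> 0) = 1" "first n (\<lambda>i. i \<noteq> 0 \<and> i \<noteq> Suc 0) = 2"
    "first n (\<lambda>i. i \<noteq> 0 \<and> i \<noteq> Suc 0 \<and> i \<noteq> 2) = 3"
    by (rule first_eqI; use n in auto)+
  define s2 where "s2 = seta 7 3 True (seta 7 2 True (seta 7 1 True (seta 7 0 True s1)))"
  define s3 where "s3 = den (fill 8 True) s2"
  have c3: "cnt s3 z = cnt s2 z" if "z \<noteq> 6" for z unfolding s3_def by (rule cnt_den) (use that in \<open>simp add: fill_def\<close>)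
  have a3: "arr s3 a = arr s2 a" if "a \<noteq> 8" for a unfolding s3_def by (rule arr_den) (use that in \<open>simp add: fill_def\<close>)
  have d: "den init_cmd s = loop (den (Put2 6 6 12 True)) 6 n s3"
    using f n(1) c3[of 0] unfolding init_cmd_def s3_def s2_def s1_def by simp
  define I where "I = (\<lambda>i (u::store). (\<forall>z. z \<noteq> 6 \<longrightarrow> cnt u z = cnt s3 z) \<and> (\<forall>a. a \<noteq> 6 \<longrightarrow> arr u a = arr s3 a) \<and>
    (\<forall>a<n. \<forall>q<n. rel 6 u a q \<longleftrightarrow> q = 0 \<and> a < i))"
  have c30: "cnt s3 0 = n" "cnt s3 12 = 0" using c3 n(1) by (auto simp: s2_def s1_def)
  have "I n (loop (den (Put2 6 6 12 True)) 6 n s3)"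
  proof (rule loop_rule)
    show "I 0 (setc 6 0 s3)" using a3[of 6] a by (simp add: I_def rel_def s2_def s1_def)
  next
    fix i u assume i: "i < n" "I i u" "cnt u 6 = i"
    have u: "cnt u 0 = n" "cnt u 12 = 0" using i(2) c30 by (auto simp: I_def)
    have "den (Put2 6 6 12 True) u = seta 6 (i * n + 0) True u" using u i(3) by simp
    moreover have "rel 6 (seta 6 (i * n + 0) True u) = (\<lambda>k l. if k = i \<and> l = 0 then True else rel 6 u k l)"
      by (rule rel_put) (use u i in auto)
    ultimately show "I (Suc i) (setc 6 (Suc i) (den (Put2 6 6 12 True) u))" using i(2) by (auto simp: I_def less_Suc_eq)
  qed
  then have I: "I n (den init_cmd s)" unfolding d .
  then show "cnt (den init_cmd s) 13 = 1" "cnt (den init_cmd s) 14 = 2" "cnt (den init_cmd s) 15 = 3"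
    using c3 by (auto simp: I_def s2_def s1_def)
  show "\<forall>q<n. arr (den init_cmd s) 7 q \<longleftrightarrow> q < 4" using I a3[of 7] a(2) by (auto simp: I_def s2_def s1_def)
  have "elems 8 s3 = {..<n}" using den_fill[of 8 True s2] c3[of 0] c30 unfolding s3_def by simp
  then show 8: "\<forall>q<n. arr (den init_cmd s) 8 q" using I c30 by (auto simp: I_def elems_def)
  show "reps (den init_cmd s) 6 8 (\<lambda>_. 0)" using I c30 by (auto simp: reps_def I_def elems_def)
qed

lemma init_cmd_frame:
  "z \<notin> {6, 12, 13, 14, 15} \<Longrightarrow> cnt (den init_cmd s) z = cnt s z"
  "a \<notin> {6, 7, 8} \<Longrightarrow> arr (den init_cmd s) a = arr s a"
  by (rule cnt_den, simp add: init_cmd_def fill_def) (rule arr_den, simp add: init_cmd_def fill_def)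

lemma fas_cmd_frame:
  "z \<notin> {5, 6, 7, 8} \<Longrightarrow> cnt (den fas_cmd s) z = cnt s z"
  "a \<notin> {4, 5} \<Longrightarrow> arr (den fas_cmd s) a = arr s a"
  by (rule cnt_den, simp add: fas_cmd_def fas_step_def rev_cmd_def fill_def copy2_def)
    (rule arr_den, simp add: fas_cmd_def fas_step_def rev_cmd_def fill_def copy2_def)

lemma odo_cmd_frame:
  "z \<notin> {9, 10, 11} \<Longrightarrow> cnt (den (odo_cmd R rows X) s) z = cnt s z"
  "a \<notin> {9, R} \<Longrightarrow> arr (den (odo_cmd R rows X) s) a = arr s a"
  by (rule cnt_den, simp add: odo_cmd_def) (rule arr_den, auto simp add: odo_cmd_def)

lemma fas_body_frame:
  "z \<notin> {5, 6, 7, 8, 9, 10, 11} \<Longrightarrow> cnt (den fas_body s) z = cnt s z"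
  "a \<notin> {3, 4, 5, 6, 9} \<Longrightarrow> arr (den fas_body s) a = arr s a"
  by (rule cnt_den, simp add: fas_body_def odo_cmd_def fas_cmd_def fas_step_def rev_cmd_def fill_def copy2_def)
    (rule arr_den, simp add: fas_body_def odo_cmd_def fas_cmd_def fas_step_def rev_cmd_def fill_def copy2_def)

lemma fill_frame:
  "z \<noteq> 6 \<Longrightarrow> cnt (den (fill a b) s) z = cnt s z" "c \<noteq> a \<Longrightarrow> arr (den (fill a b) s) c = arr s c"
  by (rule cnt_den, simp add: fill_def) (rule arr_den, simp add: fill_def)

lemma sem_tri: "sem (Ex 30 (Ex 31 (Ex 32 (cycf 30 31 32)))) s \<longleftrightarrow> tx (cnt s 0) (rel 4 s) \<noteq> cnt s 0"
proof -
  define n where "n = cnt s 0"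
  have "sem (Ex 30 (Ex 31 (Ex 32 (cycf 30 31 32)))) s \<longleftrightarrow> (\<exists>x<n. \<exists>y<n. \<exists>z<n. cyc (rel 4 s) x y z)"
    by (simp add: sem_cycf n_def cong: conj_cong)
  also have "\<dots> \<longleftrightarrow> tx n (rel 4 s) < n" unfolding tx_def first_less_iff ..
  also have "\<dots> \<longleftrightarrow> tx n (rel 4 s) \<noteq> n" using first_le[of n] unfolding tx_def by (auto simp: le_less)
  finally show ?thesis by (simp add: n_def)
qed

lemma fas_body_done:
  assumes n: "cnt u 0 = n" and f: "(rel 4 (den fas_cmd u), elems 5 (den fas_cmd u)) = (T, A)" and t: "tx n T = n"
  shows "arr (den fas_body u) 3 n \<and> elems 5 (den fas_body u) = A"
proof -
  have c: "cnt (den fas_cmd u) 0 = n" using fas_cmd_frame(1)[of 0 u] n by simp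
  then have "\<not> sem (Ex 30 (Ex 31 (Ex 32 (cycf 30 31 32)))) (den fas_cmd u)" unfolding sem_tri using f t by simp
  then have "den fas_body u = seta 3 n True (den fas_cmd u)"
    using c unfolding fas_body_def den.simps(5,6) by (simp only: if_False den.simps)
  then show ?thesis using f by simp
qed

context
  fixes n :: nat and D :: "nat \<Rightarrow> nat \<Rightarrow> bool" and R X :: "nat \<Rightarrow> bool"
  assumes R: "\<And>a. a < n \<Longrightarrow> R a" and X: "\<And>q. q < n \<Longrightarrow> X q \<longleftrightarrow> q < 4" and n4: "4 \<le> n"
begin

definition fas_inv :: "(nat \<Rightarrow> nat) \<Rightarrow> store \<Rightarrow> bool" where
  "fas_inv f u \<longleftrightarrow> cnt u 0 = n \<and> cnt u 13 = 1 \<and> cnt u 14 = 2 \<and> cnt u 15 = 3 \<and> rel 0 u = D \<and>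
     arr u 8 = R \<and> arr u 7 = X \<and> reps u 6 8 f \<and> \<not> arr u 3 n"

lemma fas_inv_fas_cmd:
  assumes "fas_inv f u" "valid n R X f"
  shows "(rel 4 (den fas_cmd u), elems 5 (den fas_cmd u)) = fasrun n D f n"
proof -
  have u: "cnt u 0 = n" "cnt u 13 = 1" "cnt u 14 = 2" "cnt u 15 = 3" "rel 0 u = D" "arr u 8 = R" "reps u 6 8 f"
    using assms(1) by (auto simp: fas_inv_def)
  have "digit u i = f i" if i: "i < n" for i
  proof -
    have "i \<in> elems 8 u" using u i R by (simp add: elems_def)
    then have r: "\<forall>q<n. rel 6 u i q \<longleftrightarrow> q = f i" using u by (auto simp: reps_def)
    have b: "arr u 6 (i * n + q) \<longleftrightarrow> q = f i" if "q < n" for q using r that i u arr_rel[of i u q 6] by simp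
    have "f i < 4" using assms(2) i R X by (auto simp: valid_def)
    then have "f i = 0 \<or> f i = 1 \<or> f i = 2 \<or> f i = 3" by linarith
    then show ?thesis unfolding digit_def u(1-4) using b[of 1] b[of 2] b[of 3] n4 by auto
  qed
  then have "fasrun n D (digit u) n = fasrun n D f n" by (rule fasrun_cong)
  then show ?thesis using den_fas_cmd[of u] u by simp
qed

lemma fas_inv_step:
  assumes fas_inv: "fas_inv f u" and v: "valid n R X f" and t: "tx n (fst (fasrun n D f n)) \<noteq> n"
  shows "snd (odo n R X n f) \<Longrightarrow> arr (den fas_body u) 3 n \<and> elems 5 (den fas_body u) = {..<n}"
    and "\<not> snd (odo n R X n f) \<Longrightarrow> fas_inv (fst (odo n R X n f)) (den fas_body u)"
proof -
  have u: "cnt u 0 = n" "cnt u 13 = 1" "cnt u 14 = 2" "cnt u 15 = 3" "rel 0 u = D" "arr u 8 = R" "arr u 7 = X"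
    "reps u 6 8 f" "\<not> arr u 3 n" using fas_inv by (auto simp: fas_inv_def)
  define w where "w = den fas_cmd u"
  have c: "cnt w 0 = n" using fas_cmd_frame(1)[of 0 u] u by (simp add: w_def)
  have wa: "arr w a = arr u a" if "a \<notin> {4, 5}" for a using fas_cmd_frame(2)[OF that] by (simp add: w_def)
  have "rel 4 w = fst (fasrun n D f n)" using fas_inv_fas_cmd[OF fas_inv v] unfolding w_def by (metis fst_conv)
  then have sm: "sem (Ex 30 (Ex 31 (Ex 32 (cycf 30 31 32)))) w" unfolding sem_tri using t c by simp
  have rw: "reps w 6 8 f" using u(8) c u(1) elems_frame[of w u 8] rel_frame[of w u 6] wa by (simp add: reps_def)
  define y where "y = den (odo_cmd 6 8 7) w"
  have ya: "arr y a = arr w a" if "a \<notin> {9, 6}" for a using odo_cmd_frame(2)[OF that] by (simp add: y_def)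
  have yc: "cnt y z = cnt w z" if "z \<notin> {9, 10, 11}" for z using odo_cmd_frame(1)[OF that] by (simp add: y_def)
  have ex: "\<exists>q<cnt w 0. arr w 7 q" using c wa[of 7] u(7) X n4 by (intro exI[of _ 0]) auto
  have y: "reps y 6 8 (fst (odo n R X n f))" "arr y 9 n = snd (odo n R X n f)"
    using den_odo[of 6 8 7 w f, OF _ _ _ _ _ ex rw] wa u c by (auto simp: y_def)
  have d: "den fas_body u = den (If (B1 9 0) (Seq (fill 5 True) (Put 3 0 True)) Skip) y"
    using sm unfolding fas_body_def den.simps(5,6) w_def[symmetric] y_def by (simp only: if_True)
  have y0: "cnt y 0 = n" using yc c by simp
  {
    assume "snd (odo n R X n f)"
    then have "den fas_body u = seta 3 n True (den (fill 5 True) y)"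
      using d y(2) y0 fill_frame(1)[of 0 5 True y] by simp
    then show "arr (den fas_body u) 3 n \<and> elems 5 (den fas_body u) = {..<n}" using den_fill[of 5 True y] y0 by simp
  next
    assume "\<not> snd (odo n R X n f)"
    then have e: "den fas_body u = y" using d y(2) y0 by simp
    have "cnt y z = cnt u z" if "z \<notin> {5,6,7,8,9,10,11}" for z
      using yc[of z] fas_cmd_frame(1)[of z u] that by (simp add: w_def)
    moreover have "arr y a = arr u a" if "a \<notin> {4,5,6,9}" for a using ya[of a] wa[of a] that by simp
    ultimately show "fas_inv (fst (odo n R X n f)) (den fas_body u)"
      unfolding e fas_inv_def using u y(1) rel_frame[of y u 0] by simp
  }
qed

lemma fas_facts: "radix n X = 4" "\<And>i. i \<le> n \<Longrightarrow> row_count R i = i" "\<And>y. y < 4 \<Longrightarrow> digit_index n X y = y"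
proof -
  have "{q. q < n \<and> X q} = {..<4}" using X n4 by auto
  then show "radix n X = 4" by (simp add: radix_def)
  fix i assume "i \<le> n"
  then have "{a. a < i \<and> R a} = {..<i}" using R by auto
  then show "row_count R i = i" by (simp add: row_count_def)
next
  fix y :: nat assume "y < 4"
  then have "{q. q < n \<and> X q \<and> q < y} = {..<y}" using X n4 by auto
  then show "digit_index n X y = y" by (simp add: digit_index_def)
qed

text \<open>Round \<open>j\<close> treats the string of rank \<open>j\<close>. With \<open>b\<close>
  back arcs some string of rank below \<open>4 ^ b\<close> succeeds, so the loop ends in time; and
  whichever string succeeds earliest also has rank below \<open>4 ^ b\<close>, hence nonzero digits
  in the first \<open>b\<close> rows only and at most \<open>2 * b\<close> affected players. This
  holds for every \<open>r\<close>, so the program need not know \<open>b\<close>.\<close>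

lemma fas_search:
  assumes T: "tournament n D" and inj: "inj_on r {..<n}" and FI0: "fas_inv (\<lambda>_. 0) s"
  shows "\<exists>k\<le>4 ^ card (back_arcs r D). (\<forall>j<k. \<not> arr ((den fas_body ^^ j) s) 3 n) \<and> arr ((den fas_body ^^ k) s) 3 n \<and>
    (\<exists>r'. ordered n D (elems 5 ((den fas_body ^^ k) s)) r') \<and> card (elems 5 ((den fas_body ^^ k) s)) \<le> 2 * card (back_arcs r D)"
proof -
  let ?S = "\<lambda>j. (den fas_body ^^ j) s"
  let ?b = "card (back_arcs r D)"
  have ex: "\<exists>q<n. X q" using X n4 by (intro exI[of _ 0]) auto
  define Inv where "Inv = (\<lambda>j f. fas_inv f (?S j) \<and> valid n R X f \<and> rank n R X n f = j)"
  have I0: "Inv 0 (\<lambda>_. 0)"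
  proof -
    have "rank n R X i (\<lambda>_. 0) = 0" for i by (induction i) (use fas_facts(3)[of 0] in auto)
    then show ?thesis using FI0 X n4 by (auto simp: Inv_def valid_def)
  qed
  have step: "arr (?S (Suc j)) 3 n \<or> (\<exists>g. Inv (Suc j) g)" if I: "Inv j f" for j f
  proof (cases "tx n (fst (fasrun n D f n)) = n")
    case True
    have "fas_inv f (?S j)" using I by (simp add: Inv_def)
    then have "cnt (?S j) 0 = n" by (simp add: fas_inv_def)
    from fas_body_done[OF this, of "fst (fasrun n D f n)" "snd (fasrun n D f n)"] fas_inv_fas_cmd[of f "?S j"] I True
    show ?thesis by (simp add: Inv_def)
  next
    case False
    show ?thesis
    proof (cases "snd (odo n R X n f)")
      case c: True
      then show ?thesis using fas_inv_step(1)[of f "?S j"] I False by (simp add: Inv_def)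
    next
      case c: False
      have "rank n R X n (fst (odo n R X n f)) = Suc j"
        using odo_rank[OF ex, of R f n] I c by (auto simp: Inv_def split: prod.splits)
      then show ?thesis using fas_inv_step(2)[of f "?S j"] I False c odo_valid[OF ex, of R f n]
        by (intro disjI2 exI[of _ "fst (odo n R X n f)"]) (simp add: Inv_def)
    qed
  qed
  have nd: "\<not> arr (?S j) 3 n" if "Inv j f" for j f using that by (simp add: Inv_def fas_inv_def)
  have all: "\<exists>f. Inv j f" if "\<And>i. i \<le> j \<Longrightarrow> \<not> arr (?S i) 3 n" for j using that
  proof (induction j)
    case 0
    then show ?case using I0 by blast
  next
    case (Suc j)
    then obtain f where "Inv j f" by auto
    then show ?case using step[of j f] Suc.prems[of "Suc j"] by blast
  qed
  have lt: "j < 4 ^ n" if "Inv j f" for j f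
    using rank_less[of n R X f n] that fas_facts by (auto simp: Inv_def)
  have exk: "\<exists>k. arr (?S k) 3 n" using all[of "4 ^ n"] lt by blast
  define k where "k = (LEAST k. arr (?S k) 3 n)"
  have kd: "arr (?S k) 3 n" unfolding k_def using exk by (rule LeastI_ex)
  have kn: "\<not> arr (?S j) 3 n" if "j < k" for j using that not_less_Least unfolding k_def by blast
  have "k \<noteq> 0" using kd nd[OF I0] by metis
  then obtain k' where k': "k = Suc k'" using not0_implies_Suc by blast
  obtain f where f: "Inv k' f" using all[of k'] kn k' by auto
  have kb: "k \<le> 4 ^ ?b"
  proof (cases "?b \<le> n")
    case True
    obtain f' where f': "\<forall>a. f' a \<le> 3" "\<forall>a\<ge>?b. f' a = 0" "tx n (fst (fasrun n D f' n)) = n"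
      using fas_exists[OF T inj True] by blast
    have "f' a < n \<and> X (f' a)" for a
    proof -
      have "f' a < 4" using f'(1) by (simp add: le_less_trans[of _ 3])
      then show ?thesis using X[of "f' a"] n4 by simp
    qed
    then have v': "valid n R X f'" by (simp add: valid_def)
    define m where "m = rank n R X n f'"
    have "m = rank n R X ?b f'" unfolding m_def using rank_zero_above[OF True, of n X f' R] f'(2) fas_facts(3)[of 0] by simp
    then have m: "m < 4 ^ ?b" using rank_less[OF v' True] fas_facts True by simp
    show ?thesis
    proof (rule ccontr)
      assume "\<not> ?thesis"
      \<comment> \<open>Round \<open>m\<close> would have met this string, or one equal to it on all
        rows, and stopped.\<close>
      then have mk: "m < k'" using m k' by simp
      then obtain g where g: "Inv m g" using all[of m] kn k' by auto
      then have "g a = f' a" if "a < n" for a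
        using rank_inj[of n R X g f' n a] v' that R by (auto simp: Inv_def m_def)
      then have "fasrun n D g n = fasrun n D f' n" by (rule fasrun_cong)
      then have "tx n (fst (fasrun n D g n)) = n" using f'(3) by simp
      moreover have "cnt (?S m) 0 = n" using g by (simp add: Inv_def fas_inv_def)
      ultimately have "arr (?S (Suc m)) 3 n"
        using fas_body_done[of "?S m" n "fst (fasrun n D g n)" "snd (fasrun n D g n)"] fas_inv_fas_cmd[of g "?S m"] g by (simp add: Inv_def)
      then show False using kn[of "Suc m"] mk k' by simp
    qed
  next
    case False
    have "k \<le> 4 ^ n" using lt[OF f] k' by simp
    also have "\<dots> \<le> 4 ^ ?b" using False by (intro power_increasing) auto
    finally show ?thesis .
  qed
  have fin: "(\<exists>r'. ordered n D (elems 5 (?S k)) r') \<and> card (elems 5 (?S k)) \<le> 2 * ?b"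
  proof (cases "tx n (fst (fasrun n D f n)) = n")
    case True
    obtain T' A where TA: "fasrun n D f n = (T', A)" by (cases "fasrun n D f n") auto
    have "cnt (?S k') 0 = n" using f by (simp add: Inv_def fas_inv_def)
    then have A: "elems 5 (?S k) = A"
      using fas_body_done[of "?S k'" n T' A] fas_inv_fas_cmd[of f "?S k'"] f TA True k' by (simp add: Inv_def)
    have inv: "tournament n T'" "\<And>u w. u \<notin> A \<or> w \<notin> A \<Longrightarrow> T' u w = D u w" "card A \<le> 2 * card {a. a < n \<and> f a \<noteq> 0}"
      using fasrun_inv[OF T, where f = f and i = n] TA by auto
    have "\<not> cyc T' x y z" for x y z using tri_none[OF inv(1)] True TA by simp
    from no_cyc_rank[OF inv(1) this] obtain r' :: "nat \<Rightarrow> nat" where r': "inj_on r' {..<n}" "\<forall>u<n. \<forall>w<n. T' u w \<longleftrightarrow> r' u < r' w" by blast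
    have "ordered n D A r'" unfolding ordered_def using r' inv(2) by metis
    moreover have "{a. a < n \<and> f a \<noteq> 0} \<subseteq> {..<?b}"
    proof
      fix a assume "a \<in> {a. a < n \<and> f a \<noteq> 0}"
      then have a: "a < n" "f a \<noteq> 0" by auto
      have "f a < 4" using f a R X by (auto simp: Inv_def valid_def)
      then have "digit_index n X (f a) * radix n X ^ row_count R a \<ge> 4 ^ a" using fas_facts a by simp
      moreover have "digit_index n X (f a) * radix n X ^ row_count R a \<le> k'"
        using rank_ge[where n = n and R = R and X = X and f = f, of a n] a R f by (simp add: Inv_def)
      ultimately have "(4::nat) ^ a < 4 ^ ?b" using kb k' by linarith
      then show "a \<in> {..<?b}" by (metis lessThan_iff not_le power_increasing one_le_numeral)
    qed
    then have "card {a. a < n \<and> f a \<noteq> 0} \<le> ?b" using card_mono[of "{..<?b}"] by fastforce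
    ultimately show ?thesis using A inv(3) by auto
  next
    case False
    have c: "snd (odo n R X n f)"
    proof (rule ccontr)
      assume "\<not> ?thesis"
      then have "fas_inv (fst (odo n R X n f)) (?S k)" using fas_inv_step(2)[of f "?S k'"] f False k' by (simp add: Inv_def)
      then show False using kd by (simp add: fas_inv_def)
    qed
    then have A: "elems 5 (?S k) = {..<n}" using fas_inv_step(1)[of f "?S k'"] f False k' by (simp add: Inv_def)
    \<comment> \<open>A carry means that all \<open>4 ^ n\<close> strings were tried. Comparing with
      the bound on \<open>k\<close> gives \<open>n <= b\<close>, so \<open>n\<close> affected
      players are not too many.\<close>
    have "k' + 1 = 4 ^ n" using odo_rank[OF ex, of R f n] f c fas_facts by (auto simp: Inv_def split: prod.splits)
    then have "(4::nat) ^ n \<le> 4 ^ ?b" using kb k' by simp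
    then have "n \<le> ?b" by (metis power_le_imp_le_exp one_less_numeral_iff semiring_norm(76))
    moreover have "ordered n D {..<n} id" by (auto simp: ordered_def)
    ultimately show ?thesis using A by auto
  qed
  show ?thesis using kb kd kn fin by blast
qed

end

text \<open>A cyclic triangle needs three players and \<open>n\<close> is a power of two, so
  \<open>4 <= n\<close> whenever a search takes place. If there is no triangle, the first round
  stops whatever digits are stored, which settles the small tournaments.\<close>

lemma fas_phase:
  assumes n: "cnt s 0 = n" "n = 2 ^ m" and D: "rel 0 s = D" "tournament n D" and inj: "inj_on r {..<n}"
    and a: "arr s 6 = (\<lambda>_. False)" "arr s 7 = (\<lambda>_. False)" "\<not> arr s 3 n"
  shows "\<exists>k\<le>4 ^ card (back_arcs r D). \<exists>s'. s' = (den fas_body ^^ k) (den init_cmd s) \<and>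
    (\<forall>j<k. \<not> arr ((den fas_body ^^ j) (den init_cmd s)) 3 n) \<and> arr s' 3 n \<and>
    (\<exists>r'. ordered n D (elems 5 s') r') \<and> card (elems 5 s') \<le> 2 * card (back_arcs r D)"
proof -
  define s1 where "s1 = den init_cmd s"
  have n1: "cnt s1 0 = n" "rel 0 s1 = D" "\<not> arr s1 3 n"
    using init_cmd_frame[of 0 s] init_cmd_frame(2)[of 3 s] rel_frame[of s1 s 0] n D a by (auto simp: s1_def)
  show ?thesis
  proof (cases "tx n D = n")
    case True
    have "fasrun n D f i = (D, {})" for f i by (induction i) (use True in \<open>auto simp: fas1_def\<close>)
    then have "(rel 4 (den fas_cmd s1), elems 5 (den fas_cmd s1)) = (D, {})" using den_fas_cmd[of s1] n1 by simp
    from fas_body_done[OF n1(1) this True] have b: "arr (den fas_body s1) 3 n" "elems 5 (den fas_body s1) = {}" by auto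
    have "\<not> cyc D x y z" for x y z using tri_none[OF D(2) True] .
    from no_cyc_rank[OF D(2) this] obtain r' :: "nat \<Rightarrow> nat" where "inj_on r' {..<n}" "\<forall>u<n. \<forall>w<n. D u w \<longleftrightarrow> r' u < r' w" by blast
    then have "ordered n D {} r'" by (auto simp: ordered_def)
    then show ?thesis using b n1 unfolding s1_def[symmetric] by (intro exI[of _ 1]) auto
  next
    case False
    then have t: "tx n D < n" "ty n D < n" "tz n D < n" "cyc D (tx n D) (ty n D) (tz n D)" using tri_found by blast+
    have "{tx n D, ty n D, tz n D} \<subseteq> {..<n}" using t by auto
    moreover have "card {tx n D, ty n D, tz n D} = 3"
      using t(4) tournament_irrefl[OF D(2)] tournament_asym[OF D(2)] unfolding cyc_def by (auto simp: card_insert_if)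
    ultimately have "3 \<le> n" using card_mono[of "{..<n}" "{tx n D, ty n D, tz n D}"] by simp
    have n4: "4 \<le> n"
    proof -
      have "2 \<le> m"
      proof (rule ccontr)
        assume "\<not> 2 \<le> m"
        then have "m = 0 \<or> m = 1" by linarith
        then show False using \<open>3 \<le> n\<close> n(2) by auto
      qed
      then have "(2::nat) ^ 2 \<le> 2 ^ m" by (intro power_increasing) auto
      then show ?thesis using n(2) by simp
    qed
    note i = den_init_cmd[OF n(1) n4 a(1,2), folded s1_def]
    have R: "\<And>a. a < n \<Longrightarrow> arr s1 8 a" and X: "\<And>q. q < n \<Longrightarrow> arr s1 7 q \<longleftrightarrow> q < 4" using i by auto
    have "fas_inv n D (arr s1 8) (arr s1 7) (\<lambda>_. 0) s1" using i n1 by (simp add: fas_inv_def[OF R X n4])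
    from fas_search[OF R X n4 D(2) inj this] show ?thesis unfolding s1_def by blast
  qed
qed

lemma den_prep_cmd:
  assumes n: "cnt s 0 = n" "cnt s 4 = v" "v < n" and a: "arr s 11 = (\<lambda>_. False)" "arr s 12 = (\<lambda>_. False)"
  shows "elems 5 (den prep_cmd s) = insert v (elems 5 s)" "\<not> arr (den prep_cmd s) 3 n"
    "reps (den prep_cmd s) 11 5 (\<lambda>_. 0)" "reps (den prep_cmd s) 12 5 (\<lambda>_. first n (\<lambda>q. q \<in> insert v (elems 5 s)))"
proof -
  define s1 where "s1 = seta 3 n False (seta 5 v True s)"
  define A where "A = insert v (elems 5 s)"
  define y where "y = first n (\<lambda>q. q \<in> A)"
  let ?c = "Seq (Find 11 (EqF 11 11)) (Seq (Put2 11 9 11 True) (Seq (Find 11 (B1 5 11)) (Put2 12 9 11 True)))"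
  have A1: "elems 5 s1 = A" using n by (simp add: s1_def A_def elems_put)
  have y: "y < n" unfolding y_def first_less_iff using n A_def by auto
  define I where "I = (\<lambda>i (u::store). cnt u 0 = n \<and> elems 5 u = A \<and> \<not> arr u 3 n \<and>
    (\<forall>a<n. \<forall>q<n. rel 11 u a q \<longleftrightarrow> q = 0 \<and> a < i) \<and> (\<forall>a<n. \<forall>q<n. rel 12 u a q \<longleftrightarrow> q = y \<and> a < i))"
  have "I n (loop (den ?c) 9 n s1)"
  proof (rule loop_rule)
    show "I 0 (setc 9 0 s1)" using A1 a n by (simp add: I_def rel_def s1_def)
  next
    fix i u assume i: "i < n" "I i u" "cnt u 9 = i"
    have u: "cnt u 0 = n" "elems 5 u = A" using i(2) by (auto simp: I_def)
    have f0: "first n (\<lambda>i. True) = 0" by (rule first_eqI) auto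
    define u1 where "u1 = seta 11 (i * n + 0) True (setc 11 0 u)"
    have fy: "first n (\<lambda>q. arr u 5 q) = y" unfolding y_def by (rule first_cong) (use u in \<open>auto simp: elems_def\<close>)
    have d: "den ?c u = seta 12 (i * n + y) True (setc 11 y u1)"
      using u i f0 fy by (simp add: u1_def)
    have r1: "rel 11 u1 = (\<lambda>a q. if a = i \<and> q = 0 then True else rel 11 u a q)"
      unfolding u1_def using rel_put[of "setc 11 0 u" n i 0 11 True] u i by simp
    have r2: "rel 12 (seta 12 (i * n + y) True (setc 11 y u1)) = (\<lambda>a q. if a = i \<and> q = y then True else rel 12 u a q)"
      using rel_put[of "setc 11 y u1" n i y 12 True] u i y by (simp add: u1_def)
    show "I (Suc i) (setc 9 (Suc i) (den ?c u))" unfolding d I_def using r1 r2 u i(2)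
      by (auto simp: I_def u1_def less_Suc_eq)
  qed
  moreover have "den prep_cmd s = loop (den ?c) 9 n s1" using n by (simp add: prep_cmd_def s1_def)
  ultimately have I: "I n (den prep_cmd s)" by metis
  then show "elems 5 (den prep_cmd s) = insert v (elems 5 s)" "\<not> arr (den prep_cmd s) 3 n"
    "reps (den prep_cmd s) 11 5 (\<lambda>_. 0)" "reps (den prep_cmd s) 12 5 (\<lambda>_. first n (\<lambda>q. q \<in> insert v (elems 5 s)))"
    using y unfolding A_def[symmetric] y_def[symmetric] by (auto simp: I_def reps_def elems_def)
qed

lemma prep_cmd_frame:
  "z \<notin> {9, 11} \<Longrightarrow> cnt (den prep_cmd s) z = cnt s z"
  "a \<notin> {3, 5, 11, 12} \<Longrightarrow> arr (den prep_cmd s) a = arr s a"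
  by (rule cnt_den, simp add: prep_cmd_def) (rule arr_den, simp add: prep_cmd_def)

text \<open>\<open>R\<close>, the affected players, gives the rows of both strings and also the
  digits of the parents. \<open>L\<close> gives the digits of the stages.\<close>

definition search_inv :: "nat \<Rightarrow> (nat \<Rightarrow> nat \<Rightarrow> bool) \<Rightarrow> nat \<Rightarrow> nat set \<Rightarrow> (nat \<Rightarrow> bool) \<Rightarrow> (nat \<Rightarrow> bool) \<Rightarrow>
    (nat \<Rightarrow> nat) \<Rightarrow> (nat \<Rightarrow> nat) \<Rightarrow> store \<Rightarrow> bool" where
  "search_inv n D v A R L st pr u \<longleftrightarrow> Env n D v A st pr u \<and> arr u 5 = R \<and> arr u 13 = L \<and> \<not> arr u 3 n \<and> \<not> arr u 17 n"

lemma search_accept: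
  assumes search_inv: "search_inv n D v A R L st pr u"
  shows "accepts n D v A st pr \<Longrightarrow> arr (den search_body u) 3 n \<and> arr (den search_body u) 17 n"
    and "\<not> accepts n D v A st pr \<Longrightarrow> den search_body u = den (Seq (odo_cmd 12 5 5) (If (B1 9 0)
       (Seq (odo_cmd 11 5 13) (If (B1 9 0) (Put 3 0 True) Skip)) Skip)) (den check_cmd u) \<and>
       search_inv n D v A R L st pr (den check_cmd u)"
proof -
  have E: "Env n D v A st pr u" using search_inv by (simp add: search_inv_def)
  define w where "w = den check_cmd u"
  have w0: "cnt w 0 = n" using check_cmd_frame(1)[of 0 u] E by (simp add: w_def Env_def)
  have "(elems 14 w, arr w 16 n) = chk n D v A st pr n" using den_check_cmd[OF E] by (simp add: w_def)
  then have acc: "accepts n D v A st pr \<longleftrightarrow> arr w 16 n \<and> {..<n} \<subseteq> elems 14 w" unfolding accepts_def by (metis fst_conv snd_conv)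
  have sm: "sem (Con (B1 16 0) (Neg (Ex 30 (Neg (B1 14 30))))) w \<longleftrightarrow> accepts n D v A st pr"
    using acc sem_full[of w] w0 by simp
  show "arr (den search_body u) 3 n \<and> arr (den search_body u) 17 n" if "accepts n D v A st pr"
  proof -
    have "den search_body u = den (Seq (Put 17 0 True) (Put 3 0 True)) w"
      unfolding search_body_def den.simps(5,6) w_def[symmetric] using sm that by (simp only: if_True simp_thms)
    then show ?thesis using w0 by simp
  qed
  assume na: "\<not> accepts n D v A st pr"
  have "Env n D v A st pr w" unfolding w_def by (rule Env_frame[OF E]) (use check_cmd_frame in auto)
  then have "search_inv n D v A R L st pr w" using search_inv check_cmd_frame(2)[of _ u] unfolding search_inv_def w_def by auto
  moreover have "den search_body u = den (Seq (odo_cmd 12 5 5) (If (B1 9 0)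
       (Seq (odo_cmd 11 5 13) (If (B1 9 0) (Put 3 0 True) Skip)) Skip)) w"
    unfolding search_body_def den.simps(5) den.simps(6)[of "Con (B1 16 0) (Neg (Ex 30 (Neg (B1 14 30))))"] w_def[symmetric]
    using sm na by (simp only: if_False simp_thms)
  ultimately show "den search_body u = den (Seq (odo_cmd 12 5 5) (If (B1 9 0)
       (Seq (odo_cmd 11 5 13) (If (B1 9 0) (Put 3 0 True) Skip)) Skip)) (den check_cmd u) \<and>
       search_inv n D v A R L st pr (den check_cmd u)" by (simp add: w_def)
qed

lemma search_reject:
  assumes search_inv: "search_inv n D v A R L st pr u" and na: "\<not> accepts n D v A st pr"
    and ex: "\<exists>q<n. R q" "\<exists>q<n. L q"
  shows "\<not> snd (odo n R R n pr) \<Longrightarrow> search_inv n D v A R L st (fst (odo n R R n pr)) (den search_body u)"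
    and "snd (odo n R R n pr) \<Longrightarrow> \<not> snd (odo n R L n st) \<Longrightarrow>
      search_inv n D v A R L (fst (odo n R L n st)) (fst (odo n R R n pr)) (den search_body u)"
    and "snd (odo n R R n pr) \<Longrightarrow> snd (odo n R L n st) \<Longrightarrow> arr (den search_body u) 3 n \<and> \<not> arr (den search_body u) 17 n"
proof -
  define w where "w = den check_cmd u"
  have d: "den search_body u = den (Seq (odo_cmd 12 5 5) (If (B1 9 0)
       (Seq (odo_cmd 11 5 13) (If (B1 9 0) (Put 3 0 True) Skip)) Skip)) w" and w: "search_inv n D v A R L st pr w"
    using search_accept(2)[OF search_inv na] by (auto simp: w_def)
  have w': "cnt w 0 = n" "cnt w 4 = v" "v < n" "rel 0 w = D" "elems 5 w = A" "reps w 11 5 st" "reps w 12 5 pr"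
    "arr w 5 = R" "arr w 13 = L" "\<not> arr w 3 n" "\<not> arr w 17 n" using w by (auto simp: search_inv_def Env_def)
  define y where "y = den (odo_cmd 12 5 5) w"
  have yc: "cnt y z = cnt w z" if "z \<notin> {9, 10, 11}" for z using odo_cmd_frame(1)[OF that] by (simp add: y_def)
  have ya: "arr y a = arr w a" if "a \<notin> {9, 12}" for a using odo_cmd_frame(2)[OF that] by (simp add: y_def)
  have y: "reps y 12 5 (fst (odo n R R n pr))" "arr y 9 n = snd (odo n R R n pr)"
    using den_odo[of 12 5 5 w pr] ex w' by (auto simp: y_def)
  have y0: "cnt y 0 = n" "cnt y 4 = v" using yc w' by auto
  have y11: "reps y 11 5 st" using w' yc[of 0] ya elems_frame[of y w 5] rel_frame[of y w 11] by (simp add: reps_def)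
  have SIy: "search_inv n D v A R L st (fst (odo n R R n pr)) y"
    using w' y(1) y0 y11 ya rel_frame[of y w 0] elems_frame[of y w 5] yc[of 0] by (simp add: search_inv_def Env_def)
  show "search_inv n D v A R L st (fst (odo n R R n pr)) (den search_body u)" if "\<not> snd (odo n R R n pr)"
  proof -
    have "den search_body u = y" using d that y(2) y0 unfolding den.simps(5,6) y_def[symmetric] by simp
    then show ?thesis using SIy by simp
  qed
  assume c: "snd (odo n R R n pr)"
  define x where "x = den (odo_cmd 11 5 13) y"
  have d2: "den search_body u = den (If (B1 9 0) (Put 3 0 True) Skip) x"
    using d c y(2) y0 unfolding den.simps(5) y_def[symmetric] den.simps(6)[of "B1 9 0" "Seq _ _"] x_def[symmetric] by simp
  have xc: "cnt x z = cnt y z" if "z \<notin> {9, 10, 11}" for z using odo_cmd_frame(1)[OF that] by (simp add: x_def)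
  have xa: "arr x a = arr y a" if "a \<notin> {9, 11}" for a using odo_cmd_frame(2)[OF that] by (simp add: x_def)
  have x: "reps x 11 5 (fst (odo n R L n st))" "arr x 9 n = snd (odo n R L n st)"
    using den_odo[of 11 5 13 y st] ex w' y0 y11 ya by (auto simp: x_def)
  have x0: "cnt x 0 = n" "cnt x 4 = v" using xc y0 by auto
  have x12: "reps x 12 5 (fst (odo n R R n pr))"
    using y(1) xc[of 0] xa elems_frame[of x y 5] rel_frame[of x y 12] by (simp add: reps_def)
  have SIx: "search_inv n D v A R L (fst (odo n R L n st)) (fst (odo n R R n pr)) x"
    using SIy x(1) x0 x12 xa rel_frame[of x y 0] elems_frame[of x y 5] xc[of 0] by (simp add: search_inv_def Env_def)
  show "search_inv n D v A R L (fst (odo n R L n st)) (fst (odo n R R n pr)) (den search_body u)" if "\<not> snd (odo n R L n st)"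
    using d2 that x(2) x0 SIx by simp
  show "arr (den search_body u) 3 n \<and> \<not> arr (den search_body u) 17 n" if "snd (odo n R L n st)"
    using d2 that x(2) x0 SIx by (simp add: search_inv_def)
qed

text \<open>The loop stops either at an accepted guess, where soundness of the check applies, or
  after all guesses, where completeness excludes a winning seeding.\<close>

lemma search_phase:
  assumes T: "tournament n D" and n: "n = 2 ^ m" and v: "v < n" "v \<in> A" and ord: "ordered n D A r"
    and SI0: "search_inv n D v A R L (\<lambda>_. 0) (\<lambda>_. first n R) s" and L: "\<And>q. q < n \<Longrightarrow> L q \<longleftrightarrow> q \<le> m"
  shows "\<exists>k\<le>card A ^ card A * (m + 1) ^ card A. \<exists>s'. s' = (den search_body ^^ k) s \<and>
    (\<forall>j<k. \<not> arr ((den search_body ^^ j) s) 3 n) \<and> arr s' 3 n \<and> (arr s' 17 n \<longleftrightarrow> TFP m n D v)"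
proof -
  let ?S = "\<lambda>j. (den search_body ^^ j) s"
  have RA: "R q \<longleftrightarrow> q \<in> A" if "q < n" for q using SI0 that by (auto simp: search_inv_def Env_def elems_def)
  have AV: "A \<subseteq> {..<n}" using SI0 by (auto simp: search_inv_def Env_def elems_def)
  have ex: "\<exists>q<n. R q" "\<exists>q<n. L q" using v RA L by (auto intro: exI[of _ v] exI[of _ 0])
  have mn: "m < n" using n less_exp by simp
  have RQ: "{q. q < n \<and> R q} = A" using RA AV by auto
  have LQ: "{q. q < n \<and> L q} = {..m}" using L mn by auto
  have cards: "radix n R = card A" "row_count R n = card A" "radix n L = m + 1" using RQ LQ by (auto simp: radix_def row_count_def)
  define B where "B = card A ^ card A"
  define M where "M = B * (m + 1) ^ card A"
  \<comment> \<open>The two ranks combine to one number, with the parents as the low part of size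
    \<open>B\<close>, and this number is the index of the round.\<close>
  define Inv where "Inv = (\<lambda>j st pr. search_inv n D v A R L st pr (?S j) \<and> valid n R L st \<and> valid n R R pr \<and>
    rank n R R n pr + B * rank n R L n st = j)"
  have I0: "Inv 0 (\<lambda>_. 0) (\<lambda>_. first n R)"
  proof -
    have "rank n R R i (\<lambda>_. first n R) = 0" for i by (induction i) (auto simp: digit_index_first)
    moreover have "rank n R L i (\<lambda>_. 0) = 0" for i by (induction i) (auto simp: digit_index_def)
    moreover have "0 < n" using v by simp
    ultimately show ?thesis using SI0 L first_X[OF ex(1)] by (auto simp: Inv_def valid_def)
  qed
  have rkb: "rank n R R n pr < B" if "valid n R R pr" for pr using rank_less[OF that order_refl] cards by (simp add: B_def)
  have rkb': "rank n R L n st < (m + 1) ^ card A" if "valid n R L st" for st using rank_less[OF that order_refl] cards by simp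
  have lt: "j < M" if "Inv j st pr" for j st pr
  proof -
    have "rank n R R n pr < B" "rank n R L n st + 1 \<le> (m + 1) ^ card A" using that rkb rkb' by (auto simp: Inv_def Suc_le_eq)
    moreover from this(2) have "B * (rank n R L n st + 1) \<le> M" unfolding M_def by (rule mult_le_mono2)
    ultimately show ?thesis using that by (simp add: Inv_def)
  qed
  have acc: "arr (?S (Suc j)) 3 n \<and> arr (?S (Suc j)) 17 n" if "Inv j st pr" "accepts n D v A st pr" for j st pr
    using search_accept(1)[of n D v A R L st pr "?S j"] that by (simp add: Inv_def)
  have rej: "(\<exists>st pr. Inv (Suc j) st pr) \<or> arr (?S (Suc j)) 3 n \<and> \<not> arr (?S (Suc j)) 17 n \<and> Suc j = M"
    if I: "Inv j st pr" and na: "\<not> accepts n D v A st pr" for j st pr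
  proof -
    have search_inv: "search_inv n D v A R L st pr (?S j)" and val: "valid n R L st" "valid n R R pr"
      and j: "rank n R R n pr + B * rank n R L n st = j" using I by (auto simp: Inv_def)
    obtain pr' c where p: "odo n R R n pr = (pr', c)" by (cases "odo n R R n pr") auto
    obtain st' c' where q: "odo n R L n st = (st', c')" by (cases "odo n R L n st") auto
    have val': "valid n R R pr'" "valid n R L st'" using odo_valid[OF ex(1) val(2), of n] odo_valid[OF ex(2) val(1), of n] p q by auto
    have rp: "if c then rank n R R n pr' = 0 \<and> rank n R R n pr + 1 = B else rank n R R n pr' = rank n R R n pr + 1"
      using odo_rank[OF ex(1) val(2) order_refl] p cards by (auto simp: B_def split: if_splits)
    have rq: "if c' then rank n R L n st' = 0 \<and> rank n R L n st + 1 = (m + 1) ^ card A else rank n R L n st' = rank n R L n st + 1"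
      using odo_rank[OF ex(2) val(1) order_refl] q cards by (auto split: if_splits)
    note s = search_reject[OF search_inv na ex, unfolded p q fst_conv snd_conv]
    consider "\<not> c" | "c" "\<not> c'" | "c" "c'" by blast
    then show ?thesis
    proof cases
      case 1
      then have "Inv (Suc j) st pr'" using s(1) val val' rp j by (simp add: Inv_def)
      then show ?thesis by blast
    next
      case 2
      then have "Inv (Suc j) st' pr'" using s(2) val val' rp rq j by (simp add: Inv_def)
      then show ?thesis by blast
    next
      case 3
      have "Suc j = B * (rank n R L n st + 1)" using rp 3 j by simp
      also have "rank n R L n st + 1 = (m + 1) ^ card A" using rq 3 by presburger
      finally have "Suc j = M" by (simp only: M_def)
      moreover have "?S (Suc j) = den search_body (?S j)" by simp
      ultimately show ?thesis using s(3)[OF 3] by metis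
    qed
  qed
  have nd: "\<not> arr (?S j) 3 n" if "Inv j st pr" for j st pr using that by (simp add: Inv_def search_inv_def)
  have all: "\<exists>st pr. Inv j st pr" if "\<And>i. i \<le> j \<Longrightarrow> \<not> arr (?S i) 3 n" for j using that
  proof (induction j)
    case 0
    then show ?case using I0 by blast
  next
    case (Suc j)
    then obtain st pr where "Inv j st pr" by auto
    then show ?case using acc[of j st pr] rej[of j st pr] Suc.prems[of "Suc j"] by blast
  qed
  have exk: "\<exists>k. arr (?S k) 3 n" using all[of M] lt by blast
  define k where "k = (LEAST k. arr (?S k) 3 n)"
  have kd: "arr (?S k) 3 n" unfolding k_def using exk by (rule LeastI_ex)
  have kn: "\<not> arr (?S j) 3 n" if "j < k" for j using that not_less_Least unfolding k_def by blast
  have "k \<noteq> 0" using kd nd[OF I0] by metis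
  then obtain k' where k': "k = Suc k'" using not0_implies_Suc by blast
  obtain st pr where I: "Inv k' st pr" using all[of k'] kn k' by auto
  have "k \<le> M" using lt[OF I] k' by simp
  moreover have "arr (?S k) 17 n \<longleftrightarrow> TFP m n D v"
  proof (cases "accepts n D v A st pr")
    case True
    then show ?thesis using acc[OF I True] k' accepts_sound[OF v(1) n True] by simp
  next
    case False
    have kM: "k = M" "\<not> arr (?S k) 17 n" using rej[OF I False] nd[of k] kd k' by auto
    moreover have "\<not> TFP m n D v"
    proof
      assume "TFP m n D v"
      from TFP_imp_accepts[OF T v AV n ord this] obtain st' pr' where
        b: "\<forall>a\<in>A. st' a \<le> m \<and> pr' a \<in> A" and a': "accepts n D v A st' pr'" by blast
      have "st' a < n \<and> L (st' a) \<and> pr' a < n \<and> R (pr' a)" if "a < n" "R a" for a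
      proof -
        have "a \<in> A" using that RA by blast
        then have "st' a \<le> m" "pr' a \<in> A" using b by auto
        then show ?thesis using mn L RA AV by auto
      qed
      then have v': "valid n R L st'" "valid n R R pr'" by (auto simp: valid_def)
      \<comment> \<open>The index of the round in which the accepting guess comes up. The search
        would have stopped there with array 17 set.\<close>
      define j where "j = rank n R R n pr' + B * rank n R L n st'"
      have jM: "j < M"
      proof -
        have "rank n R R n pr' < B" "rank n R L n st' + 1 \<le> (m + 1) ^ card A" using v' rkb rkb' by (auto simp: Suc_le_eq)
        moreover from this(2) have "B * (rank n R L n st' + 1) \<le> M" unfolding M_def by (rule mult_le_mono2)
        ultimately show ?thesis by (simp add: j_def)
      qed
      then obtain st1 pr1 where I1: "Inv j st1 pr1" using all[of j] kn kM by auto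
      have v1: "valid n R L st1" "valid n R R pr1" and e: "rank n R R n pr1 + B * rank n R L n st1 = rank n R R n pr' + B * rank n R L n st'"
        using I1 by (auto simp: Inv_def j_def)
      have l: "rank n R R n pr1 < B" "rank n R R n pr' < B" using rkb v1 v' by auto
      have "(rank n R R n pr1 + B * rank n R L n st1) div B = (rank n R R n pr' + B * rank n R L n st') div B" using e by simp
      then have e2: "rank n R L n st1 = rank n R L n st'" using l by simp
      then have e1: "rank n R R n pr1 = rank n R R n pr'" using e by simp
      have "st1 a = st' a \<and> pr1 a = pr' a" if "a \<in> A" for a
        using rank_inj[OF v1(1) v'(1) order_refl e2] rank_inj[OF v1(2) v'(2) order_refl e1] that AV RA by auto
      then have "accepts n D v A st1 pr1" using a' accepts_cong by metis
      from acc[OF I1 this] have ac: "arr (?S (Suc j)) 3 n" "arr (?S (Suc j)) 17 n" by auto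
      then have "Suc j = k" using kn[of "Suc j"] jM kM by (metis Suc_lessI)
      then show False using ac kM by simp
    qed
    ultimately show ?thesis by simp
  qed
  ultimately show ?thesis using kd kn unfolding M_def B_def by blast
qed

section \<open>Reading the input\<close>

lemma nth_concat_blocks:
  "i < k \<Longrightarrow> j < n \<Longrightarrow> concat (map (\<lambda>i. map (g i) [0..<n]) [0..<k]) ! (i * n + j) = g i j"
proof (induction k)
  case (Suc k)
  have len: "length (concat (map (\<lambda>i. map (g i) [0..<n]) [0..<k])) = k * n" for k
    by (induction k) (auto simp: length_concat)
  show ?case
  proof (cases "i < k")
    case True
    have "i * n + j < (i + 1) * n" using Suc.prems by simp
    also have "\<dots> \<le> k * n" using True by (intro mult_le_mono1) simp
    finally show ?thesis using Suc True len[of k] by (simp add: nth_append)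
  next
    case False
    then have "i = k" using Suc.prems by simp
    then show ?thesis using Suc.prems len[of k] by (simp add: nth_append)
  qed
qed simp

lemma length_concat_blocks: "length (concat (map (\<lambda>i. map (g i) [0..<n]) [0..<k])) = k * n"
  by (induction k) (auto simp: length_concat)

lemma encode_nth:
  "i < n \<Longrightarrow> j < n \<Longrightarrow> encode n D v ! (i * n + j) = (if D i j then 1 else 2)"
  "encode n D v ! (n * n) = 3"
  "t < v \<Longrightarrow> encode n D v ! (n * n + 1 + t) = 1"
  "length (encode n D v) = n * n + 1 + v"
proof -
  let ?c = "concat (map (\<lambda>i. map (\<lambda>j. if D i j then 1 else 2 :: nat) [0..<n]) [0..<n])"
  have e: "encode n D v = ?c @ [3] @ replicate v 1" by (simp add: encode_def)
  have len: "length ?c = n * n" by (rule length_concat_blocks)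
  show "length (encode n D v) = n * n + 1 + v" unfolding e using len by simp
  show "encode n D v ! (n * n) = 3" unfolding e using len by (simp add: nth_append)
  show "encode n D v ! (n * n + 1 + t) = 1" if "t < v" unfolding e using len that by (simp add: nth_append)
  show "encode n D v ! (i * n + j) = (if D i j then 1 else 2)" if ij: "i < n" "j < n"
  proof -
    have "i * n + j < (i + 1) * n" using ij by simp
    also have "\<dots> \<le> n * n" using ij by (intro mult_le_mono1) simp
    finally have "i * n + j < length ?c" using len by simp
    then show ?thesis unfolding e nth_append using nth_concat_blocks[OF ij, of "\<lambda>i j. if D i j then 1 else 2"] by simp
  qed
qed

lemma set_encode: "set (encode n D v) \<subseteq> {1, 2, 3}"
  by (auto simp: encode_def)

text \<open>The symbol 1 sets bit 0, the symbol 2 bit 1, and the symbol 3 both. Hence array 0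
  already contains \<open>D\<close> in row-major order, and the separator is the first cell with
  both bits set.\<close>

lemma init_store_encode:
  fixes n v :: nat and D
  defines "s \<equiv> init_store (encode n D v)"
  shows "\<And>p. p < n * n \<Longrightarrow> \<not> (arr s 0 p \<and> arr s 1 p)"
    "arr s 0 (n * n)" "arr s 1 (n * n)" "\<And>t. t < v \<Longrightarrow> arr s 0 (n * n + 1 + t)" "\<not> arr s 0 (n * n + 1 + v)"
    "\<And>i j. i < n \<Longrightarrow> j < n \<Longrightarrow> arr s 0 (i * n + j) \<longleftrightarrow> D i j"
    "\<And>a. a \<notin> {0, 1} \<Longrightarrow> arr s a = (\<lambda>_. False)" "cnt s = (\<lambda>_. 0)"
proof -
  note e = encode_nth[where n = n and D = D and v = v]
  have b: "\<not> bit (2::nat) 0" "bit (1::nat) 0" "\<not> bit (1::nat) 1" "bit (3::nat) 0" "bit (3::nat) 1"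
    by (simp_all add: bit_iff_odd)
  have lt: "i * n + j < n * n" if "i < n" "j < n" for i j
  proof -
    have "i * n + j < (i + 1) * n" using that by simp
    also have "\<dots> \<le> n * n" using that by (intro mult_le_mono1) simp
    finally show ?thesis .
  qed
  show 6: "arr s 0 (i * n + j) \<longleftrightarrow> D i j" if "i < n" "j < n" for i j
    using e(1)[OF that] e(4) lt[OF that] b by (simp add: s_def init_store_def)
  show "arr s 0 (n * n)" "arr s 1 (n * n)" "cnt s = (\<lambda>_. 0)" using e b by (auto simp: s_def init_store_def)
  show "arr s 0 (n * n + 1 + t)" if "t < v" for t using e(3)[OF that] e(4) that b by (simp add: s_def init_store_def)
  show "\<not> arr s 0 (n * n + 1 + v)" using e(4) by (simp add: s_def init_store_def)
  show "\<not> (arr s 0 p \<and> arr s 1 p)" if p: "p < n * n" for p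
  proof -
    have "0 < n" using p by (cases n) auto
    then have ij: "p div n < n" "p mod n < n" "p = p div n * n + p mod n" using p by (auto simp: less_mult_imp_div_less)
    have "encode n D v ! p = (if D (p div n) (p mod n) then 1 else 2)" using e(1)[OF ij(1,2)] ij(3) by simp
    then show ?thesis using b by (auto simp: s_def init_store_def)
  qed
  show "arr s a = (\<lambda>_. False)" if "a \<notin> {0, 1}" for a
  proof
    fix p
    have "\<not> bit (encode n D v ! p) a" if p: "p < length (encode n D v)"
    proof -
      have "encode n D v ! p \<in> {1, 2, 3}" using set_encode nth_mem[OF p] by blast
      then have "encode n D v ! p < 2 ^ 2" by auto
      moreover have "2 \<le> a" using \<open>a \<notin> {0, 1}\<close> by auto
      ultimately show ?thesis unfolding less_exp_iff by blast
    qed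
    then show "arr s a p = False" by (auto simp: s_def init_store_def)
  qed
qed

text \<open>The input shows \<open>n * n\<close>, the position of the separator, but not
  \<open>n\<close>. Candidates are counted up in counter 0, and their squares, built by repeated
  addition in counter 6, are compared with that position. While the separator is sought, counter 0
  is still 0, so the exit bit stands at index 0.\<close>

definition read_n :: com where
  "read_n = Loop (Test 0 (Arr 3) False) (Cond (Test 5 (Arr 0) True)
       (Cond (Test 5 (Arr 1) True) (Do (Write 3 0 True)) (Do (Inc 5))) (Do (Inc 5))) ;;
     Do (Write 3 0 False) ;;
     Loop (Test 6 (Cnt 5) False) (Do (Inc 0) ;; Do (Zero 6) ;; Do (Zero 7) ;;
       Loop (Test 7 (Cnt 0) False) (addloop 8 6 0 ;; Do (Inc 7)))"

definition read_v :: com where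
  "read_v = Do (Inc 5) ;; Loop (Test 5 (Arr 0) True) (Do (Inc 5) ;; Do (Inc 4))"

text \<open>Array 13 becomes the set of possible stages. Its largest element is the number of
  doublings that lead from 1 to \<open>n\<close>.\<close>

definition mark_stages :: com where
  "mark_stages = Do (Zero 6) ;; Do (Inc 6) ;; Do (Zero 7) ;; Do (Write 13 7 True) ;;
     Loop (Test 6 (Cnt 0) False) (Do (Inc 7) ;; Do (Write 13 7 True) ;; Do (Zero 8) ;; addloop 9 8 6 ;; addloop 9 6 8)"

definition read_input :: com where
  "read_input = read_n ;; read_v ;; mark_stages ;; Do (Zero 5) ;; Do (Zero 6) ;; Do (Zero 7) ;; Do (Zero 8) ;; Do (Zero 9)"

lemma runs_read_n:
  assumes c: "cnt s = (\<lambda>_. 0)" and p: "\<And>p. p < n * n \<Longrightarrow> \<not> (arr s 0 p \<and> arr s 1 p)" "arr s 0 (n * n)" "arr s 1 (n * n)"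
    and a3: "arr s 3 = (\<lambda>_. False)"
  shows "\<exists>s'. runs read_n s ((n * n + 1) * 5 + n * (n * (n * 5 + 7) + 9) + 5) s' \<and> cnt s' 0 = n \<and> cnt s' 5 = n * n \<and>
    (\<forall>z. z \<notin> {0, 5, 6, 7, 8} \<longrightarrow> cnt s' z = 0) \<and> arr s' = arr s"
proof -
  let ?b1 = "Cond (Test 5 (Arr 0) True) (Cond (Test 5 (Arr 1) True) (Do (Write 3 0 True)) (Do (Inc 5))) (Do (Inc 5))"
  \<comment> \<open>The last of the \<open>n * n + 1\<close> rounds stays on the separator and sets
    the exit bit, hence the minimum.\<close>
  define I where "I = (\<lambda>j (u::store). cnt u 5 = min j (n * n) \<and> (\<forall>z. z \<noteq> 5 \<longrightarrow> cnt u z = 0) \<and>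
    arr u = (arr s)(3 := (\<lambda>q. q = 0 \<and> j = n * n + 1)))"
  have "\<exists>s'. runs (Loop (Test 0 (Arr 3) False) ?b1) s ((n * n + 1) * (3 + 2) + 1) s' \<and> I (n * n + 1) s'"
  proof (rule runs_Loop)
    show "I 0 s" using c a3 by (auto simp: I_def fun_eq_iff)
  next
    fix u assume "I (n * n + 1) u"
    then show "\<not> res (Test 0 (Arr 3) False) u \<and> eff (Test 0 (Arr 3) False) u = u" by (simp add: I_def)
  next
    fix j u assume j: "j < n * n + 1" and I: "I j u"
    have u: "cnt u 5 = j" "cnt u 0 = 0" "\<And>a. a \<noteq> 3 \<Longrightarrow> arr u a = arr s a" "arr u 3 = (\<lambda>_. False)"
      using I j by (auto simp: I_def)
    define i where "i = (if arr s 0 j \<and> arr s 1 j then Write 3 0 True else Inc 5)"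
    have r1: "runs (Do i) u 1 (eff i u)" by (rule runs_Do)
    have "runs ?b1 u 3 (eff i u)"
    proof (cases "arr s 0 j")
      case True
      have "runs (Cond (Test 5 (Arr 1) True) (Do (Write 3 0 True)) (Do (Inc 5))) u (1 + 1) (eff i u)"
        by (rule runs_Cond) (use r1 u True in \<open>auto simp: i_def\<close>)
      then have "runs ?b1 u (1 + 1 + 1) (eff i u)" by (intro runs_Cond) (use u True in auto)
      then show ?thesis by (simp add: numeral_eq_Suc)
    next
      case False
      have "runs ?b1 u (1 + 1) (eff i u)" by (rule runs_Cond) (use r1 u False in \<open>auto simp: i_def\<close>)
      then show ?thesis by (rule runs_mono) simp
    qed
    moreover have "I (Suc j) (eff i u)"
    proof (cases "j = n * n")
      case True
      then have "i = Write 3 0 True" using p by (simp add: i_def)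
      then show ?thesis using I True by (auto simp: I_def fun_eq_iff)
    next
      case False
      then have "i = Inc 5" using p j by (auto simp: i_def)
      then show ?thesis using I False j by (auto simp: I_def fun_eq_iff)
    qed
    ultimately show "res (Test 0 (Arr 3) False) u \<and> eff (Test 0 (Arr 3) False) u = u \<and> (\<exists>s'. runs ?b1 u 3 s' \<and> I (Suc j) s')"
      using u by auto
  qed
  then obtain s1 where s1: "runs (Loop (Test 0 (Arr 3) False) ?b1) s ((n * n + 1) * (3 + 2) + 1) s1" "I (n * n + 1) s1" by blast
  define s2 where "s2 = eff (Write 3 0 False) s1"
  have r2: "runs (Do (Write 3 0 False)) s1 1 s2" unfolding s2_def by (rule runs_Do)
  have s2: "cnt s2 5 = n * n" "\<And>z. z \<noteq> 5 \<Longrightarrow> cnt s2 z = 0" "arr s2 = arr s"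
    using s1(2) a3 by (auto simp: s2_def I_def fun_eq_iff)
  let ?i = "Loop (Test 7 (Cnt 0) False) (addloop 8 6 0 ;; Do (Inc 7))"
  let ?b2 = "Do (Inc 0) ;; Do (Zero 6) ;; Do (Zero 7) ;; ?i"
  define J where "J = (\<lambda>j (u::store). cnt u 0 = j \<and> cnt u 5 = n * n \<and> cnt u 6 = j * j \<and>
    (\<forall>z. z \<notin> {0, 5, 6, 7, 8} \<longrightarrow> cnt u z = 0) \<and> arr u = arr s)"
  have "\<exists>s'. runs (Loop (Test 6 (Cnt 5) False) ?b2) s2 (n * ((n * (n * 5 + 7) + 7) + 2) + 1) s' \<and> J n s'"
  proof (rule runs_Loop)
    show "J 0 s2" using s2 by (simp add: J_def)
  next
    fix u assume "J n u"
    then show "\<not> res (Test 6 (Cnt 5) False) u \<and> eff (Test 6 (Cnt 5) False) u = u" by (simp add: J_def)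
  next
    fix j u assume j: "j < n" and J: "J j u"
    have jj: "j * j \<noteq> n * n" using j by (metis less_irrefl mult_strict_mono' zero_le)
    define u1 where "u1 = eff (Zero 7) (eff (Zero 6) (eff (Inc 0) u))"
    define K where "K = (\<lambda>i (w::store). cnt w 0 = Suc j \<and> cnt w 5 = n * n \<and> cnt w 6 = i * Suc j \<and> cnt w 7 = i \<and>
      (\<forall>z. z \<notin> {0, 5, 6, 7, 8} \<longrightarrow> cnt w z = 0) \<and> arr w = arr s)"
    have "\<exists>w. runs ?i u1 (Suc j * ((n * 5 + 5) + 2) + 1) w \<and> K (Suc j) w"
    proof (rule runs_Loop)
      show "K 0 u1" using J by (simp add: K_def J_def u1_def)
    next
      fix w assume "K (Suc j) w"
      then show "\<not> res (Test 7 (Cnt 0) False) w \<and> eff (Test 7 (Cnt 0) False) w = w" by (simp add: K_def)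
    next
      fix i w assume i: "i < Suc j" and K: "K i w"
      obtain x where x: "runs (addloop 8 6 0) w (cnt w 0 * 5 + 3) x"
        "cnt x = (cnt w)(8 := cnt w 0, 6 := cnt w 6 + cnt w 0)" "arr x = arr w"
        using runs_addloop[of 8 6 0 w] by auto
      have "runs (addloop 8 6 0 ;; Do (Inc 7)) w ((cnt w 0 * 5 + 3) + 1 + 1) (eff (Inc 7) x)"
        by (rule runs_Then[OF x(1) runs_Do])
      then have "runs (addloop 8 6 0 ;; Do (Inc 7)) w (n * 5 + 5) (eff (Inc 7) x)"
        by (rule runs_mono) (use K j in \<open>simp add: K_def\<close>)
      moreover have "K (Suc i) (eff (Inc 7) x)" using K x by (auto simp: K_def)
      ultimately show "res (Test 7 (Cnt 0) False) w \<and> eff (Test 7 (Cnt 0) False) w = w \<and>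
         (\<exists>s'. runs (addloop 8 6 0 ;; Do (Inc 7)) w (n * 5 + 5) s' \<and> K (Suc i) s')" using K i by (auto simp: K_def)
    qed
    then obtain w where w: "runs ?i u1 (Suc j * ((n * 5 + 5) + 2) + 1) w" "K (Suc j) w" by blast
    have "runs ?b2 u (1 + (1 + (1 + (Suc j * ((n * 5 + 5) + 2) + 1) + 1) + 1) + 1) w"
      by (rule runs_Then[OF runs_Do runs_Then[OF runs_Do runs_Then[OF runs_Do]]]) (use w(1) in \<open>simp only: u1_def\<close>)
    then have "runs ?b2 u (n * (n * 5 + 7) + 7) w"
    proof (rule runs_mono)
      have "Suc j * (n * 5 + 7) \<le> n * (n * 5 + 7)" using j by (intro mult_le_mono1) simp
      then show "1 + (1 + (1 + (Suc j * ((n * 5 + 5) + 2) + 1) + 1) + 1) + 1 \<le> n * (n * 5 + 7) + 7"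
        by (simp only: add.assoc) simp
    qed
    moreover have "J (Suc j) w" using w(2) by (auto simp: K_def J_def)
    ultimately show "res (Test 6 (Cnt 5) False) u \<and> eff (Test 6 (Cnt 5) False) u = u \<and>
      (\<exists>s'. runs ?b2 u (n * (n * 5 + 7) + 7) s' \<and> J (Suc j) s')" using J jj by (auto simp: J_def)
  qed
  then obtain s3 where s3: "runs (Loop (Test 6 (Cnt 5) False) ?b2) s2 (n * ((n * (n * 5 + 7) + 7) + 2) + 1) s3" "J n s3" by blast
  have "runs read_n s (((n * n + 1) * (3 + 2) + 1) + (1 + (n * ((n * (n * 5 + 7) + 7) + 2) + 1) + 1) + 1) s3"
    unfolding read_n_def by (rule runs_Then[OF s1(1) runs_Then[OF r2 s3(1)]])
  moreover have "((n * n + 1) * (3 + 2) + 1) + (1 + (n * ((n * (n * 5 + 7) + 7) + 2) + 1) + 1) + 1 =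
    (n * n + 1) * 5 + n * (n * (n * 5 + 7) + 9) + 5" by (simp add: add.assoc)
  ultimately have "runs read_n s ((n * n + 1) * 5 + n * (n * (n * 5 + 7) + 9) + 5) s3" by (simp only:)
  then show ?thesis using s3(2) unfolding J_def by blast
qed

lemma runs_read_v:
  assumes "cnt s 5 = k" "cnt s 4 = 0" "\<And>t. t < v \<Longrightarrow> arr s 0 (k + 1 + t)" "\<not> arr s 0 (k + 1 + v)"
  shows "\<exists>s'. runs read_v s (v * 5 + 3) s' \<and> cnt s' 4 = v \<and> (\<forall>z. z \<notin> {4, 5} \<longrightarrow> cnt s' z = cnt s z) \<and> arr s' = arr s"
proof -
  define I where "I = (\<lambda>j (u::store). cnt u 5 = k + 1 + j \<and> cnt u 4 = j \<and> (\<forall>z. z \<notin> {4, 5} \<longrightarrow> cnt u z = cnt s z) \<and> arr u = arr s)"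
  have "\<exists>s'. runs (Loop (Test 5 (Arr 0) True) (Do (Inc 5) ;; Do (Inc 4))) (eff (Inc 5) s) (v * (3 + 2) + 1) s' \<and> I v s'"
  proof (rule runs_Loop)
    show "I 0 (eff (Inc 5) s)" using assms by (simp add: I_def)
  next
    fix j u assume j: "j < v" "I j u"
    have "runs (Do (Inc 5) ;; Do (Inc 4)) u (1 + 1 + 1) (eff (Inc 4) (eff (Inc 5) u))"
      by (rule runs_Then[OF runs_Do runs_Do])
    moreover have "I (Suc j) (eff (Inc 4) (eff (Inc 5) u))" using j by (auto simp: I_def)
    ultimately show "res (Test 5 (Arr 0) True) u \<and> eff (Test 5 (Arr 0) True) u = u \<and>
      (\<exists>s'. runs (Do (Inc 5) ;; Do (Inc 4)) u 3 s' \<and> I (Suc j) s')"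
      using j assms(3)[OF j(1)] by (auto simp: I_def numeral_3_eq_3)
  qed (use assms(4) in \<open>simp add: I_def\<close>)
  then obtain s' where s': "runs (Loop (Test 5 (Arr 0) True) (Do (Inc 5) ;; Do (Inc 4))) (eff (Inc 5) s) (v * (3 + 2) + 1) s'" "I v s'"
    by blast
  have "runs read_v s (1 + (v * (3 + 2) + 1) + 1) s'" unfolding read_v_def by (rule runs_Then[OF runs_Do s'(1)])
  then have "runs read_v s (v * 5 + 3) s'" by (rule runs_mono) simp
  then show ?thesis using s'(2) by (auto simp: I_def)
qed

lemma runs_mark_stages:
  assumes n: "cnt s 0 = n" "n = 2 ^ m" and a: "arr s 13 = (\<lambda>_. False)"
  shows "\<exists>s'. runs mark_stages s (m * (n * 10 + 15) + 9) s' \<and> (\<forall>z. z \<notin> {6, 7, 8, 9} \<longrightarrow> cnt s' z = cnt s z) \<and>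
    arr s' = (arr s)(13 := (\<lambda>q. q \<le> m))"
proof -
  let ?b = "Do (Inc 7) ;; Do (Write 13 7 True) ;; Do (Zero 8) ;; addloop 9 8 6 ;; addloop 9 6 8"
  define s1 where "s1 = eff (Write 13 7 True) (eff (Zero 7) (eff (Inc 6) (eff (Zero 6) s)))"
  define I where "I = (\<lambda>j (u::store). cnt u 6 = 2 ^ j \<and> cnt u 7 = j \<and> (\<forall>z. z \<notin> {6, 7, 8, 9} \<longrightarrow> cnt u z = cnt s z) \<and>
    arr u = (arr s)(13 := (\<lambda>q. q \<le> j)))"
  have "\<exists>s'. runs (Loop (Test 6 (Cnt 0) False) ?b) s1 (m * ((n * 10 + 13) + 2) + 1) s' \<and> I m s'"
  proof (rule runs_Loop)
    show "I 0 s1" using a by (auto simp: I_def s1_def fun_eq_iff)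
  next
    fix j u assume j: "j < m" "I j u"
    have lt: "(2::nat) ^ j < n" using j(1) n(2) by (simp add: power_strict_increasing)
    define u1 where "u1 = eff (Zero 8) (eff (Write 13 7 True) (eff (Inc 7) u))"
    have c1: "cnt u1 6 = 2 ^ j" "cnt u1 8 = 0" using j by (auto simp: u1_def I_def)
    obtain u2 where u2: "runs (addloop 9 8 6) u1 (cnt u1 6 * 5 + 3) u2"
      "cnt u2 = (cnt u1)(9 := cnt u1 6, 8 := cnt u1 8 + cnt u1 6)" "arr u2 = arr u1" using runs_addloop[of 9 8 6 u1] by auto
    obtain u3 where u3: "runs (addloop 9 6 8) u2 (cnt u2 8 * 5 + 3) u3"
      "cnt u3 = (cnt u2)(9 := cnt u2 8, 6 := cnt u2 6 + cnt u2 8)" "arr u3 = arr u2" using runs_addloop[of 9 6 8 u2] by auto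
    have "runs ?b u (1 + (1 + (1 + ((cnt u1 6 * 5 + 3) + (cnt u2 8 * 5 + 3) + 1) + 1) + 1) + 1) u3"
      by (rule runs_Then[OF runs_Do runs_Then[OF runs_Do runs_Then[OF runs_Do runs_Then[OF _ u3(1)]]]]) (use u2(1) in \<open>simp only: u1_def\<close>)
    then have "runs ?b u (n * 10 + 13) u3" by (rule runs_mono) (use c1 u2(2) lt in simp)
    moreover have "I (Suc j) u3" using j(2) u2 u3 c1 by (auto simp: I_def u1_def fun_eq_iff le_Suc_eq)
    ultimately show "res (Test 6 (Cnt 0) False) u \<and> eff (Test 6 (Cnt 0) False) u = u \<and>
      (\<exists>s'. runs ?b u (n * 10 + 13) s' \<and> I (Suc j) s')" using j(2) lt n(1) by (auto simp: I_def)
  qed (use n in \<open>simp add: I_def\<close>)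
  then obtain s' where s': "runs (Loop (Test 6 (Cnt 0) False) ?b) s1 (m * ((n * 10 + 13) + 2) + 1) s'" "I m s'" by blast
  have "runs mark_stages s (1 + (1 + (1 + (1 + (m * ((n * 10 + 13) + 2) + 1) + 1) + 1) + 1) + 1) s'"
    unfolding mark_stages_def
    by (rule runs_Then[OF runs_Do runs_Then[OF runs_Do runs_Then[OF runs_Do runs_Then[OF runs_Do]]]]) (use s'(1) in \<open>simp only: s1_def\<close>)
  moreover have "1 + (1 + (1 + (1 + (m * ((n * 10 + 13) + 2) + 1) + 1) + 1) + 1) + 1 = m * (n * 10 + 15) + 9"
    by (simp only: add.assoc) simp
  ultimately have "runs mark_stages s (m * (n * 10 + 15) + 9) s'" by (simp only:)
  then show ?thesis using s'(2) unfolding I_def by blast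
qed

definition read_time :: "nat \<Rightarrow> nat" where
  "read_time n = ((n * n + 1) * 5 + n * (n * (n * 5 + 7) + 9) + 5) + (n * 5 + 3) + (n * (n * 10 + 15) + 9) + 20"

lemma runs_read_input:
  assumes n: "n = 2 ^ m" and v: "v < n"
  shows "\<exists>s'. runs read_input (init_store (encode n D v)) (read_time n) s' \<and>
    cnt s' = (\<lambda>z. if z = 0 then n else if z = 4 then v else 0) \<and>
    arr s' = (arr (init_store (encode n D v)))(13 := (\<lambda>q. q \<le> m))"
proof -
  define s where "s = init_store (encode n D v)"
  note e = init_store_encode[where n = n and D = D and v = v, folded s_def]
  obtain s1 where s1: "runs read_n s ((n * n + 1) * 5 + n * (n * (n * 5 + 7) + 9) + 5) s1" "cnt s1 0 = n" "cnt s1 5 = n * n"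
    "\<forall>z. z \<notin> {0, 5, 6, 7, 8} \<longrightarrow> cnt s1 z = 0" "arr s1 = arr s"
    using runs_read_n[OF e(8) e(1-3)] e(7)[of 3] by auto
  obtain s2 where s2: "runs read_v s1 (v * 5 + 3) s2" "cnt s2 4 = v" "\<forall>z. z \<notin> {4, 5} \<longrightarrow> cnt s2 z = cnt s1 z" "arr s2 = arr s1"
    using runs_read_v[OF s1(3), of v] s1(4,5) e(4,5) by auto
  have s20: "cnt s2 0 = n" using s2 s1 by simp
  obtain s3 where s3: "runs mark_stages s2 (m * (n * 10 + 15) + 9) s3" "\<forall>z. z \<notin> {6, 7, 8, 9} \<longrightarrow> cnt s3 z = cnt s2 z"
    "arr s3 = (arr s2)(13 := (\<lambda>q. q \<le> m))"
    using runs_mark_stages[OF s20 n] s2(4) s1(5) e(7)[of 13] by auto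
  define s4 where "s4 = eff (Zero 9) (eff (Zero 8) (eff (Zero 7) (eff (Zero 6) (eff (Zero 5) s3))))"
  have z: "runs (Do (Zero 5) ;; Do (Zero 6) ;; Do (Zero 7) ;; Do (Zero 8) ;; Do (Zero 9)) s3 (1 + (1 + (1 + (1 + 1 + 1) + 1) + 1) + 1) s4"
    unfolding s4_def
    by (rule runs_Then[OF runs_Do runs_Then[OF runs_Do runs_Then[OF runs_Do runs_Then[OF runs_Do runs_Do]]]])
  have "runs read_input s (((n * n + 1) * 5 + n * (n * (n * 5 + 7) + 9) + 5) + ((v * 5 + 3) + ((m * (n * 10 + 15) + 9) +
     (1 + (1 + (1 + (1 + 1 + 1) + 1) + 1) + 1) + 1) + 1) + 1) s4"
    unfolding read_input_def by (rule runs_Then[OF s1(1) runs_Then[OF s2(1) runs_Then[OF s3(1) z]]])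
  then have "runs read_input s (read_time n) s4"
  proof (rule runs_mono)
    have "m \<le> n" using n less_exp[of m] by simp
    then have "m * (n * 10 + 15) \<le> n * (n * 10 + 15)" by (rule mult_le_mono1)
    then show "((n * n + 1) * 5 + n * (n * (n * 5 + 7) + 9) + 5) + ((v * 5 + 3) + ((m * (n * 10 + 15) + 9) +
     (1 + (1 + (1 + (1 + 1 + 1) + 1) + 1) + 1) + 1) + 1) + 1 \<le> read_time n" using v unfolding read_time_def by linarith
  qed
  moreover have "cnt s4 = (\<lambda>z. if z = 0 then n else if z = 4 then v else 0)"
    using s1(2,4) s2(2,3) s3(2) by (auto simp: s4_def fun_eq_iff)
  moreover have "arr s4 = (arr s)(13 := (\<lambda>q. q \<le> m))" using s1(5) s2(4) s3(3) by (simp add: s4_def)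
  ultimately show ?thesis unfolding s_def by blast
qed

lemma poly_bounded_read_time: "poly_bounded read_time"
  unfolding read_time_def by (intro poly_bounded_add poly_bounded_mult poly_bounded_id poly_bounded_const)

text \<open>Counters 1 to 3 are scratch, and those from 30 on are left to the quantifiers.\<close>

definition program_vars :: "nat set" where "program_vars = insert 0 {4..<30}"

definition program :: com where
  "program = read_input ;; compile init_cmd ;; Loop (Test 0 (Arr 3) False) (compile fas_body) ;;
     compile prep_cmd ;; Loop (Test 0 (Arr 3) False) (compile search_body) ;; ev (B1 17 0)"

lemma admissible_program_vars: "admissible program_vars" by (simp add: admissible_def program_vars_def)

lemma wfc_cmds: "wfc program_vars init_cmd" "wfc program_vars fas_body" "wfc program_vars prep_cmd" "wfc program_vars search_body"
  by (simp_all add: program_vars_def init_cmd_def fas_body_def prep_cmd_def search_body_def fill_def copy1_def copy2_def odo_cmd_def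
      fas_cmd_def fas_step_def rev_cmd_def cycf_def check_cmd_def stage_cmd_def aff_step_def una_step_def
      parent_fm_def child_fm_def)

text \<open>\<open>a\<close> is the number of affected players, two for each reversed arc and one
  for \<open>v\<close>. The two summands in the time are the rounds of the two searches; all other
  work is absorbed in \<open>f\<close>.\<close>

lemma program_correct:
  "\<exists>f. poly_bounded f \<and> (\<forall>m n D v (r::nat \<Rightarrow> nat). n = 2 ^ m \<longrightarrow> tournament n D \<longrightarrow> v < n \<longrightarrow> inj_on r {..<n} \<longrightarrow>
     (\<exists>s' a. a \<le> 2 * card (back_arcs r D) + 1 \<and>
       runs program (init_store (encode n D v)) (f n * (4 ^ card (back_arcs r D) + a ^ a * (m + 1) ^ a + 1)) s' \<and>
       flag s' = TFP m n D v))"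
proof -
  from compile_correct[OF admissible_program_vars wfc_cmds(1)] obtain f1 where f1: "poly_bounded f1"
    "\<And>s t. agree program_vars s t \<Longrightarrow> \<exists>t'. runs (compile init_cmd) t (f1 (cnt s 0)) t' \<and> agree program_vars (den init_cmd s) t'"
    unfolding comps_def by blast
  from runs_while[OF admissible_program_vars wfc_cmds(2)] obtain f2 where f2: "poly_bounded f2"
    "\<And>s t k. agree program_vars s t \<Longrightarrow> (\<forall>j<k. \<not> arr ((den fas_body ^^ j) s) 3 (cnt s 0)) \<Longrightarrow> arr ((den fas_body ^^ k) s) 3 (cnt s 0) \<Longrightarrow>
      \<exists>t'. runs (Loop (Test 0 (Arr 3) False) (compile fas_body)) t (k * f2 (cnt s 0) + 1) t' \<and> agree program_vars ((den fas_body ^^ k) s) t'"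
    by blast
  from compile_correct[OF admissible_program_vars wfc_cmds(3)] obtain f3 where f3: "poly_bounded f3"
    "\<And>s t. agree program_vars s t \<Longrightarrow> \<exists>t'. runs (compile prep_cmd) t (f3 (cnt s 0)) t' \<and> agree program_vars (den prep_cmd s) t'"
    unfolding comps_def by blast
  from runs_while[OF admissible_program_vars wfc_cmds(4)] obtain f4 where f4: "poly_bounded f4"
    "\<And>s t k. agree program_vars s t \<Longrightarrow> (\<forall>j<k. \<not> arr ((den search_body ^^ j) s) 3 (cnt s 0)) \<Longrightarrow> arr ((den search_body ^^ k) s) 3 (cnt s 0) \<Longrightarrow>
      \<exists>t'. runs (Loop (Test 0 (Arr 3) False) (compile search_body)) t (k * f4 (cnt s 0) + 1) t' \<and> agree program_vars ((den search_body ^^ k) s) t'"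
    by blast
  have "wff program_vars (B1 17 0)" by (simp add: program_vars_def)
  from ev_correct[OF admissible_program_vars this] obtain f5 where f5: "poly_bounded f5"
    "\<And>s t. agree program_vars s t \<Longrightarrow> \<exists>t'. runs (ev (B1 17 0)) t (f5 (cnt s 0)) t' \<and> agree program_vars s t' \<and> flag t' = sem (B1 17 0) s"
    unfolding evals_def by blast
  define f where "f = (\<lambda>n. read_time n + f1 n + f2 n + f3 n + f4 n + f5 n + 10)"
  have "poly_bounded f" unfolding f_def by (intro poly_bounded_add poly_bounded_const poly_bounded_read_time f1 f2 f3 f4 f5)
  moreover have "\<exists>s' a. a \<le> 2 * card (back_arcs r D) + 1 \<and>
       runs program (init_store (encode n D v)) (f n * (4 ^ card (back_arcs r D) + a ^ a * (m + 1) ^ a + 1)) s' \<and>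
       flag s' = TFP m n D v"
    if n: "n = 2 ^ m" and T: "tournament n D" and v: "v < n" and inj: "inj_on r {..<n}" for m n D v and r :: "nat \<Rightarrow> nat"
  proof -
    let ?w = "init_store (encode n D v)"
    let ?b = "card (back_arcs r D)"
    note e = init_store_encode[where n = n and D = D and v = v]
    obtain s0 where r0: "runs read_input ?w (read_time n) s0" and
      c0: "cnt s0 = (\<lambda>z. if z = 0 then n else if z = 4 then v else 0)" and a0: "arr s0 = (arr ?w)(13 := (\<lambda>q. q \<le> m))"
      using runs_read_input[OF n v] by blast
    have D0: "rel 0 s0 = D" using e(6) c0 a0 tournament_less[OF T] by (auto simp: rel_def fun_eq_iff)
    have z0: "arr s0 a = (\<lambda>_. False)" if "a \<notin> {0, 1, 13}" for a using e(7)[of a] a0 that by simp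
    have n0: "cnt s0 0 = n" using c0 by simp
    have "agree program_vars s0 s0" using c0 v by (auto simp: agree_def)
    from f1(2)[OF this] n0 obtain t1 where t1: "runs (compile init_cmd) s0 (f1 n) t1" "agree program_vars (den init_cmd s0) t1" by auto
    define s1 where "s1 = den init_cmd s0"
    have n1: "cnt s1 0 = n" using init_cmd_frame(1)[of 0 s0] n0 by (simp add: s1_def)
    obtain k s2 where k: "k \<le> 4 ^ ?b" "s2 = (den fas_body ^^ k) s1" "\<forall>j<k. \<not> arr ((den fas_body ^^ j) s1) 3 n" "arr s2 3 n"
      "\<exists>r'. ordered n D (elems 5 s2) r'" "card (elems 5 s2) \<le> 2 * ?b"
      using fas_phase[OF n0 n D0 T inj] z0 unfolding s1_def by auto
    obtain t2 where t2: "runs (Loop (Test 0 (Arr 3) False) (compile fas_body)) t1 (k * f2 n + 1) t2" "agree program_vars s2 t2"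
      using f2(2)[OF t1(2), of k] k n1 unfolding s1_def by auto
    have c2: "cnt s2 z = cnt s0 z" if "z \<in> {0, 4}" for z
    proof -
      have "cnt ((den fas_body ^^ j) s1) z = cnt s1 z" for j
        by (induction j) (use fas_body_frame(1)[of z] that in auto)
      then show ?thesis using init_cmd_frame(1)[of z s0] that k(2) by (auto simp: s1_def)
    qed
    have a2: "arr s2 a = arr s0 a" if "a \<in> {0, 11, 12, 13, 17}" for a
    proof -
      have "arr ((den fas_body ^^ j) s1) a = arr s1 a" for j
        by (induction j) (use fas_body_frame(2)[of a] that in auto)
      then show ?thesis using init_cmd_frame(2)[of a s0] that k(2) by (auto simp: s1_def)
    qed
    have n2: "cnt s2 0 = n" "cnt s2 4 = v" using c2 c0 by auto
    from f3(2)[OF t2(2)] n2 obtain t3 where t3: "runs (compile prep_cmd) t2 (f3 n) t3" "agree program_vars (den prep_cmd s2) t3" by auto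
    define s3 where "s3 = den prep_cmd s2"
    define A where "A = insert v (elems 5 s2)"
    have z2: "arr s2 11 = (\<lambda>_. False)" "arr s2 12 = (\<lambda>_. False)" "arr s2 17 = (\<lambda>_. False)" using a2 z0 by auto
    note p = den_prep_cmd[OF n2 v z2(1,2), folded s3_def A_def]
    have n3: "cnt s3 0 = n" "cnt s3 4 = v" using prep_cmd_frame(1)[of _ s2] n2 by (auto simp: s3_def)
    have a3: "arr s3 a = arr s2 a" if "a \<notin> {3, 5, 11, 12}" for a using prep_cmd_frame(2)[OF that] by (simp add: s3_def)
    have D3: "rel 0 s3 = D" using rel_frame[of s3 s2 0] rel_frame[of s2 s0 0] n3 n2 n0 a3 a2 D0 by simp
    have L: "arr s3 13 q \<longleftrightarrow> q \<le> m" if "q < n" for q using a3[of 13] a2[of 13] a0 by simp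
    have fA: "first n (\<lambda>q. q \<in> A) = first n (arr s3 5)"
      by (rule first_cong) (use p(1) n3 in \<open>auto simp: elems_def\<close>)
    have "search_inv n D v A (arr s3 5) (arr s3 13) (\<lambda>_. 0) (\<lambda>_. first n (arr s3 5)) s3"
      unfolding search_inv_def Env_def using n3 v D3 p a3[of 17] z2(3) fA by simp
    moreover obtain r' where "ordered n D (elems 5 s2) r'" using k(5) by blast
    then have "ordered n D A r'" by (auto simp: ordered_def A_def)
    moreover have vA: "v \<in> A" by (simp add: A_def)
    ultimately obtain l s4 where l: "l \<le> card A ^ card A * (m + 1) ^ card A" "s4 = (den search_body ^^ l) s3"
      "\<forall>j<l. \<not> arr ((den search_body ^^ j) s3) 3 n" "arr s4 3 n" "arr s4 17 n \<longleftrightarrow> TFP m n D v"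
      using search_phase[OF T n v vA _ _ L] by blast
    obtain t4 where t4: "runs (Loop (Test 0 (Arr 3) False) (compile search_body)) t3 (l * f4 n + 1) t4" "agree program_vars s4 t4"
      using f4(2)[OF t3(2), of l] l n3 unfolding s3_def by auto
    have n4: "cnt s4 0 = n"
    proof -
      have "cnt ((den search_body ^^ j) s3) 0 = n" for j
        by (induction j) (use cnt0_den[OF wfc_cmds(4)] n3 in auto)
      then show ?thesis using l(2) by simp
    qed
    from f5(2)[OF t4(2)] n4 obtain t5 where t5: "runs (ev (B1 17 0)) t4 (f5 n) t5" "flag t5 = sem (B1 17 0) s4" by auto
    have fl: "flag t5 = TFP m n D v" using t5(2) n4 l(5) by simp
    have "runs program ?w (read_time n + (f1 n + ((k * f2 n + 1) + (f3 n + ((l * f4 n + 1) + f5 n + 1) + 1) + 1) + 1) + 1) t5"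
      unfolding program_def
      by (rule runs_Then[OF r0 runs_Then[OF t1(1) runs_Then[OF t2(1) runs_Then[OF t3(1) runs_Then[OF t4(1) t5(1)]]]]])
    moreover have "read_time n + (f1 n + ((k * f2 n + 1) + (f3 n + ((l * f4 n + 1) + f5 n + 1) + 1) + 1) + 1) + 1
      \<le> f n * (4 ^ ?b + card A ^ card A * (m + 1) ^ card A + 1)"
    proof -
      have "k * f2 n \<le> f n * 4 ^ ?b" using k(1) by (subst mult.commute) (intro mult_le_mono, auto simp: f_def)
      moreover have "l * f4 n \<le> f n * (card A ^ card A * (m + 1) ^ card A)"
        using l(1) by (subst mult.commute) (intro mult_le_mono, auto simp: f_def)
      moreover have "read_time n + f1 n + f3 n + f5 n + 10 \<le> f n" by (simp add: f_def)
      ultimately show ?thesis unfolding distrib_left mult_1_right by linarith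
    qed
    ultimately have "runs program ?w (f n * (4 ^ ?b + card A ^ card A * (m + 1) ^ card A + 1)) t5" by (rule runs_mono)
    moreover have "card A \<le> 2 * ?b + 1"
    proof -
      have "finite (elems 5 s2)" by (simp add: elems_def)
      then show ?thesis using k(6) by (simp add: A_def card_insert_if)
    qed
    ultimately show ?thesis using fl by blast
  qed
  ultimately show ?thesis by blast
qed

section \<open>The running time\<close>

text \<open>A power of \<open>log n\<close> is traded for a factorial and a power of two: with
  \<open>x = m + 1\<close> the latter is \<open>2 * n * 2 ^ s\<close>. The reason is that
  \<open>x ^ s\<close> is at most \<open>(x + 1) * ... * (x + s)\<close>, which is \<open>s!\<close>
  times a binomial coefficient.\<close>

lemma power_le_fact_mult: "(x::nat) ^ s \<le> fact s * 2 ^ (x + s)"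
proof -
  have 1: "fact x * x ^ s \<le> (fact (x + s) :: nat)"
  proof (induction s)
    case (Suc s)
    have "fact x * x ^ Suc s = x * (fact x * x ^ s)" by simp
    also have "\<dots> \<le> (x + s + 1) * fact (x + s)" using Suc by (intro mult_le_mono) auto
    finally show ?case by simp
  qed simp
  have "fact s * fact x * (x + s choose s) = (fact (x + s) :: nat)"
    using binomial_fact_lemma[of s "x + s"] by simp
  then have "fact x * x ^ s \<le> fact x * (fact s * (x + s choose s))" using 1 by (simp add: ac_simps)
  then have "x ^ s \<le> fact s * (x + s choose s)" by simp
  also have "\<dots> \<le> fact s * 2 ^ (x + s)" by (intro mult_le_mono2 binomial_le_pow2)
  finally show ?thesis .
qed

text \<open>Everything is measured in \<open>E\<close>. The guesses contribute \<open>E ^ 5\<close>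
  for the parents and \<open>4 * n ^ 3 * E ^ 4\<close> for the stages; the other two terms are at
  most \<open>n ^ 3 * E ^ 9\<close> each, which makes the 6.\<close>

lemma search_space_bound:
  fixes m n b a :: nat
  assumes n: "n = 2 ^ m" and a: "a \<le> 2 * b + 1"
  defines "E \<equiv> (b + 2) ^ b"
  shows "4 ^ b + a ^ a * (m + 1) ^ a + 1 \<le> 6 * n ^ 3 * E ^ 9"
proof -
  have E1: "1 \<le> E" and n1: "1 \<le> n" by (simp_all add: E_def n)
  have E2: "2 ^ b \<le> E" unfolding E_def by (rule power_mono) auto
  have "(4::nat) ^ b = (2 ^ b) ^ 2" by (induction b) (auto simp: power2_eq_square)
  then have p4: "4 ^ b \<le> E ^ 2" using E2 by (simp add: power_mono)
  have lin: "2 * b + 1 \<le> E"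
  proof (cases "b = 0")
    case False
    have "2 * b + 1 \<le> 3 ^ b" by (induction b) auto
    also have "\<dots> \<le> E" unfolding E_def using False by (intro power_mono) auto
    finally show ?thesis .
  qed (simp add: E_def)
  have aa: "a ^ a \<le> E ^ 5"
  proof -
    have "a ^ a \<le> (2 * b + 1) ^ a" using a by (intro power_mono) auto
    also have "\<dots> \<le> (2 * b + 1) ^ (2 * b + 1)" using a by (intro power_increasing) auto
    also have "\<dots> = (2 * b + 1) ^ (2 * b) * (2 * b + 1)" by simp
    also have "\<dots> \<le> ((b + 2) ^ 2) ^ (2 * b) * E"
      using lin by (intro mult_le_mono power_mono) (auto simp: power2_eq_square)
    also have "((b + 2) ^ 2) ^ (2 * b) = E ^ 4" unfolding E_def by (simp flip: power_mult add: mult.commute)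
    also have "E ^ 4 * E = E ^ 5" by (simp add: eval_nat_numeral)
    finally show ?thesis .
  qed
  \<comment> \<open>Both \<open>b!\<close> and \<open>2 ^ b\<close> are at most \<open>E\<close>,
    and \<open>2 ^ (m + 1) = 2 * n\<close>.\<close>
  have mb: "(m + 1) ^ b \<le> 2 * n * E ^ 2"
  proof -
    have "(m + 1) ^ b \<le> fact b * 2 ^ (m + 1 + b)" by (rule power_le_fact_mult)
    also have "\<dots> = fact b * (2 * n * 2 ^ b)" by (simp add: n power_add)
    also have "\<dots> \<le> E * (2 * n * E)"
    proof (intro mult_le_mono order_refl E2)
      have "fact b \<le> b ^ b" using fact_le_power[of b, where 'a = nat] by simp
      also have "\<dots> \<le> E" unfolding E_def by (rule power_mono) auto
      finally show "fact b \<le> E" .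
    qed
    finally show ?thesis by (simp add: power2_eq_square ac_simps)
  qed
  \<comment> \<open>Twice the exponent \<open>b\<close> and one factor \<open>m + 1\<close>, which
    is at most \<open>n\<close>.\<close>
  have ma: "(m + 1) ^ a \<le> 4 * n ^ 3 * E ^ 4"
  proof -
    have "(m + 1) ^ a \<le> (m + 1) ^ (2 * b + 1)" using a by (intro power_increasing) auto
    also have "\<dots> = (m + 1) ^ b * (m + 1) ^ b * (m + 1)" by (simp add: power_add mult_2)
    also have "\<dots> \<le> (2 * n * E ^ 2) * (2 * n * E ^ 2) * n"
      using mb less_exp[of m] n by (intro mult_le_mono) (auto simp: Suc_le_eq)
    also have "\<dots> = 4 * n ^ 3 * E ^ 4" by (simp add: eval_nat_numeral algebra_simps)
    finally show ?thesis .
  qed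
  have "a ^ a * (m + 1) ^ a \<le> E ^ 5 * (4 * n ^ 3 * E ^ 4)" using aa ma by (rule mult_le_mono)
  also have "\<dots> = 4 * n ^ 3 * E ^ 9" by (simp flip: power_add add: ac_simps)
  finally have 1: "a ^ a * (m + 1) ^ a \<le> 4 * n ^ 3 * E ^ 9" .
  have "E ^ 2 \<le> E ^ 9" using E1 by (intro power_increasing) auto
  moreover have "E ^ 9 \<le> n ^ 3 * E ^ 9" "1 \<le> n ^ 3 * E ^ 9" using n1 E1 by auto
  ultimately show ?thesis using 1 p4 by linarith
qed

theorem theorem3:
  "\<exists>M c. wf_tm M \<and> c > 0 \<and>
     (\<forall>k n D v. n = 2 ^ k \<and> tournament n D \<and> v < n \<longrightarrow>
        (\<exists>t. decides_within M (encode n D v) t (TFP k n D v) \<and>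
             real t \<le> c * 2 powr (c * real (sfas_in D v + sfas_out D v)
                                   * log 2 (real (sfas_in D v + sfas_out D v) + 2))
                      * real n powr c))"
proof -
  obtain f where f: "poly_bounded f" "\<And>m n D v (r::nat \<Rightarrow> nat). n = 2 ^ m \<Longrightarrow> tournament n D \<Longrightarrow> v < n \<Longrightarrow> inj_on r {..<n} \<Longrightarrow>
     (\<exists>s' a. a \<le> 2 * card (back_arcs r D) + 1 \<and>
       runs program (init_store (encode n D v)) (f n * (4 ^ card (back_arcs r D) + a ^ a * (m + 1) ^ a + 1)) s' \<and>
       flag s' = TFP m n D v)" using program_correct by metis
  obtain e where e: "\<And>n. f n \<le> (n + 2) ^ e" using f(1) unfolding poly_bounded_def by blast
  obtain M where M: "wf_tm M" "\<And>w T s'. set w \<subseteq> {1, 2, 3} \<Longrightarrow> runs program (init_store w) T s' \<Longrightarrow>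
     decides_within M w (1 + (T + 1) * (2 * T + 5)) (flag s')" using com_to_tm[of program] by blast
  \<comment> \<open>\<open>3 ^ e\<close> comes from \<open>n + 2 <= 3 * n\<close>, and 6 from
    \<open>search_space_bound\<close>.\<close>
  define C where "C = 3 ^ e * (6::nat)"
  \<comment> \<open>A sum, so that one constant exceeds the leading factor \<open>15 * C ^ 2\<close>
    and the exponents 18 of \<open>E\<close> and \<open>2 * (e + 3)\<close> of \<open>n\<close>,
    which arise by squaring \<open>U\<close>.\<close>
  define c where "c = real (15 * C ^ 2 + 2 * (e + 3) + 18)"
  have "\<exists>t. decides_within M (encode n D v) t (TFP k n D v) \<and>
             real t \<le> c * 2 powr (c * real (sfas_in D v + sfas_out D v)
                                   * log 2 (real (sfas_in D v + sfas_out D v) + 2)) * real n powr c"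
    if n: "n = 2 ^ k" and T: "tournament n D" and v: "v < n" for k n D v
  proof -
    define s where "s = sfas_in D v + sfas_out D v"
    obtain r :: "nat \<Rightarrow> nat" where r: "inj_on r {..<n}" "card (back_arcs r D) \<le> s"
      using back_arcs_le_sfas[OF T v] unfolding s_def back_arcs_def by blast
    define b where "b = card (back_arcs r D)"
    obtain s' a where a: "a \<le> 2 * b + 1" "flag s' = TFP k n D v"
      and run: "runs program (init_store (encode n D v)) (f n * (4 ^ b + a ^ a * (k + 1) ^ a + 1)) s'"
      using f(2)[OF n T v r(1)] unfolding b_def by blast
    define E where "E = (s + 2) ^ s"
    define U where "U = C * n ^ (e + 3) * E ^ 9"
    have n1: "1 \<le> n" using v by simp
    have E1: "1 \<le> E" by (simp add: E_def)
    have bE: "(b + 2) ^ b \<le> E"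
    proof -
      have "(b + 2) ^ b \<le> (s + 2) ^ b" using r(2) by (intro power_mono) (auto simp: b_def)
      also have "\<dots> \<le> E" unfolding E_def using r(2) by (intro power_increasing) (auto simp: b_def)
      finally show ?thesis .
    qed
    have "f n * (4 ^ b + a ^ a * (k + 1) ^ a + 1) \<le> U"
    proof -
      have "f n \<le> (3 * n) ^ e" using e[of n] power_mono[of "n + 2" "3 * n" e] n1 by simp
      moreover have "4 ^ b + a ^ a * (k + 1) ^ a + 1 \<le> 6 * n ^ 3 * E ^ 9"
        using search_space_bound[OF n a(1)] power_mono[OF bE, of 9] by (meson le_trans mult_le_mono2 zero_le)
      ultimately have "f n * (4 ^ b + a ^ a * (k + 1) ^ a + 1) \<le> (3 * n) ^ e * (6 * n ^ 3 * E ^ 9)" by (rule mult_le_mono)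
      also have "\<dots> = U" by (simp add: U_def C_def power_mult_distrib power_add ac_simps)
      finally show ?thesis .
    qed
    then have "runs program (init_store (encode n D v)) U s'" using run by (rule runs_mono[rotated])
    from M(2)[OF set_encode this] have dec: "decides_within M (encode n D v) (1 + (U + 1) * (2 * U + 5)) (TFP k n D v)"
      using a(2) by simp
    have "1 \<le> U" using n1 E1 by (simp add: U_def C_def)
    then have "1 + (U + 1) * (2 * U + 5) \<le> 1 * U ^ 2 + (2 * U) * (7 * U)"
      by (intro add_mono mult_le_mono) (auto simp: power2_eq_square)
    also have "\<dots> = 15 * U ^ 2" by (simp add: power2_eq_square)
    also have "\<dots> = 15 * C ^ 2 * (E ^ 18 * n ^ (2 * (e + 3)))"
      by (simp add: U_def power_mult_distrib ac_simps flip: power_mult)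
    finally have "real (1 + (U + 1) * (2 * U + 5)) \<le> real (15 * C ^ 2) * (real E ^ 18 * real n ^ (2 * (e + 3)))"
      by (metis of_nat_le_iff of_nat_mult of_nat_power)
    also have "\<dots> \<le> c * (real E powr c * real n powr c)"
    proof (intro mult_mono)
      show "real (15 * C ^ 2) \<le> c" unfolding c_def by (simp only: of_nat_le_iff)
      have "real E ^ 18 = real E powr real 18" using E1 by (subst powr_realpow) auto
      also have "\<dots> \<le> real E powr c" using E1 unfolding c_def by (intro powr_mono) auto
      finally show "real E ^ 18 \<le> real E powr c" .
      have "real n ^ (2 * (e + 3)) = real n powr real (2 * (e + 3))" using n1 by (subst powr_realpow) auto
      also have "\<dots> \<le> real n powr c" using n1 unfolding c_def by (intro powr_mono) auto
      finally show "real n ^ (2 * (e + 3)) \<le> real n powr c" .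
    qed (auto simp: c_def)
    \<comment> \<open>\<open>E = (s + 2) ^ s\<close> is \<open>2 ^ (s * log 2 (s + 2))\<close>; the
      shift by 2 keeps the logarithm defined and positive for \<open>s = 0\<close>.\<close>
    also have "real E powr c = 2 powr (c * real s * log 2 (real s + 2))"
    proof -
      have "2 powr (c * real s * log 2 (real s + 2)) = (2 powr log 2 (real s + 2)) powr (real s * c)"
        unfolding powr_powr by (simp only: ac_simps)
      also have "2 powr log 2 (real s + 2) = real s + 2" by simp
      also have "(real s + 2) powr (real s * c) = ((real s + 2) powr real s) powr c" by (simp only: powr_powr)
      also have "(real s + 2) powr real s = real E" by (subst powr_realpow) (auto simp: E_def add.commute)
      finally show ?thesis by simp
    qed
    finally have "real (1 + (U + 1) * (2 * U + 5)) \<le> c * 2 powr (c * real s * log 2 (real s + 2)) * real n powr c"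
      by (simp only: mult.assoc)
    then show ?thesis using dec unfolding s_def by blast
  qed
  moreover have "c > 0" unfolding c_def of_nat_0_less_iff by simp
  ultimately show ?thesis using M(1) by blast
qed

end
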